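(* Let $k$ be a commutative ring, $S=k[x_1,\ldots,x_n]$, $\prec$ a monomial order, and $\Delta\subset\mathbb{N}^n$ a standard set of finite size $d\ge1$. Write $\mathbb{A}^1_k={\rm Spec}\,k[t]$. There exists a morphism $$g:\mathbb{A}^1_{k}\times_{{\rm Spec}\,k}{\rm Hilb}^{\prec\Delta}_{S/k}\to{\rm Hilb}^{\prec\Delta}_{S/k}$$ of $k$-schemes such that - the restriction of $g$ to the closed subscheme $\{t=1\}\times_{{\rm Spec}\,k}{\rm Hilb}^{\prec\Delta}_{S/k}$ is the identity; and - for each point $p$ of ${\rm Hilb}^{\prec\Delta}_{S/k}$, the restriction of $g$ to $\mathbb{A}^1_{k}\times_{{\rm Spec}\,k}p$ is a curve on ${\rm Hilb}^{\prec\Delta}_{S/k}$ which connects $p$ (the value at $t=1$) with the point defined by the monomial ideal $(x^\alpha;\alpha\in\mathbb{N}^n-\Delta)\subset S$ (the value at $t=0$). In particular, if ${\rm Spec}\,k$ is connected, then ${\rm Hilb}^{\prec\Delta}_{S/k}$ is connected as well.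
   Context: All rings are commutative with $1$; $x^\alpha=x_1^{\alpha_1}\cdots x_n^{\alpha_n}$ for $\alpha\in\mathbb{N}^n$, and $B[x]=B[x_1,\ldots,x_n]$. A standard set is a subset $\Delta\subset\mathbb{N}^n$ with $(\mathbb{N}^n-\Delta)+\mathbb{N}^n\subset\mathbb{N}^n-\Delta$. For an ideal $I\subset B[x]$, the standard set attached to $I$ is the complement in $\mathbb{N}^n$ of the set of leading exponents (w.r.t. $\prec$) of nonzero elements of $I$; $I$ is monic if for each monomial $x^\alpha$ the ideal of $B$ consisting of $0$ and all leading coefficients of those $f\in I-\{0\}$ with leading exponent $\alpha$ is the zero or the unit ideal. ${\rm Hilb}^{\prec\Delta}_{S/k}$ is the affine $k$-scheme representing the functor sending a $k$-algebra $B$ to the set of monic ideals in $B[x]$ with attached standard set $\Delta$ (one-element set for $B=0$ by convention), where $B\to A$ sends an ideal to the ideal it generates in $A[x]$. The monomial ideal $(x^\alpha;\alpha\in\mathbb{N}^n-\Delta)\subset S$ defines a section ${\rm Spec}\,k\to{\rm Hilb}^{\prec\Delta}_{S/k}$; for a point $p$ with residue field $\kappa(p)$, "the point defined by the monomial ideal" is the composite ${\rm Spec}\,\kappa(p)\to{\rm Spec}\,k\to{\rm Hilb}^{\prec\Delta}_{S/k}$, and "curve" means the morphism $\mathbb{A}^1_{\kappa(p)}\to{\rm Hilb}^{\prec\Delta}_{S/k}$ obtained from $g$ (possibly constant). *)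

theory Defs
  imports "HOL-Algebra.Algebra" "HOL-Analysis.Abstract_Topology"
begin

text \<open>
  Rings are records over a carrier set. A $k$-algebra is a commutative ring $B$ together with a
  structure map $b \in$ \<open>ring_hom k B\<close>.
\<close>

definition kalgebra ::
    "('a, 'm) ring_scheme \<Rightarrow> ('b, 'n) ring_scheme \<Rightarrow> ('a \<Rightarrow> 'b) \<Rightarrow> bool" where
  "kalgebra k B b \<longleftrightarrow> cring k \<and> cring B \<and> b \<in> ring_hom k B"

text \<open>Homomorphisms are made extensional so that uniqueness can be phrased with equality.\<close>

definition kalgebra_hom ::
    "('a, 'm) ring_scheme \<Rightarrow> ('b, 'n) ring_scheme \<Rightarrow> ('a \<Rightarrow> 'b) \<Rightarrow>
     ('c, 'l) ring_scheme \<Rightarrow> ('a \<Rightarrow> 'c) \<Rightarrow> ('b \<Rightarrow> 'c) set" where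
  "kalgebra_hom k B b C c =
     {h \<in> ring_hom B C \<inter> extensional (carrier B). \<forall>x\<in>carrier k. h (b x) = c x}"


section \<open>Polynomials in $n$ variables, monomial orders and standard sets\<close>

text \<open>$\mathbb{N}^n$ is the set of functions \<open>nat \<Rightarrow> nat\<close> that vanish outside \<open>{..<n}\<close>.\<close>

definition expo :: "nat \<Rightarrow> (nat \<Rightarrow> nat) set" where
  "expo n = {\<alpha>. \<forall>i\<ge>n. \<alpha> i = 0}"

definition expo_add :: "(nat \<Rightarrow> nat) \<Rightarrow> (nat \<Rightarrow> nat) \<Rightarrow> nat \<Rightarrow> nat" where
  "expo_add \<alpha> \<beta> = (\<lambda>i. \<alpha> i + \<beta> i)"

definition mpoly :: "nat \<Rightarrow> ('a, 'm) ring_scheme \<Rightarrow> ((nat \<Rightarrow> nat) \<Rightarrow> 'a) ring" where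
  "mpoly n B =
     \<lparr>carrier = {f. range f \<subseteq> carrier B \<and> {\<alpha>. f \<alpha> \<noteq> \<zero>\<^bsub>B\<^esub>} \<subseteq> expo n \<and> finite {\<alpha>. f \<alpha> \<noteq> \<zero>\<^bsub>B\<^esub>}},
      monoid.mult = (\<lambda>f g \<gamma>. if \<gamma> \<in> expo n
                then finsum B (\<lambda>\<alpha>. f \<alpha> \<otimes>\<^bsub>B\<^esub> g (\<lambda>i. \<gamma> i - \<alpha> i)) {\<alpha>. \<forall>i. \<alpha> i \<le> \<gamma> i}
                else \<zero>\<^bsub>B\<^esub>),
      one = (\<lambda>\<gamma>. if \<gamma> = (\<lambda>_. 0) then \<one>\<^bsub>B\<^esub> else \<zero>\<^bsub>B\<^esub>),
      ring.zero = (\<lambda>_. \<zero>\<^bsub>B\<^esub>),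
      add = (\<lambda>f g \<gamma>. f \<gamma> \<oplus>\<^bsub>B\<^esub> g \<gamma>)\<rparr>"

definition mono_poly :: "('a, 'm) ring_scheme \<Rightarrow> (nat \<Rightarrow> nat) \<Rightarrow> (nat \<Rightarrow> nat) \<Rightarrow> 'a" where
  "mono_poly B \<alpha> = (\<lambda>\<gamma>. if \<gamma> = \<alpha> then \<one>\<^bsub>B\<^esub> else \<zero>\<^bsub>B\<^esub>)"

text \<open>The reflexive form of the order: \<open>(\<alpha>, \<beta>) \<in> r\<close> means $\alpha \preceq \beta$.\<close>

definition monomial_order :: "nat \<Rightarrow> ((nat \<Rightarrow> nat) \<times> (nat \<Rightarrow> nat)) set \<Rightarrow> bool" where
  "monomial_order n r \<longleftrightarrow> well_order_on (expo n) r \<and>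
     (\<forall>\<alpha> \<beta>. (\<alpha>, \<beta>) \<in> r \<longrightarrow> (\<forall>\<gamma>\<in>expo n. (expo_add \<alpha> \<gamma>, expo_add \<beta> \<gamma>) \<in> r))"

definition standard_set :: "nat \<Rightarrow> (nat \<Rightarrow> nat) set \<Rightarrow> bool" where
  "standard_set n \<Delta> \<longleftrightarrow> \<Delta> \<subseteq> expo n \<and>
     (\<forall>\<alpha>\<in>expo n - \<Delta>. \<forall>\<beta>\<in>expo n. expo_add \<alpha> \<beta> \<in> expo n - \<Delta>)"

definition lead_exp ::
    "((nat \<Rightarrow> nat) \<times> (nat \<Rightarrow> nat)) set \<Rightarrow> ('a, 'm) ring_scheme \<Rightarrow> ((nat \<Rightarrow> nat) \<Rightarrow> 'a) \<Rightarrow> nat \<Rightarrow> nat" where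
  "lead_exp r B f = (THE \<alpha>. f \<alpha> \<noteq> \<zero>\<^bsub>B\<^esub> \<and> (\<forall>\<beta>. f \<beta> \<noteq> \<zero>\<^bsub>B\<^esub> \<longrightarrow> (\<beta>, \<alpha>) \<in> r))"

definition attached_standard_set ::
    "nat \<Rightarrow> ((nat \<Rightarrow> nat) \<times> (nat \<Rightarrow> nat)) set \<Rightarrow> ('a, 'm) ring_scheme \<Rightarrow>
     ((nat \<Rightarrow> nat) \<Rightarrow> 'a) set \<Rightarrow> (nat \<Rightarrow> nat) set" where
  "attached_standard_set n r B I = expo n - lead_exp r B ` (I - {\<zero>\<^bsub>mpoly n B\<^esub>})"

definition lead_coeffs ::
    "nat \<Rightarrow> ((nat \<Rightarrow> nat) \<times> (nat \<Rightarrow> nat)) set \<Rightarrow> ('a, 'm) ring_scheme \<Rightarrow>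
     ((nat \<Rightarrow> nat) \<Rightarrow> 'a) set \<Rightarrow> (nat \<Rightarrow> nat) \<Rightarrow> 'a set" where
  "lead_coeffs n r B I \<alpha> =
     {\<zero>\<^bsub>B\<^esub>} \<union> {f \<alpha> | f. f \<in> I - {\<zero>\<^bsub>mpoly n B\<^esub>} \<and> lead_exp r B f = \<alpha>}"

definition monic_ideal ::
    "nat \<Rightarrow> ((nat \<Rightarrow> nat) \<times> (nat \<Rightarrow> nat)) set \<Rightarrow> ('a, 'm) ring_scheme \<Rightarrow>
     ((nat \<Rightarrow> nat) \<Rightarrow> 'a) set \<Rightarrow> bool" where
  "monic_ideal n r B I \<longleftrightarrow> ideal I (mpoly n B) \<and>
     (\<forall>\<alpha>\<in>expo n. lead_coeffs n r B I \<alpha> = {\<zero>\<^bsub>B\<^esub>} \<or> lead_coeffs n r B I \<alpha> = carrier B)"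


section \<open>The functor and its representing algebra\<close>

text \<open>
  Over the zero ring the value is the one-element set consisting of the only ideal of the zero
  ring $B[x]$; its attached standard set would be $\mathbb{N}^n$.
\<close>

definition Hilb_functor ::
    "nat \<Rightarrow> ((nat \<Rightarrow> nat) \<times> (nat \<Rightarrow> nat)) set \<Rightarrow> (nat \<Rightarrow> nat) set \<Rightarrow> ('a, 'm) ring_scheme \<Rightarrow>
     ((nat \<Rightarrow> nat) \<Rightarrow> 'a) set set" where
  "Hilb_functor n r \<Delta> B =
     (if carrier B = {\<zero>\<^bsub>B\<^esub>} then {carrier (mpoly n B)}
      else {I. monic_ideal n r B I \<and> attached_standard_set n r B I = \<Delta>})"

definition extend_ideal ::
    "nat \<Rightarrow> ('b, 'm) ring_scheme \<Rightarrow> ('a \<Rightarrow> 'b) \<Rightarrow> ((nat \<Rightarrow> nat) \<Rightarrow> 'a) set \<Rightarrow> ((nat \<Rightarrow> nat) \<Rightarrow> 'b) set" where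
  "extend_ideal n A h I = genideal (mpoly n A) ((\<lambda>f \<alpha>. h (f \<alpha>)) ` I)"

text \<open>
  \<open>represents_Hilb k n r \<Delta> R c U\<close> says that the $k$-algebra $R$ (structure map $c$) represents the
  functor, with universal ideal $U \subset R[x]$. All test algebras have their carriers in the
  type \<open>'a\<close>, which plays the role of a universe. If \<open>'a\<close> is infinite, it contains copies of all
  $k$-algebras of finite type and in particular of the representing algebra, so the universal
  property determines $R$ up to a unique isomorphism and it holds for all $k$-algebras.
\<close>

definition represents_Hilb ::
    "'a ring \<Rightarrow> nat \<Rightarrow> ((nat \<Rightarrow> nat) \<times> (nat \<Rightarrow> nat)) set \<Rightarrow> (nat \<Rightarrow> nat) set \<Rightarrow>
     'a ring \<Rightarrow> ('a \<Rightarrow> 'a) \<Rightarrow> ((nat \<Rightarrow> nat) \<Rightarrow> 'a) set \<Rightarrow> bool" where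
  "represents_Hilb k n r \<Delta> R c U \<longleftrightarrow>
     kalgebra k R c \<and> U \<in> Hilb_functor n r \<Delta> R \<and>
     (\<forall>(B :: 'a ring) b. kalgebra k B b \<longrightarrow>
        (\<forall>I\<in>Hilb_functor n r \<Delta> B. \<exists>!h. h \<in> kalgebra_hom k R c B b \<and> extend_ideal n B h U = I))"

definition classifying_hom ::
    "'a ring \<Rightarrow> nat \<Rightarrow> 'a ring \<Rightarrow> ('a \<Rightarrow> 'a) \<Rightarrow> ((nat \<Rightarrow> nat) \<Rightarrow> 'a) set \<Rightarrow>
     'a ring \<Rightarrow> ('a \<Rightarrow> 'a) \<Rightarrow> ((nat \<Rightarrow> nat) \<Rightarrow> 'a) set \<Rightarrow> 'a \<Rightarrow> 'a" where
  "classifying_hom k n R c U B b I =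
     (THE h. h \<in> kalgebra_hom k R c B b \<and> extend_ideal n B h U = I)"

definition monomial_ideal ::
    "nat \<Rightarrow> (nat \<Rightarrow> nat) set \<Rightarrow> ('a, 'm) ring_scheme \<Rightarrow> ((nat \<Rightarrow> nat) \<Rightarrow> 'a) set" where
  "monomial_ideal n \<Delta> k = genideal (mpoly n k) (mono_poly k ` (expo n - \<Delta>))"


section \<open>Localization at a prime and residue fields\<close>

definition fraction :: "('a, 'm) ring_scheme \<Rightarrow> 'a set \<Rightarrow> 'a \<Rightarrow> 'a \<Rightarrow> ('a \<times> 'a) set" where
  "fraction R p a s = {(b, t). b \<in> carrier R \<and> t \<in> carrier R - p \<and>
     (\<exists>u\<in>carrier R - p. u \<otimes>\<^bsub>R\<^esub> (a \<otimes>\<^bsub>R\<^esub> t) = u \<otimes>\<^bsub>R\<^esub> (b \<otimes>\<^bsub>R\<^esub> s))}"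

definition localization :: "('a, 'm) ring_scheme \<Rightarrow> 'a set \<Rightarrow> ('a \<times> 'a) set ring" where
  "localization R p =
     \<lparr>carrier = {fraction R p a s | a s. a \<in> carrier R \<and> s \<in> carrier R - p},
      monoid.mult = (\<lambda>P Q. \<Union>(a, s)\<in>P. \<Union>(b, t)\<in>Q. fraction R p (a \<otimes>\<^bsub>R\<^esub> b) (s \<otimes>\<^bsub>R\<^esub> t)),
      one = fraction R p \<one>\<^bsub>R\<^esub> \<one>\<^bsub>R\<^esub>,
      ring.zero = fraction R p \<zero>\<^bsub>R\<^esub> \<one>\<^bsub>R\<^esub>,
      add = (\<lambda>P Q. \<Union>(a, s)\<in>P. \<Union>(b, t)\<in>Q.
               fraction R p (a \<otimes>\<^bsub>R\<^esub> t \<oplus>\<^bsub>R\<^esub> b \<otimes>\<^bsub>R\<^esub> s) (s \<otimes>\<^bsub>R\<^esub> t))\<rparr>"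

text \<open>The map $A_{h^{-1}(q)} \to B_q$ induced by a homomorphism $h : A \to B$.\<close>

definition localization_map ::
    "('b, 'm) ring_scheme \<Rightarrow> 'b set \<Rightarrow> ('a \<Rightarrow> 'b) \<Rightarrow> ('a \<times> 'a) set \<Rightarrow> ('b \<times> 'b) set" where
  "localization_map B q h P = (\<Union>(a, s)\<in>P. fraction B q (h a) (h s))"

definition localization_max_ideal :: "('a, 'm) ring_scheme \<Rightarrow> 'a set \<Rightarrow> ('a \<times> 'a) set set" where
  "localization_max_ideal R p = {fraction R p a s | a s. a \<in> p \<and> s \<in> carrier R - p}"

definition residue_field :: "('a, 'm) ring_scheme \<Rightarrow> 'a set \<Rightarrow> ('a \<times> 'a) set set ring" where
  "residue_field R p = localization R p Quot localization_max_ideal R p"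

definition residue_map :: "('a, 'm) ring_scheme \<Rightarrow> 'a set \<Rightarrow> 'a \<Rightarrow> ('a \<times> 'a) set set" where
  "residue_map R p a = localization_max_ideal R p +>\<^bsub>localization R p\<^esub> fraction R p a \<one>\<^bsub>R\<^esub>"


section \<open>Ringed spaces and morphisms of locally ringed spaces\<close>

record ('p, 's) ringed_space =
  rs_topology :: "'p topology"
  sections :: "'p set \<Rightarrow> 's ring"
  restr :: "'p set \<Rightarrow> 'p set \<Rightarrow> 's \<Rightarrow> 's"

definition germ :: "('p, 's) ringed_space \<Rightarrow> 'p \<Rightarrow> 'p set \<Rightarrow> 's \<Rightarrow> ('p set \<times> 's) set" where
  "germ S x V s = {(W, t). openin (rs_topology S) W \<and> x \<in> W \<and> t \<in> carrier (sections S W) \<and>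
     (\<exists>N. openin (rs_topology S) N \<and> x \<in> N \<and> N \<subseteq> V \<inter> W \<and> restr S V N s = restr S W N t)}"

definition stalk :: "('p, 's) ringed_space \<Rightarrow> 'p \<Rightarrow> ('p set \<times> 's) set ring" where
  "stalk S x =
     \<lparr>carrier = {germ S x V s | V s. openin (rs_topology S) V \<and> x \<in> V \<and> s \<in> carrier (sections S V)},
      monoid.mult = (\<lambda>A B. \<Union>(V, s)\<in>A. \<Union>(W, t)\<in>B. germ S x (V \<inter> W)
         (restr S V (V \<inter> W) s \<otimes>\<^bsub>sections S (V \<inter> W)\<^esub> restr S W (V \<inter> W) t)),
      one = germ S x (topspace (rs_topology S)) \<one>\<^bsub>sections S (topspace (rs_topology S))\<^esub>,
      ring.zero = germ S x (topspace (rs_topology S)) \<zero>\<^bsub>sections S (topspace (rs_topology S))\<^esub>,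
      add = (\<lambda>A B. \<Union>(V, s)\<in>A. \<Union>(W, t)\<in>B. germ S x (V \<inter> W)
         (restr S V (V \<inter> W) s \<oplus>\<^bsub>sections S (V \<inter> W)\<^esub> restr S W (V \<inter> W) t))\<rparr>"

text \<open>A morphism consists of a map of points and of maps $\mathcal{O}_T(V) \to \mathcal{O}_S(f^{-1}V)$.\<close>

record ('p, 's, 'q, 't) rs_map =
  point_map :: "'p \<Rightarrow> 'q"
  pullback :: "'q set \<Rightarrow> 't \<Rightarrow> 's"

definition preimage ::
    "('p, 's) ringed_space \<Rightarrow> ('p, 's, 'q, 't) rs_map \<Rightarrow> 'q set \<Rightarrow> 'p set" where
  "preimage S f V = {x \<in> topspace (rs_topology S). point_map f x \<in> V}"

definition stalk_map ::
    "('p, 's) ringed_space \<Rightarrow> ('p, 's, 'q, 't) rs_map \<Rightarrow> 'p \<Rightarrow> ('q set \<times> 't) set \<Rightarrow> ('p set \<times> 's) set" where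
  "stalk_map S f x A = (\<Union>(V, s)\<in>A. germ S x (preimage S f V) (pullback f V s))"

text \<open>The maximal ideal of a local ring is its set of non-units, hence the form of the last clause.\<close>

definition morphism ::
    "('p, 's) ringed_space \<Rightarrow> ('q, 't) ringed_space \<Rightarrow> ('p, 's, 'q, 't) rs_map \<Rightarrow> bool" where
  "morphism S T f \<longleftrightarrow>
     continuous_map (rs_topology S) (rs_topology T) (point_map f) \<and>
     (\<forall>V. openin (rs_topology T) V \<longrightarrow>
        pullback f V \<in> ring_hom (sections T V) (sections S (preimage S f V))) \<and>
     (\<forall>V W s. openin (rs_topology T) V \<longrightarrow> openin (rs_topology T) W \<longrightarrow> W \<subseteq> V \<longrightarrow> s \<in> carrier (sections T V) \<longrightarrow>
        restr S (preimage S f V) (preimage S f W) (pullback f V s) = pullback f W (restr T V W s)) \<and>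
     (\<forall>x\<in>topspace (rs_topology S).
        stalk_map S f x ` (carrier (stalk T (point_map f x)) - Units (stalk T (point_map f x)))
          \<subseteq> carrier (stalk S x) - Units (stalk S x))"

definition morphism_eq ::
    "('p, 's) ringed_space \<Rightarrow> ('q, 't) ringed_space \<Rightarrow>
     ('p, 's, 'q, 't) rs_map \<Rightarrow> ('p, 's, 'q, 't) rs_map \<Rightarrow> bool" where
  "morphism_eq S T f g \<longleftrightarrow>
     (\<forall>x\<in>topspace (rs_topology S). point_map f x = point_map g x) \<and>
     (\<forall>V. openin (rs_topology T) V \<longrightarrow> (\<forall>s\<in>carrier (sections T V). pullback f V s = pullback g V s))"

definition id_morphism :: "('p, 's, 'p, 's) rs_map" where
  "id_morphism = \<lparr>point_map = (\<lambda>x. x), pullback = (\<lambda>V s. s)\<rparr>"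

text \<open>\<open>comp_morphism T g f\<close> is $g \circ f$ where $f$ has target $T$ and $g$ has source $T$.\<close>

definition comp_morphism ::
    "('q, 't) ringed_space \<Rightarrow> ('q, 't, 'z, 'w) rs_map \<Rightarrow> ('p, 's, 'q, 't) rs_map \<Rightarrow>
     ('p, 's, 'z, 'w) rs_map" where
  "comp_morphism T g f =
     \<lparr>point_map = (\<lambda>x. point_map g (point_map f x)),
      pullback = (\<lambda>V s. pullback f (preimage T g V) (pullback g V s))\<rparr>"


section \<open>Affine schemes\<close>

definition zariski :: "('a, 'm) ring_scheme \<Rightarrow> 'a set topology" where
  "zariski R = topology (\<lambda>V. \<exists>E\<subseteq>carrier R. V = {p. primeideal p R \<and> \<not> E \<subseteq> p})"

text \<open>
  A section over $V$ is a function with values in the local rings $R_p$, $p \in V$, which is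
  locally a fraction.
\<close>

definition Spec :: "('a, 'm) ring_scheme \<Rightarrow> ('a set, 'a set \<Rightarrow> ('a \<times> 'a) set) ringed_space" where
  "Spec R =
     \<lparr>rs_topology = zariski R,
      sections = (\<lambda>V.
        \<lparr>carrier = {\<sigma> \<in> \<Pi>\<^sub>E p\<in>V. carrier (localization R p).
           \<forall>p\<in>V. \<exists>W a s. openin (zariski R) W \<and> p \<in> W \<and> W \<subseteq> V \<and> a \<in> carrier R \<and> s \<in> carrier R \<and>
             (\<forall>q\<in>W. s \<notin> q \<and> \<sigma> q = fraction R q a s)},
         monoid.mult = (\<lambda>\<sigma> \<tau>. \<lambda>p\<in>V. \<sigma> p \<otimes>\<^bsub>localization R p\<^esub> \<tau> p),
         one = (\<lambda>p\<in>V. \<one>\<^bsub>localization R p\<^esub>),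
         ring.zero = (\<lambda>p\<in>V. \<zero>\<^bsub>localization R p\<^esub>),
         add = (\<lambda>\<sigma> \<tau>. \<lambda>p\<in>V. \<sigma> p \<oplus>\<^bsub>localization R p\<^esub> \<tau> p)\<rparr>),
      restr = (\<lambda>V W \<sigma>. restrict \<sigma> W)\<rparr>"

text \<open>The morphism $\mathrm{Spec}\, B \to \mathrm{Spec}\, A$ induced by $h : A \to B$.\<close>

definition Spec_map ::
    "('a, 'm) ring_scheme \<Rightarrow> ('b, 'n) ring_scheme \<Rightarrow> ('a \<Rightarrow> 'b) \<Rightarrow>
     ('b set, 'b set \<Rightarrow> ('b \<times> 'b) set, 'a set, 'a set \<Rightarrow> ('a \<times> 'a) set) rs_map" where
  "Spec_map A B h =
     \<lparr>point_map = (\<lambda>q. {a \<in> carrier A. h a \<in> q}),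
      pullback = (\<lambda>V \<sigma>. \<lambda>q\<in>{q. primeideal q B \<and> {a \<in> carrier A. h a \<in> q} \<in> V}.
        localization_map B q h (\<sigma> {a \<in> carrier A. h a \<in> q}))\<rparr>"

text \<open>
  For a $k$-algebra $R$, the product $\mathbb{A}^1_k \times_{\mathrm{Spec}\,k} \mathrm{Spec}\,R$ is
  $\mathrm{Spec}\,R[t]$, because $R[t] = k[t] \otimes_k R$ (lemma \<open>line_pushout\<close> below).
\<close>

definition affine_line ::
    "('a, 'm) ring_scheme \<Rightarrow> ((nat \<Rightarrow> 'a) set, (nat \<Rightarrow> 'a) set \<Rightarrow> ((nat \<Rightarrow> 'a) \<times> (nat \<Rightarrow> 'a)) set) ringed_space" where
  "affine_line R = Spec (UP R)"

definition const_poly :: "('a, 'm) ring_scheme \<Rightarrow> 'a \<Rightarrow> nat \<Rightarrow> 'a" where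
  "const_poly R a = monom (UP R) a 0"

definition up_map :: "('a \<Rightarrow> 'b) \<Rightarrow> (nat \<Rightarrow> 'a) \<Rightarrow> nat \<Rightarrow> 'b" where
  "up_map h f = (\<lambda>i. h (f i))"

text \<open>The inclusion of the closed subscheme $\{t = a\} \times \mathrm{Spec}\,R$, identified with $\mathrm{Spec}\,R$.\<close>

definition at_param ::
    "('a, 'm) ring_scheme \<Rightarrow> 'a \<Rightarrow>
     ('a set, 'a set \<Rightarrow> ('a \<times> 'a) set, (nat \<Rightarrow> 'a) set, (nat \<Rightarrow> 'a) set \<Rightarrow> ((nat \<Rightarrow> 'a) \<times> (nat \<Rightarrow> 'a)) set) rs_map" where
  "at_param R a = Spec_map (UP R) R (eval R R id a)"

definition base_change_line ::
    "('a, 'm) ring_scheme \<Rightarrow> ('b, 'n) ring_scheme \<Rightarrow> ('a \<Rightarrow> 'b) \<Rightarrow>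
     ((nat \<Rightarrow> 'b) set, (nat \<Rightarrow> 'b) set \<Rightarrow> ((nat \<Rightarrow> 'b) \<times> (nat \<Rightarrow> 'b)) set,
      (nat \<Rightarrow> 'a) set, (nat \<Rightarrow> 'a) set \<Rightarrow> ((nat \<Rightarrow> 'a) \<times> (nat \<Rightarrow> 'a)) set) rs_map" where
  "base_change_line A B h = Spec_map (UP A) (UP B) (up_map h)"

definition point_inclusion ::
    "('a, 'm) ring_scheme \<Rightarrow> 'a set \<Rightarrow>
     (('a \<times> 'a) set set set, ('a \<times> 'a) set set set \<Rightarrow> (('a \<times> 'a) set set \<times> ('a \<times> 'a) set set) set,
      'a set, 'a set \<Rightarrow> ('a \<times> 'a) set) rs_map" where
  "point_inclusion R p = Spec_map R (residue_field R p) (residue_map R p)"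

text \<open>
  \<open>curve_connects F S \<gamma> u v\<close>: the morphism $\gamma : \mathbb{A}^1_F \to S$ has value $u$ at $t = 1$
  and value $v$ at $t = 0$, where $u, v : \mathrm{Spec}\,F \to S$.
\<close>

definition curve_connects where
  "curve_connects F S \<gamma> u v \<longleftrightarrow>
     morphism (affine_line F) S \<gamma> \<and>
     morphism_eq (Spec F) S (comp_morphism (affine_line F) \<gamma> (at_param F \<one>\<^bsub>F\<^esub>)) u \<and>
     morphism_eq (Spec F) S (comp_morphism (affine_line F) \<gamma> (at_param F \<zero>\<^bsub>F\<^esub>)) v"

end

theory Submission
  imports Defs
begin

text \<open>
  A monic ideal with standard set $\Delta$ is determined by the coefficients \<open>N \<alpha> \<beta>\<close> of the normal
  forms of the monomials $x^\alpha$ in the basis $x^\beta$, $\beta \in \Delta$. They vanish unless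
  $\beta \preceq \alpha$, and the ideal property amounts to quadratic equations between them.
  Choose weights $w \in \mathbb{N}^n$ with $w(\beta) < w(\alpha)$ whenever $\beta \in \Delta$ and
  $\beta \prec \alpha$. Then the coefficients $t^{w(\alpha) - w(\beta)}$ \<open>N \<alpha> \<beta>\<close> satisfy the same
  equations over $R[t]$, hence define a monic ideal there and, by the universal property, a
  homomorphism $R \to R[t]$. At $t = 1$ nothing has changed, and at $t = 0$ only the monomials of
  $\mathbb{N}^n - \Delta$ survive. Since $R[t]$ lives on another type, it is first copied into \<open>'a\<close>.
  For connectedness, the prime ideal $\mathfrak{p}[t]$ specializes to the points $(t - 1, \mathfrak{p})$ and
  $(t, \mathfrak{p})$, so a clopen set contains $\mathfrak{p}$ if and only if it contains its limit at $t = 0$.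
\<close>


section \<open>Weights adapted to a monomial order\<close>

text \<open>A monomial order need not be given by a single integral weight, and the scaling of
  variables by negative powers of t is not defined over R[t]. Both difficulties vanish on the level
  of coefficients: only comparisons with the finitely many elements of \<Delta> have to be
  respected, and every nonzero coefficient is multiplied by a nonnegative power of t. Encoding
  ideals by coefficients also makes base change immediate, since a homomorphism acts on them
  entrywise. The universal coefficients, together with the image of k, detect homomorphisms out of
  R; this is how the deformation is identified at t = 1 and at t = 0, where it factors through k by
  the section of the monomial ideal. For this it is proved from the sheaf definition that a ring
  homomorphism induces a morphism of locally ringed spaces.\<close>

lemma dickson:
  assumes "S \<subseteq> expo n"
  shows "\<exists>M\<subseteq>S. finite M \<and> (\<forall>\<alpha>\<in>S. \<exists>m\<in>M. m \<le> \<alpha>)"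
  using assms
proof (induction n arbitrary: S)
  case 0
  have "expo 0 = {\<lambda>_. 0}" by (auto simp: expo_def)
  with 0 have "finite S" by (metis finite.emptyI finite.insertI finite_subset)
  then show ?case by (intro exI[of _ S]) auto
next
  case (Suc n)
  \<comment> \<open>\<open>pr\<close> forgets the last coordinate, so the induction hypothesis
    controls all coordinates but one.\<close>
  define pr :: "(nat \<Rightarrow> nat) \<Rightarrow> nat \<Rightarrow> nat" where "pr \<alpha> = \<alpha>(n := 0)" for \<alpha>
  have pr_expo: "pr ` T \<subseteq> expo n" if "T \<subseteq> S" for T
    using that Suc.prems by (fastforce simp: pr_def expo_def)
  have basis: "\<exists>M\<subseteq>T. finite M \<and> (\<forall>\<alpha>\<in>T. \<exists>m\<in>M. pr m \<le> pr \<alpha>)" if T: "T \<subseteq> S" for T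
  proof -
    obtain M where "M \<subseteq> pr ` T" "finite M" and M: "\<And>\<alpha>. \<alpha> \<in> pr ` T \<Longrightarrow> \<exists>m\<in>M. m \<le> \<alpha>"
      using Suc.IH[of "pr ` T"] pr_expo[OF T] by metis
    then obtain N where N: "N \<subseteq> T" "finite N" "M = pr ` N"
      using finite_subset_image[of M pr T] by auto
    have "\<forall>\<alpha>\<in>T. \<exists>m\<in>N. pr m \<le> pr \<alpha>" using M unfolding N(3) by simp
    with N show ?thesis by (intro exI[of _ N]) simp
  qed
  obtain M0 where M0: "M0 \<subseteq> S" "finite M0" "\<And>\<alpha>. \<alpha> \<in> S \<Longrightarrow> \<exists>m\<in>M0. pr m \<le> pr \<alpha>"
    using basis[of S] by blast
  have "\<forall>k. \<exists>M\<subseteq>{\<alpha>\<in>S. \<alpha> n = k}. finite M \<and> (\<forall>\<alpha>\<in>{\<alpha>\<in>S. \<alpha> n = k}. \<exists>m\<in>M. pr m \<le> pr \<alpha>)"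
    by (intro allI basis) blast
  from choice[OF this] obtain M where "\<forall>k. M k \<subseteq> {\<alpha>\<in>S. \<alpha> n = k} \<and> finite (M k)
      \<and> (\<forall>\<alpha>\<in>{\<alpha>\<in>S. \<alpha> n = k}. \<exists>m\<in>M k. pr m \<le> pr \<alpha>)" ..
  then have M: "M k \<subseteq> {\<alpha>\<in>S. \<alpha> n = k}" "finite (M k)"
      "\<alpha> \<in> S \<Longrightarrow> \<alpha> n = k \<Longrightarrow> \<exists>m\<in>M k. pr m \<le> pr \<alpha>" for k \<alpha>
    by simp_all
  have le: "m \<le> \<alpha>" if "pr m \<le> pr \<alpha>" "m n \<le> \<alpha> n" for m \<alpha>
    using that by (auto simp: le_fun_def pr_def split: if_splits)
  \<comment> \<open>Above the height \<open>K\<close> the elements of \<open>M0\<close> are small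
    enough in the last coordinate too, so \<open>M0\<close> suffices there. Each of the finitely
    many slices below contributes its own finite set \<open>M k\<close>.\<close>
  obtain K where K: "\<And>m. m \<in> M0 \<Longrightarrow> m n \<le> K"
    using finite_nat_set_iff_bounded_le[of "(\<lambda>m. m n) ` M0"] M0(2) by auto
  have "\<exists>m\<in>M0 \<union> (\<Union>k\<le>K. M k). m \<le> \<alpha>" if \<alpha>: "\<alpha> \<in> S" for \<alpha>
  proof (cases "\<alpha> n \<le> K")
    case True
    obtain m where "m \<in> M (\<alpha> n)" "pr m \<le> pr \<alpha>" using M(3)[OF \<alpha>] by blast
    moreover from this have "m n = \<alpha> n" using M(1)[of "\<alpha> n"] by auto
    ultimately show ?thesis using True le[of m \<alpha>] by auto
  next
    case False
    obtain m where "m \<in> M0" "pr m \<le> pr \<alpha>" using M0(3)[OF \<alpha>] by blast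
    then show ?thesis using False le[of m \<alpha>] K[of m] by auto
  qed
  then show ?case
    using M0(1,2) M(1,2) by (intro exI[of _ "M0 \<union> (\<Union>k\<le>K. M k)"]) blast
qed

text \<open>In the elimination below, the lower and the upper bounds on the last weight form two
  finite sets. Density of the rationals gives a value strictly between them, and an empty side
  imposes no constraint.\<close>

lemma finite_separation:
  fixes A B :: "rat set"
  assumes "finite A" "finite B" "\<And>a b. a \<in> A \<Longrightarrow> b \<in> B \<Longrightarrow> a < b"
  shows "\<exists>z. (\<forall>a\<in>A. a < z) \<and> (\<forall>b\<in>B. z < b)"
proof (cases "A = {} \<or> B = {}")
  case True
  obtain x y where "\<And>b. b \<in> B \<Longrightarrow> x \<le> b" "\<And>a. a \<in> A \<Longrightarrow> a \<le> y"
    using Min_le[OF assms(2)] Max_ge[OF assms(1)] by metis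
  then have "\<forall>b\<in>B. x - 1 < b" "\<forall>a\<in>A. a < y + 1"
    by (force simp: algebra_simps)+
  with True show ?thesis by blast
next
  case False
  then have "Max A < Min B" using assms by auto
  then obtain z where "Max A < z" "z < Min B" using dense[of "Max A" "Min B"] by metis
  then show ?thesis using False assms(1,2) by (intro exI[of _ z]) simp
qed

text \<open>Fourier-Motzkin elimination of the last coordinate.\<close>

lemma positive_functional:
  fixes P V :: "(nat \<Rightarrow> int) set"
  assumes add: "\<And>u v. u \<in> P \<Longrightarrow> v \<in> P \<Longrightarrow> (\<lambda>i. u i + v i) \<in> P"
    and zero: "(\<lambda>_. 0) \<notin> P"
  shows "finite V \<Longrightarrow> V \<subseteq> P \<Longrightarrow> \<forall>v\<in>V. \<forall>i\<ge>n. v i = 0 \<Longrightarrow> \<exists>w. \<forall>v\<in>V. (\<Sum>i<n. w i * v i) > 0"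
proof (induction n arbitrary: V)
  case 0
  \<comment> \<open>All coordinates are eliminated. A surviving vector would be zero, and zero is
    excluded from \<open>P\<close>, in which every elimination step has stayed.\<close>
  then have "V \<subseteq> {\<lambda>_. 0}" by auto
  with 0 zero have "V = {}" by auto
  then show ?case by simp
next
  case (Suc n)
  have smult: "(\<lambda>i. int (Suc m) * u i) \<in> P" if "u \<in> P" for u m
  proof (induction m)
    case (Suc m)
    have "(\<lambda>i. u i + int (Suc m) * u i) = (\<lambda>i. int (Suc (Suc m)) * u i)"
      by (simp add: fun_eq_iff algebra_simps)
    then show ?case using add[OF that Suc] by simp
  qed (use that in simp)
  have smult: "(\<lambda>i. k * u i) \<in> P" if "u \<in> P" "k > 0" for u and k :: int
    using smult[OF that(1), of "nat k - 1"] that(2) by (simp add: of_nat_diff)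
  define Vp where "Vp = {v\<in>V. v n > 0}"
  define Vm where "Vm = {v\<in>V. v n < 0}"
  define V0 where "V0 = {v\<in>V. v n = 0}"
  \<comment> \<open>Positive multiples of a vector with positive and of one with negative last
    coordinate, chosen so that the last coordinates cancel; the sum stays in
    \<open>P\<close>.\<close>
  define comb where "comb = (\<lambda>(u::nat\<Rightarrow>int, v::nat\<Rightarrow>int) i. (- v n) * u i + u n * v i)"
  define V' where "V' = V0 \<union> comb ` (Vp \<times> Vm)"
  have fin: "finite Vp" "finite Vm" "finite V0"
    using Suc.prems by (auto simp: Vp_def Vm_def V0_def)
  have "finite V'" using fin by (simp add: V'_def)
  moreover have "V' \<subseteq> P"
  proof -
    have "comb (u, v) \<in> P" if "u \<in> Vp" "v \<in> Vm" for u v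
      using that Suc.prems add[OF smult smult, of u "- v n" v "u n"]
      unfolding comb_def Vp_def Vm_def by auto
    then show ?thesis using Suc.prems by (auto simp: V'_def V0_def)
  qed
  moreover have "\<forall>v\<in>V'. \<forall>i\<ge>n. v i = 0"
  proof -
    have "comb (u, v) i = 0" if "u \<in> Vp" "v \<in> Vm" "i \<ge> n" for u v i
    proof (cases "i = n")
      case False
      then have "u i = 0" "v i = 0" using that Suc.prems by (auto simp: Vp_def Vm_def)
      then show ?thesis by (simp add: comb_def)
    qed (simp add: comb_def)
    moreover have "v i = 0" if "v \<in> V0" "i \<ge> n" for v i
      using that Suc.prems by (cases "i = n") (auto simp: V0_def)
    ultimately show ?thesis unfolding V'_def by fast
  qed
  ultimately obtain w where w: "\<And>v. v \<in> V' \<Longrightarrow> (\<Sum>i<n. w i * v i) > 0"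
    using Suc.IH[of V'] by metis
  define s where "s v = (\<Sum>i<n. w i * v i)" for v
  have s_comb: "s (comb (u, v)) = (- v n) * s u + u n * s v" for u v
    by (simp add: s_def comb_def sum_distrib_left right_diff_distrib sum_subtractf sum_negf mult.left_commute)
  \<comment> \<open>With last weight \<open>z\<close> the condition on a vector reads
    \<open>s v + z * v n > 0\<close>. Vectors in \<open>Vp\<close> bound \<open>z\<close> from
    below, those in \<open>Vm\<close> from above, and positivity on \<open>comb\<close> says exactly
    that each lower bound is less than each upper bound.\<close>
  have "\<exists>z. (\<forall>a\<in>(\<lambda>u. - of_int (s u) / of_int (u n)) ` Vp. a < z)
     \<and> (\<forall>b\<in>(\<lambda>v. of_int (s v) / of_int (- v n) :: rat) ` Vm. z < b)"
  proof (rule finite_separation)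
    fix a b :: rat
    assume "a \<in> (\<lambda>u. - of_int (s u) / of_int (u n)) ` Vp" "b \<in> (\<lambda>v. of_int (s v) / of_int (- v n)) ` Vm"
    then obtain u v where uv: "u \<in> Vp" "v \<in> Vm" and ab: "a = - of_int (s u) / of_int (u n)" "b = of_int (s v) / of_int (- v n)"
      by blast
    have "comb (u, v) \<in> V'" using uv by (auto simp: V'_def)
    from w[OF this] have "(- v n) * s u + u n * s v > 0" using s_comb by (simp add: s_def)
    then have "of_int ((- v n) * s u + u n * s v) > (0::rat)" by linarith
    moreover have "of_int (u n) > (0::rat)" "of_int (- v n) > (0::rat)"
      using uv by (auto simp: Vp_def Vm_def)
    moreover have "b - a = of_int ((- v n) * s u + u n * s v) / (of_int (u n) * of_int (- v n))"
      using calculation(2,3) unfolding ab by (simp add: field_simps)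
    ultimately have "b - a > 0" by (metis divide_pos_pos mult_pos_pos)
    then show "a < b" by simp
  qed (use fin in auto)
  then obtain z :: rat where z1: "\<And>u. u \<in> Vp \<Longrightarrow> - of_int (s u) / of_int (u n) < z"
    and z2: "\<And>v. v \<in> Vm \<Longrightarrow> z < of_int (s v) / of_int (- v n)" by auto
  \<comment> \<open>Weights have to be integral, so all of them are multiplied by the denominator
    \<open>q\<close> of \<open>z\<close>; the last weight becomes the numerator
    \<open>p\<close>.\<close>
  obtain p q where pq: "quotient_of z = (p, q)" by fastforce
  have q: "q > 0" "z = of_int p / of_int q"
    using quotient_of_denom_pos[OF pq] quotient_of_div[OF pq] by auto
  have pos: "of_int (s v) + z * of_int (v n) > 0" if v: "v \<in> V" for v
  proof -
    consider "v \<in> Vp" | "v \<in> Vm" | "v \<in> V0" using v by (force simp: Vp_def Vm_def V0_def)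
    then show ?thesis
    proof cases
      case 1
      then have "of_int (v n) > (0::rat)" by (auto simp: Vp_def)
      with z1[OF 1] show ?thesis by (simp add: field_simps)
    next
      case 2
      then have "of_int (v n) < (0::rat)" by (auto simp: Vm_def)
      with z2[OF 2] show ?thesis by (simp add: field_simps)
    next
      case 3
      then have "v \<in> V'" "v n = 0" by (auto simp: V'_def V0_def)
      then have "s v > 0" using w by (simp add: s_def)
      with \<open>v n = 0\<close> show ?thesis by simp
    qed
  qed
  have "(\<Sum>i<Suc n. (if i < n then q * w i else p) * v i) > 0" if "v \<in> V" for v
  proof -
    have "(\<Sum>i<Suc n. (if i < n then q * w i else p) * v i) = q * s v + p * v n"
      by (simp add: s_def sum_distrib_left mult.assoc)
    moreover have "of_int (q * s v + p * v n) = of_int q * (of_int (s v) + z * of_int (v n))"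
      using q by (simp add: field_simps)
    moreover have "\<dots> > 0" using pos[OF that] q(1) by simp
    ultimately show ?thesis by (metis of_int_0_less_iff)
  qed
  then show ?case by (intro exI[of _ "\<lambda>i. if i < n then q * w i else p"]) blast
qed

section \<open>Weighted degrees and the arithmetic of exponents\<close>

definition weight :: "nat \<Rightarrow> (nat \<Rightarrow> nat) \<Rightarrow> (nat \<Rightarrow> nat) \<Rightarrow> nat" where
  "weight n w \<alpha> = (\<Sum>i<n. w i * \<alpha> i)"

lemma weight_add: "weight n w (expo_add \<alpha> \<beta>) = weight n w \<alpha> + weight n w \<beta>"
  by (simp add: weight_def expo_add_def sum.distrib algebra_simps)

lemma expo_add_closed: "\<alpha> \<in> expo n \<Longrightarrow> \<beta> \<in> expo n \<Longrightarrow> expo_add \<alpha> \<beta> \<in> expo n"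
  by (simp add: expo_def expo_add_def)

lemma expo_add_commute: "expo_add \<alpha> \<beta> = expo_add \<beta> \<alpha>"
  by (simp add: expo_add_def add.commute)

lemma expo_add_assoc: "expo_add (expo_add \<alpha> \<beta>) \<gamma> = expo_add \<alpha> (expo_add \<beta> \<gamma>)"
  by (simp add: expo_add_def add.assoc)

lemma expo_add_right_cancel [simp]: "expo_add \<alpha> \<gamma> = expo_add \<beta> \<gamma> \<longleftrightarrow> \<alpha> = \<beta>"
  by (auto simp: expo_add_def fun_eq_iff)

lemma expo_add_0 [simp]: "expo_add \<alpha> (\<lambda>_. 0) = \<alpha>" "expo_add (\<lambda>_. 0) \<alpha> = \<alpha>"
  by (simp_all add: expo_add_def)

lemma zero_expo [simp]: "(\<lambda>_. 0) \<in> expo n"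
  by (simp add: expo_def)

context
  fixes n and r :: "((nat \<Rightarrow> nat) \<times> (nat \<Rightarrow> nat)) set"
  assumes r: "monomial_order n r"
begin

lemma mo_add: "(\<alpha>, \<beta>) \<in> r \<Longrightarrow> \<gamma> \<in> expo n \<Longrightarrow> (expo_add \<alpha> \<gamma>, expo_add \<beta> \<gamma>) \<in> r"
  using r by (simp add: monomial_order_def)

lemma mo_field: "(\<alpha>, \<beta>) \<in> r \<Longrightarrow> \<alpha> \<in> expo n \<and> \<beta> \<in> expo n"
  using r by (auto simp: monomial_order_def order_on_defs)

lemma mo_trans: "(\<alpha>, \<beta>) \<in> r \<Longrightarrow> (\<beta>, \<gamma>) \<in> r \<Longrightarrow> (\<alpha>, \<gamma>) \<in> r"
  using r unfolding monomial_order_def order_on_defs by (meson transD)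

lemma mo_antisym: "(\<alpha>, \<beta>) \<in> r \<Longrightarrow> (\<beta>, \<alpha>) \<in> r \<Longrightarrow> \<alpha> = \<beta>"
  using r unfolding monomial_order_def order_on_defs by (meson antisymD)

lemma mo_refl: "\<alpha> \<in> expo n \<Longrightarrow> (\<alpha>, \<alpha>) \<in> r"
  using r unfolding monomial_order_def order_on_defs by (meson refl_onD)

lemma mo_total: "\<alpha> \<in> expo n \<Longrightarrow> \<beta> \<in> expo n \<Longrightarrow> (\<alpha>, \<beta>) \<in> r \<or> (\<beta>, \<alpha>) \<in> r"
  using r mo_refl unfolding monomial_order_def order_on_defs total_on_def by metis

lemma mo_wf: "wf (r - Id)"
  using r by (simp add: monomial_order_def well_order_on_def)

text \<open>By translation invariance, an exponent below 0 would have ever smaller multiples, so the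
  set of its multiples would have no least element.\<close>

lemma mo_zero_le:
  assumes \<alpha>: "\<alpha> \<in> expo n"
  shows "((\<lambda>_. 0), \<alpha>) \<in> r"
proof (rule ccontr)
  assume neg: "((\<lambda>_. 0), \<alpha>) \<notin> r"
  then have le: "(\<alpha>, \<lambda>_. 0) \<in> r" using mo_total[OF \<alpha> zero_expo] by blast
  have ne: "\<alpha> \<noteq> (\<lambda>_. 0)" using neg mo_refl[OF zero_expo] by auto
  define m where "m k = (\<lambda>i. k * \<alpha> i)" for k
  have m: "m k \<in> expo n" "m (Suc k) = expo_add \<alpha> (m k)" for k
    using \<alpha> by (auto simp: m_def expo_def expo_add_def)
  obtain z where z: "z \<in> range m" "\<And>y. (y, z) \<in> r - Id \<Longrightarrow> y \<notin> range m"
    using wfE_min[OF mo_wf, of "m 0" "range m"] by blast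
  then obtain k where k: "z = m k" by blast
  have "(m (Suc k), m k) \<in> r" using mo_add[OF le m(1)[of k]] m(2) by simp
  moreover have "m (Suc k) \<noteq> m k" using ne by (auto simp: m_def fun_eq_iff)
  ultimately show False using z(2)[of "m (Suc k)"] k by blast
qed

text \<open>
  By Dickson's lemma, the infinitely many inequalities $w(\alpha) > w(\beta)$ follow from
  finitely many of them together with $w \ge 0$.
\<close>

lemma ex_weight:
  assumes \<Delta>: "finite \<Delta>" "\<Delta> \<subseteq> expo n"
  shows "\<exists>w. \<forall>\<beta>\<in>\<Delta>. \<forall>\<alpha>. (\<beta>, \<alpha>) \<in> r \<longrightarrow> \<beta> \<noteq> \<alpha> \<longrightarrow> weight n w \<beta> < weight n w \<alpha>"
proof -
  define diff where "diff \<alpha> \<beta> = (\<lambda>i. int (\<alpha> i) - int (\<beta> i))" for \<alpha> \<beta> :: "nat \<Rightarrow> nat"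
  \<comment> \<open>The differences of strictly ordered exponents. Translation invariance,
    transitivity and antisymmetry make them closed under sums, and distinct exponents have a nonzero
    difference.\<close>
  define P where "P = {diff \<alpha> \<beta> | \<alpha> \<beta>. (\<beta>, \<alpha>) \<in> r \<and> \<beta> \<noteq> \<alpha>}"
  have P_add: "(\<lambda>i. u i + v i) \<in> P" if uv: "u \<in> P" "v \<in> P" for u v
  proof -
    obtain \<alpha> \<beta> \<alpha>' \<beta>' where *: "u = diff \<alpha> \<beta>" "(\<beta>, \<alpha>) \<in> r" "\<beta> \<noteq> \<alpha>" "v = diff \<alpha>' \<beta>'" "(\<beta>', \<alpha>') \<in> r" "\<beta>' \<noteq> \<alpha>'"
      using uv unfolding P_def by blast
    have 1: "(expo_add \<beta> \<beta>', expo_add \<alpha> \<beta>') \<in> r" using *(2,5) mo_add mo_field by blast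
    have 2: "(expo_add \<alpha> \<beta>', expo_add \<alpha> \<alpha>') \<in> r" using *(2,5) mo_add mo_field expo_add_commute by metis
    have "expo_add \<beta> \<beta>' \<noteq> expo_add \<alpha> \<alpha>'" using mo_antisym[OF 1] 2 *(3) by auto
    moreover have "(expo_add \<beta> \<beta>', expo_add \<alpha> \<alpha>') \<in> r" using mo_trans[OF 1 2] .
    moreover have "(\<lambda>i. u i + v i) = diff (expo_add \<alpha> \<alpha>') (expo_add \<beta> \<beta>')"
      by (simp add: *(1,4) diff_def expo_add_def fun_eq_iff)
    ultimately show ?thesis unfolding P_def by blast
  qed
  have P_zero: "(\<lambda>_. 0) \<notin> P"
  proof
    assume "(\<lambda>_. 0) \<in> P"
    then obtain \<alpha> \<beta> where ab: "(\<lambda>_. 0) = diff \<alpha> \<beta>" "\<beta> \<noteq> \<alpha>" unfolding P_def by blast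
    have "\<alpha> i = \<beta> i" for i using fun_cong[OF ab(1), of i] by (simp add: diff_def)
    with ab(2) show False by auto
  qed
  have "\<forall>\<beta>. \<exists>M\<subseteq>{\<alpha>. (\<beta>, \<alpha>) \<in> r \<and> \<beta> \<noteq> \<alpha>}. finite M \<and> (\<forall>\<alpha>\<in>{\<alpha>. (\<beta>, \<alpha>) \<in> r \<and> \<beta> \<noteq> \<alpha>}. \<exists>m\<in>M. m \<le> \<alpha>)"
    by (intro allI dickson[of _ n]) (use mo_field in blast)
  from choice[OF this] obtain M where "\<forall>\<beta>. M \<beta> \<subseteq> {\<alpha>. (\<beta>, \<alpha>) \<in> r \<and> \<beta> \<noteq> \<alpha>} \<and> finite (M \<beta>)
      \<and> (\<forall>\<alpha>\<in>{\<alpha>. (\<beta>, \<alpha>) \<in> r \<and> \<beta> \<noteq> \<alpha>}. \<exists>m\<in>M \<beta>. m \<le> \<alpha>)" ..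
  then have M: "M \<beta> \<subseteq> {\<alpha>. (\<beta>, \<alpha>) \<in> r \<and> \<beta> \<noteq> \<alpha>}" "finite (M \<beta>)"
      "(\<beta>, \<alpha>) \<in> r \<Longrightarrow> \<beta> \<noteq> \<alpha> \<Longrightarrow> \<exists>m\<in>M \<beta>. m \<le> \<alpha>" for \<beta> \<alpha>
    by simp_all
  define e :: "nat \<Rightarrow> nat \<Rightarrow> nat" where "e j = (\<lambda>i. if i = j then 1 else 0)" for j
  have e: "e j \<in> expo n" "e j \<noteq> (\<lambda>_. 0)" if "j < n" for j
    using that by (auto simp: e_def expo_def fun_eq_iff)
  \<comment> \<open>The unit vectors, as differences with 0, join the minimal comparisons. They make
    the functional nonnegative on each coordinate, so that the weight of \<alpha> is at least that
    of the minimal \<open>m\<close> below it, and so that \<open>nat\<close> loses nothing.\<close>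
  define V where "V = (\<Union>\<beta>\<in>\<Delta>. (\<lambda>\<alpha>. diff \<alpha> \<beta>) ` M \<beta>) \<union> (\<lambda>j. diff (e j) (\<lambda>_. 0)) ` {..<n}"
  have "finite V" using \<Delta> M by (simp add: V_def)
  moreover have VP: "V \<subseteq> P"
  proof -
    have "diff (e j) (\<lambda>_. 0) \<in> P" if "j < n" for j
      unfolding P_def using e[OF that] mo_zero_le[OF e(1)[OF that]] by (metis (mono_tags, lifting) mem_Collect_eq)
    moreover have "diff \<alpha> \<beta> \<in> P" if "\<alpha> \<in> M \<beta>" for \<alpha> \<beta>
    proof -
      have "(\<beta>, \<alpha>) \<in> r \<and> \<beta> \<noteq> \<alpha>" using that M(1)[of \<beta>] by blast
      then show ?thesis unfolding P_def by blast
    qed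
    ultimately show ?thesis unfolding V_def by blast
  qed
  moreover have "\<forall>v\<in>V. \<forall>i\<ge>n. v i = 0"
  proof -
    have "v i = 0" if "v \<in> P" "i \<ge> n" for v i
    proof -
      obtain \<alpha> \<beta> where "v = diff \<alpha> \<beta>" "\<alpha> \<in> expo n" "\<beta> \<in> expo n"
        using \<open>v \<in> P\<close> mo_field unfolding P_def by blast
      then show ?thesis using \<open>i \<ge> n\<close> by (simp add: diff_def expo_def)
    qed
    then show ?thesis using VP by blast
  qed
  ultimately obtain w where w: "\<And>v. v \<in> V \<Longrightarrow> (\<Sum>i<n. w i * v i) > 0"
    using positive_functional[of P V n, OF P_add P_zero] by blast
  have w_pos: "w j \<ge> 0" if "j < n" for j
  proof -
    have "(\<Sum>i<n. w i * diff (e j) (\<lambda>_. 0) i) > 0" using w that by (auto simp: V_def)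
    moreover have "(\<Sum>i<n. w i * diff (e j) (\<lambda>_. 0) i) = (\<Sum>i<n. if i = j then w i else 0)"
      by (intro sum.cong) (auto simp: diff_def e_def)
    ultimately show ?thesis using that by simp
  qed
  define w' where "w' i = nat (w i)" for i
  have weight_w': "int (weight n w' \<alpha>) = (\<Sum>i<n. w i * int (\<alpha> i))" for \<alpha>
    using w_pos by (simp add: weight_def w'_def)
  have "weight n w' \<beta> < weight n w' \<alpha>" if \<beta>: "\<beta> \<in> \<Delta>" and le: "(\<beta>, \<alpha>) \<in> r" "\<beta> \<noteq> \<alpha>" for \<alpha> \<beta>
  proof -
    obtain m where m: "m \<in> M \<beta>" "m \<le> \<alpha>" using M(3)[OF le] by blast
    have "diff m \<beta> \<in> V" using m \<beta> by (auto simp: V_def)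
    from w[OF this] have "int (weight n w' \<beta>) < int (weight n w' m)"
      by (simp add: diff_def weight_w' right_diff_distrib sum_subtractf)
    moreover have "weight n w' m \<le> weight n w' \<alpha>"
      unfolding weight_def using m(2) by (intro sum_mono) (auto simp: le_fun_def)
    ultimately show ?thesis by linarith
  qed
  then show ?thesis by blast
qed

end


section \<open>The ring of polynomials in $n$ variables\<close>

lemma (in abelian_monoid) finsum_swap:
  assumes "finite A" "finite B" "\<And>x y. x \<in> A \<Longrightarrow> y \<in> B \<Longrightarrow> f x y \<in> carrier G"
  shows "(\<Oplus>x\<in>A. \<Oplus>y\<in>B. f x y) = (\<Oplus>y\<in>B. \<Oplus>x\<in>A. f x y)"
  using assms(1,3)
proof (induction A)
  case empty
  show ?case by simp
next
  case (insert a A)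
  have "(\<Oplus>x\<in>insert a A. \<Oplus>y\<in>B. f x y) = (\<Oplus>y\<in>B. f a y) \<oplus> (\<Oplus>y\<in>B. \<Oplus>x\<in>A. f x y)"
    using insert by (subst finsum_insert) auto
  also have "\<dots> = (\<Oplus>y\<in>B. f a y \<oplus> (\<Oplus>x\<in>A. f x y))"
    using insert by (intro finsum_addf[symmetric]) auto
  also have "\<dots> = (\<Oplus>y\<in>B. \<Oplus>x\<in>insert a A. f x y)"
    using insert by (intro finsum_cong') auto
  finally show ?case .
qed

text \<open>The value at \<open>f\<close> of the linear functional on polynomials that takes the
  value \<open>m \<alpha>\<close> on the monomial with exponent \<alpha>. Any function
  \<open>m\<close> is allowed, because the sum runs over the finite support of \<open>f\<close>.
  Coefficients and normal form coefficients are both such functionals.\<close>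

definition pairing :: "('a, 'm) ring_scheme \<Rightarrow> ((nat \<Rightarrow> nat) \<Rightarrow> 'a) \<Rightarrow> ((nat \<Rightarrow> nat) \<Rightarrow> 'a) \<Rightarrow> 'a" where
  "pairing B f m = (\<Oplus>\<^bsub>B\<^esub>\<alpha>\<in>{\<alpha>. f \<alpha> \<noteq> \<zero>\<^bsub>B\<^esub>}. f \<alpha> \<otimes>\<^bsub>B\<^esub> m \<alpha>)"

lemma mpoly_zero: "\<zero>\<^bsub>mpoly n B\<^esub> = (\<lambda>_. \<zero>\<^bsub>B\<^esub>)"
  and mpoly_add: "f \<oplus>\<^bsub>mpoly n B\<^esub> g = (\<lambda>\<gamma>. f \<gamma> \<oplus>\<^bsub>B\<^esub> g \<gamma>)"
  and mpoly_one: "\<one>\<^bsub>mpoly n B\<^esub> = mono_poly B (\<lambda>_. 0)"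
  by (simp_all add: mpoly_def mono_poly_def)

lemma mpoly_carrier:
  "f \<in> carrier (mpoly n B) \<longleftrightarrow>
     (\<forall>\<alpha>. f \<alpha> \<in> carrier B) \<and> {\<alpha>. f \<alpha> \<noteq> \<zero>\<^bsub>B\<^esub>} \<subseteq> expo n \<and> finite {\<alpha>. f \<alpha> \<noteq> \<zero>\<^bsub>B\<^esub>}"
  by (auto simp: mpoly_def)

lemma mpoly_coeff: "f \<in> carrier (mpoly n B) \<Longrightarrow> f \<alpha> \<in> carrier B"
  and mpoly_finite: "f \<in> carrier (mpoly n B) \<Longrightarrow> finite {\<alpha>. f \<alpha> \<noteq> \<zero>\<^bsub>B\<^esub>}"
  and mpoly_expo: "f \<in> carrier (mpoly n B) \<Longrightarrow> f \<alpha> \<noteq> \<zero>\<^bsub>B\<^esub> \<Longrightarrow> \<alpha> \<in> expo n"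
  by (auto simp: mpoly_carrier)

section \<open>Linear functionals on polynomials\<close>

context cring
begin

lemma pairing_superset:
  assumes "finite S" "{\<alpha>. f \<alpha> \<noteq> \<zero>} \<subseteq> S" "\<And>\<alpha>. f \<alpha> \<in> carrier R" "\<And>\<alpha>. m \<alpha> \<in> carrier R"
  shows "pairing R f m = (\<Oplus>\<alpha>\<in>S. f \<alpha> \<otimes> m \<alpha>)"
  unfolding pairing_def
  using assms by (intro add.finprod_mono_neutral_cong_left) auto

lemma pairing_closed [simp]:
  "f \<in> carrier (mpoly n R) \<Longrightarrow> (\<And>\<alpha>. m \<alpha> \<in> carrier R) \<Longrightarrow> pairing R f m \<in> carrier R"
  unfolding pairing_def by (intro finsum_closed) (auto simp: mpoly_coeff)

lemma pairing_cong:
  assumes "f \<in> carrier (mpoly n R)" "\<And>\<alpha>. \<alpha> \<in> expo n \<Longrightarrow> m \<alpha> = m' \<alpha>" "\<And>\<alpha>. m' \<alpha> \<in> carrier R"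
  shows "pairing R f m = pairing R f m'"
  unfolding pairing_def using assms
  by (intro finsum_cong') (auto simp: mpoly_coeff mpoly_expo)

lemma pairing_single:
  assumes "\<And>\<alpha>. m \<alpha> \<in> carrier R" "c \<in> carrier R"
  shows "pairing R (\<lambda>\<gamma>. if \<gamma> = \<alpha> then c else \<zero>) m = c \<otimes> m \<alpha>"
proof -
  have "pairing R (\<lambda>\<gamma>. if \<gamma> = \<alpha> then c else \<zero>) m = (\<Oplus>\<gamma>\<in>{\<alpha>}. (if \<gamma> = \<alpha> then c else \<zero>) \<otimes> m \<gamma>)"
    using assms by (intro pairing_superset) auto
  then show ?thesis using assms by simp
qed

lemma pairing_mono_poly [simp]:
  "(\<And>\<alpha>. m \<alpha> \<in> carrier R) \<Longrightarrow> pairing R (mono_poly R \<alpha>) m = m \<alpha>"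
  unfolding mono_poly_def by (simp add: pairing_single)

lemma pairing_coeff:
  assumes f: "f \<in> carrier (mpoly n R)" and c: "c \<in> carrier R"
  shows "pairing R f (\<lambda>\<gamma>. if \<gamma> = \<alpha> then c else \<zero>) = f \<alpha> \<otimes> c"
proof -
  have "pairing R f (\<lambda>\<gamma>. if \<gamma> = \<alpha> then c else \<zero>)
      = (\<Oplus>\<gamma>\<in>insert \<alpha> {\<alpha>. f \<alpha> \<noteq> \<zero>}. f \<gamma> \<otimes> (if \<gamma> = \<alpha> then c else \<zero>))"
    using assms by (intro pairing_superset) (auto simp: mpoly_finite mpoly_coeff)
  also have "\<dots> = (\<Oplus>\<gamma>\<in>insert \<alpha> {\<alpha>. f \<alpha> \<noteq> \<zero>}. if \<alpha> = \<gamma> then f \<gamma> \<otimes> c else \<zero>)"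
    using assms by (intro finsum_cong') (auto simp: mpoly_coeff)
  also have "\<dots> = f \<alpha> \<otimes> c"
    using assms by (intro finsum_singleton) (auto simp: mpoly_finite mpoly_coeff)
  finally show ?thesis .
qed

lemma pairing_swap:
  assumes f: "f \<in> carrier (mpoly n R)" and g: "g \<in> carrier (mpoly n R)"
    and m: "\<And>\<alpha> \<beta>. m \<alpha> \<beta> \<in> carrier R"
  shows "pairing R f (\<lambda>\<alpha>. pairing R g (m \<alpha>)) = pairing R g (\<lambda>\<beta>. pairing R f (\<lambda>\<alpha>. m \<alpha> \<beta>))"
proof -
  let ?F = "{\<alpha>. f \<alpha> \<noteq> \<zero>}" and ?G = "{\<alpha>. g \<alpha> \<noteq> \<zero>}"
  note [simp] = mpoly_coeff[OF f] mpoly_coeff[OF g] mpoly_finite[OF f] mpoly_finite[OF g] m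
  have "pairing R f (\<lambda>\<alpha>. pairing R g (m \<alpha>)) = (\<Oplus>\<alpha>\<in>?F. \<Oplus>\<beta>\<in>?G. f \<alpha> \<otimes> (g \<beta> \<otimes> m \<alpha> \<beta>))"
    unfolding pairing_def by (intro finsum_cong' finsum_rdistr) (auto intro!: finsum_closed)
  also have "\<dots> = (\<Oplus>\<beta>\<in>?G. \<Oplus>\<alpha>\<in>?F. f \<alpha> \<otimes> (g \<beta> \<otimes> m \<alpha> \<beta>))"
    by (intro finsum_swap) auto
  also have "\<dots> = (\<Oplus>\<beta>\<in>?G. \<Oplus>\<alpha>\<in>?F. g \<beta> \<otimes> (f \<alpha> \<otimes> m \<alpha> \<beta>))"
    by (intro finsum_cong') (auto simp: m_lcomm intro!: finsum_closed)
  also have "\<dots> = pairing R g (\<lambda>\<beta>. pairing R f (\<lambda>\<alpha>. m \<alpha> \<beta>))"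
    unfolding pairing_def by (intro finsum_cong' finsum_rdistr[symmetric]) (auto intro!: finsum_closed)
  finally show ?thesis .
qed

lemma pairing_finsum:
  assumes f: "f \<in> carrier (mpoly n R)" and "finite D"
    and m: "\<And>\<alpha> \<delta>. m \<alpha> \<delta> \<in> carrier R" and c: "\<And>\<delta>. c \<delta> \<in> carrier R"
  shows "pairing R f (\<lambda>\<alpha>. \<Oplus>\<delta>\<in>D. m \<alpha> \<delta> \<otimes> c \<delta>) = (\<Oplus>\<delta>\<in>D. pairing R f (\<lambda>\<alpha>. m \<alpha> \<delta>) \<otimes> c \<delta>)"
proof -
  let ?F = "{\<alpha>. f \<alpha> \<noteq> \<zero>}"
  note [simp] = mpoly_coeff[OF f] mpoly_finite[OF f] m c \<open>finite D\<close>
  have "pairing R f (\<lambda>\<alpha>. \<Oplus>\<delta>\<in>D. m \<alpha> \<delta> \<otimes> c \<delta>) = (\<Oplus>\<alpha>\<in>?F. \<Oplus>\<delta>\<in>D. f \<alpha> \<otimes> (m \<alpha> \<delta> \<otimes> c \<delta>))"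
    unfolding pairing_def by (intro finsum_cong' finsum_rdistr) (auto intro!: finsum_closed)
  also have "\<dots> = (\<Oplus>\<delta>\<in>D. \<Oplus>\<alpha>\<in>?F. f \<alpha> \<otimes> (m \<alpha> \<delta> \<otimes> c \<delta>))"
    by (intro finsum_swap) auto
  also have "\<dots> = (\<Oplus>\<delta>\<in>D. \<Oplus>\<alpha>\<in>?F. (f \<alpha> \<otimes> m \<alpha> \<delta>) \<otimes> c \<delta>)"
    by (intro finsum_cong') (auto simp: m_assoc intro!: finsum_closed)
  also have "\<dots> = (\<Oplus>\<delta>\<in>D. pairing R f (\<lambda>\<alpha>. m \<alpha> \<delta>) \<otimes> c \<delta>)"
    unfolding pairing_def by (intro finsum_cong' finsum_ldistr[symmetric]) (auto intro!: finsum_closed)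
  finally show ?thesis .
qed

lemma mpoly_add_closed:
  assumes "f \<in> carrier (mpoly n R)" "g \<in> carrier (mpoly n R)"
  shows "f \<oplus>\<^bsub>mpoly n R\<^esub> g \<in> carrier (mpoly n R)"
proof -
  have "{\<alpha>. f \<alpha> \<oplus> g \<alpha> \<noteq> \<zero>} \<subseteq> {\<alpha>. f \<alpha> \<noteq> \<zero>} \<union> {\<alpha>. g \<alpha> \<noteq> \<zero>}" by auto
  then show ?thesis using assms unfolding mpoly_carrier mpoly_add
    by (auto dest: finite_subset)
qed

lemma pairing_add:
  assumes f: "f \<in> carrier (mpoly n R)" and g: "g \<in> carrier (mpoly n R)" and m: "\<And>\<alpha>. m \<alpha> \<in> carrier R"
  shows "pairing R (f \<oplus>\<^bsub>mpoly n R\<^esub> g) m = pairing R f m \<oplus> pairing R g m"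
proof -
  let ?S = "{\<alpha>. f \<alpha> \<noteq> \<zero>} \<union> {\<alpha>. g \<alpha> \<noteq> \<zero>}"
  note [simp] = mpoly_coeff[OF f] mpoly_coeff[OF g] mpoly_finite[OF f] mpoly_finite[OF g] m
  have "pairing R (f \<oplus>\<^bsub>mpoly n R\<^esub> g) m = (\<Oplus>\<alpha>\<in>?S. (f \<alpha> \<oplus> g \<alpha>) \<otimes> m \<alpha>)"
    unfolding mpoly_add by (intro pairing_superset) auto
  also have "\<dots> = (\<Oplus>\<alpha>\<in>?S. f \<alpha> \<otimes> m \<alpha> \<oplus> g \<alpha> \<otimes> m \<alpha>)"
    by (intro finsum_cong') (auto simp: l_distr)
  also have "\<dots> = (\<Oplus>\<alpha>\<in>?S. f \<alpha> \<otimes> m \<alpha>) \<oplus> (\<Oplus>\<alpha>\<in>?S. g \<alpha> \<otimes> m \<alpha>)"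
    by (intro finsum_addf) auto
  also have "\<dots> = pairing R f m \<oplus> pairing R g m"
    by (subst (1 2) pairing_superset[of ?S]) auto
  finally show ?thesis .
qed

text \<open>The convolution in \<open>mpoly\<close> runs over a box and uses truncated subtraction.
  It is rewritten as an iterated pairing with the indicator of \<alpha> + \<beta> = \<gamma>, in
  which both factors play the same role: for \<alpha> \<le> \<gamma> the only partner of \<alpha> is
  the exact difference, otherwise there is none.\<close>

lemma mpoly_mult_coeff:
  assumes f: "f \<in> carrier (mpoly n R)" and g: "g \<in> carrier (mpoly n R)"
  shows "(f \<otimes>\<^bsub>mpoly n R\<^esub> g) \<gamma>
    = pairing R f (\<lambda>\<alpha>. pairing R g (\<lambda>\<beta>. if expo_add \<alpha> \<beta> = \<gamma> then \<one> else \<zero>))"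
proof -
  note [simp] = mpoly_coeff[OF f] mpoly_coeff[OF g] mpoly_finite[OF f] mpoly_finite[OF g]
  define m where "m \<alpha> = (if \<forall>i. \<alpha> i \<le> \<gamma> i then g (\<lambda>i. \<gamma> i - \<alpha> i) else \<zero>)" for \<alpha>
  have m[simp]: "m \<alpha> \<in> carrier R" for \<alpha> by (simp add: m_def)
  have inner: "pairing R g (\<lambda>\<beta>. if expo_add \<alpha> \<beta> = \<gamma> then \<one> else \<zero>) = m \<alpha>" for \<alpha>
  proof (cases "\<forall>i. \<alpha> i \<le> \<gamma> i")
    case True
    then have "expo_add \<alpha> \<beta> = \<gamma> \<longleftrightarrow> \<beta> = (\<lambda>i. \<gamma> i - \<alpha> i)" for \<beta>
      unfolding expo_add_def fun_eq_iff by (metis add_diff_cancel_left' le_add_diff_inverse)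
    then show ?thesis using True by (simp add: m_def pairing_coeff[OF g])
  next
    case False
    then have "expo_add \<alpha> \<beta> \<noteq> \<gamma>" for \<beta> unfolding expo_add_def by auto
    moreover have "m \<alpha> = \<zero>" using False by (auto simp: m_def)
    ultimately show ?thesis by (simp add: pairing_def)
  qed
  show ?thesis
  proof (cases "\<gamma> \<in> expo n")
    case True
    let ?B = "{\<alpha>. \<forall>i. \<alpha> i \<le> \<gamma> i}"
    \<comment> \<open>Since \<gamma> vanishes from index \<open>n\<close> on, the box consists of
      functions with values in a finite set that are zero outside a finite set.\<close>
    have "?B \<subseteq> {\<alpha>. \<forall>i. (i \<in> {..<n} \<longrightarrow> \<alpha> i \<in> (\<Union>i<n. {..\<gamma> i})) \<and> (i \<notin> {..<n} \<longrightarrow> \<alpha> i = 0)}"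
      using True by (auto simp: expo_def) (metis le_zero_eq not_le)
    then have finB: "finite ?B"
      using finite_set_of_finite_funs[of "{..<n}" "\<Union>i<n. {..\<gamma> i}" 0] finite_subset by fastforce
    have "(f \<otimes>\<^bsub>mpoly n R\<^esub> g) \<gamma> = (\<Oplus>\<alpha>\<in>?B. f \<alpha> \<otimes> m \<alpha>)"
      using True by (auto simp: mpoly_def m_def intro!: finsum_cong')
    also have "\<dots> = (\<Oplus>\<alpha>\<in>{\<alpha>. f \<alpha> \<noteq> \<zero>}. f \<alpha> \<otimes> m \<alpha>)"
      using finB by (intro add.finprod_mono_neutral_cong) (auto simp: m_def)
    finally show ?thesis unfolding inner unfolding pairing_def .
  next
    case False
    have "f \<alpha> \<otimes> m \<alpha> = \<zero>" for \<alpha>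
    proof (rule ccontr)
      assume "f \<alpha> \<otimes> m \<alpha> \<noteq> \<zero>"
      then have "f \<alpha> \<noteq> \<zero>" "m \<alpha> \<noteq> \<zero>" by auto
      then have "\<alpha> \<in> expo n" "(\<lambda>i. \<gamma> i - \<alpha> i) \<in> expo n" "\<forall>i. \<alpha> i \<le> \<gamma> i"
        using mpoly_expo[OF f] mpoly_expo[OF g] by (auto simp: m_def split: if_splits)
      then have "\<gamma> \<in> expo n" by (auto simp: expo_def)
      with False show False by simp
    qed
    then show ?thesis using False unfolding inner by (simp add: pairing_def mpoly_def)
  qed
qed

lemma mpoly_mult_support:
  assumes f: "f \<in> carrier (mpoly n R)" and g: "g \<in> carrier (mpoly n R)"
  shows "{\<gamma>. (f \<otimes>\<^bsub>mpoly n R\<^esub> g) \<gamma> \<noteq> \<zero>} \<subseteq> (\<lambda>(\<alpha>, \<beta>). expo_add \<alpha> \<beta>) ` ({\<alpha>. f \<alpha> \<noteq> \<zero>} \<times> {\<beta>. g \<beta> \<noteq> \<zero>})"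
proof (rule subsetI, rule ccontr)
  fix \<gamma>
  assume \<gamma>: "\<gamma> \<in> {\<gamma>. (f \<otimes>\<^bsub>mpoly n R\<^esub> g) \<gamma> \<noteq> \<zero>}"
    and "\<gamma> \<notin> (\<lambda>(\<alpha>, \<beta>). expo_add \<alpha> \<beta>) ` ({\<alpha>. f \<alpha> \<noteq> \<zero>} \<times> {\<beta>. g \<beta> \<noteq> \<zero>})"
  then have ne: "expo_add \<alpha> \<beta> \<noteq> \<gamma>" if "f \<alpha> \<noteq> \<zero>" "g \<beta> \<noteq> \<zero>" for \<alpha> \<beta>
    using that by force
  have "pairing R g (\<lambda>\<beta>. if expo_add \<alpha> \<beta> = \<gamma> then \<one> else \<zero>) = \<zero>" if "f \<alpha> \<noteq> \<zero>" for \<alpha>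
    unfolding pairing_def using ne[OF that] mpoly_coeff[OF g] by (intro add.finprod_one_eqI) auto
  then have "pairing R f (\<lambda>\<alpha>. pairing R g (\<lambda>\<beta>. if expo_add \<alpha> \<beta> = \<gamma> then \<one> else \<zero>)) = \<zero>"
    unfolding pairing_def[of R f] using mpoly_coeff[OF f] by (intro add.finprod_one_eqI) auto
  with \<gamma> show False by (simp add: mpoly_mult_coeff[OF f g])
qed

lemma mpoly_mult_closed:
  assumes f: "f \<in> carrier (mpoly n R)" and g: "g \<in> carrier (mpoly n R)"
  shows "f \<otimes>\<^bsub>mpoly n R\<^esub> g \<in> carrier (mpoly n R)"
  unfolding mpoly_carrier
proof (intro conjI allI)
  show "(f \<otimes>\<^bsub>mpoly n R\<^esub> g) \<alpha> \<in> carrier R" for \<alpha>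
    using f g by (auto simp: mpoly_mult_coeff)
  show "{\<alpha>. (f \<otimes>\<^bsub>mpoly n R\<^esub> g) \<alpha> \<noteq> \<zero>} \<subseteq> expo n"
    using mpoly_mult_support[OF f g] mpoly_expo[OF f] mpoly_expo[OF g] expo_add_closed by fastforce
  show "finite {\<alpha>. (f \<otimes>\<^bsub>mpoly n R\<^esub> g) \<alpha> \<noteq> \<zero>}"
    using mpoly_mult_support[OF f g] mpoly_finite[OF f] mpoly_finite[OF g]
    by (meson finite_SigmaI finite_imageI finite_subset)
qed

text \<open>
  Pairing with all functions \<open>m\<close> determines a polynomial, and turns a product into an iterated
  pairing. Associativity and commutativity of the product follow formally.
\<close>

lemma pairing_mult:
  assumes f: "f \<in> carrier (mpoly n R)" and g: "g \<in> carrier (mpoly n R)" and m: "\<And>\<alpha>. m \<alpha> \<in> carrier R"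
  shows "pairing R (f \<otimes>\<^bsub>mpoly n R\<^esub> g) m = pairing R f (\<lambda>\<alpha>. pairing R g (\<lambda>\<beta>. m (expo_add \<alpha> \<beta>)))"
proof -
  let ?F = "{\<alpha>. f \<alpha> \<noteq> \<zero>}" and ?G = "{\<alpha>. g \<alpha> \<noteq> \<zero>}"
  let ?S = "(\<lambda>(\<alpha>, \<beta>). expo_add \<alpha> \<beta>) ` (?F \<times> ?G)"
  let ?d = "\<lambda>\<gamma> \<alpha> \<beta>. if expo_add \<alpha> \<beta> = \<gamma> then \<one> else \<zero>"
  note [simp] = mpoly_coeff[OF f] mpoly_coeff[OF g] mpoly_finite[OF f] mpoly_finite[OF g] m
  have fg: "f \<otimes>\<^bsub>mpoly n R\<^esub> g \<in> carrier (mpoly n R)" using f g by (rule mpoly_mult_closed)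
  have "pairing R (f \<otimes>\<^bsub>mpoly n R\<^esub> g) m = (\<Oplus>\<gamma>\<in>?S. (f \<otimes>\<^bsub>mpoly n R\<^esub> g) \<gamma> \<otimes> m \<gamma>)"
    using mpoly_mult_support[OF f g] mpoly_coeff[OF fg] by (intro pairing_superset) auto
  also have "\<dots> = (\<Oplus>\<gamma>\<in>?S. \<Oplus>\<alpha>\<in>?F. f \<alpha> \<otimes> (\<Oplus>\<beta>\<in>?G. g \<beta> \<otimes> (?d \<gamma> \<alpha> \<beta> \<otimes> m \<gamma>)))"
  proof (intro finsum_cong')
    fix \<gamma>
    have "(f \<otimes>\<^bsub>mpoly n R\<^esub> g) \<gamma> \<otimes> m \<gamma> = (\<Oplus>\<alpha>\<in>?F. (f \<alpha> \<otimes> (\<Oplus>\<beta>\<in>?G. g \<beta> \<otimes> ?d \<gamma> \<alpha> \<beta>)) \<otimes> m \<gamma>)"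
      unfolding mpoly_mult_coeff[OF f g] pairing_def
      by (intro finsum_ldistr) (auto intro!: finsum_closed)
    also have "\<dots> = (\<Oplus>\<alpha>\<in>?F. f \<alpha> \<otimes> (\<Oplus>\<beta>\<in>?G. g \<beta> \<otimes> (?d \<gamma> \<alpha> \<beta> \<otimes> m \<gamma>)))"
    proof (intro finsum_cong')
      fix \<alpha>
      have "(\<Oplus>\<beta>\<in>?G. g \<beta> \<otimes> ?d \<gamma> \<alpha> \<beta>) \<otimes> m \<gamma> = (\<Oplus>\<beta>\<in>?G. (g \<beta> \<otimes> ?d \<gamma> \<alpha> \<beta>) \<otimes> m \<gamma>)"
        by (intro finsum_ldistr) auto
      also have "\<dots> = (\<Oplus>\<beta>\<in>?G. g \<beta> \<otimes> (?d \<gamma> \<alpha> \<beta> \<otimes> m \<gamma>))"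
        by (intro finsum_cong') (auto simp: m_assoc)
      finally show "(f \<alpha> \<otimes> (\<Oplus>\<beta>\<in>?G. g \<beta> \<otimes> ?d \<gamma> \<alpha> \<beta>)) \<otimes> m \<gamma> = f \<alpha> \<otimes> (\<Oplus>\<beta>\<in>?G. g \<beta> \<otimes> (?d \<gamma> \<alpha> \<beta> \<otimes> m \<gamma>))"
        by (subst m_assoc) (auto intro!: finsum_closed)
    qed (auto intro!: finsum_closed)
    finally show "(f \<otimes>\<^bsub>mpoly n R\<^esub> g) \<gamma> \<otimes> m \<gamma> = (\<Oplus>\<alpha>\<in>?F. f \<alpha> \<otimes> (\<Oplus>\<beta>\<in>?G. g \<beta> \<otimes> (?d \<gamma> \<alpha> \<beta> \<otimes> m \<gamma>)))" .
  qed (auto intro!: finsum_closed)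
  also have "\<dots> = (\<Oplus>\<alpha>\<in>?F. \<Oplus>\<gamma>\<in>?S. f \<alpha> \<otimes> (\<Oplus>\<beta>\<in>?G. g \<beta> \<otimes> (?d \<gamma> \<alpha> \<beta> \<otimes> m \<gamma>)))"
    by (intro finsum_swap) (auto intro!: finsum_closed)
  also have "\<dots> = (\<Oplus>\<alpha>\<in>?F. f \<alpha> \<otimes> (\<Oplus>\<beta>\<in>?G. g \<beta> \<otimes> m (expo_add \<alpha> \<beta>)))"
  proof (intro finsum_cong')
    fix \<alpha> assume \<alpha>: "\<alpha> \<in> ?F"
    have "(\<Oplus>\<gamma>\<in>?S. f \<alpha> \<otimes> (\<Oplus>\<beta>\<in>?G. g \<beta> \<otimes> (?d \<gamma> \<alpha> \<beta> \<otimes> m \<gamma>)))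
        = f \<alpha> \<otimes> (\<Oplus>\<gamma>\<in>?S. \<Oplus>\<beta>\<in>?G. g \<beta> \<otimes> (?d \<gamma> \<alpha> \<beta> \<otimes> m \<gamma>))"
      by (intro finsum_rdistr[symmetric]) (auto intro!: finsum_closed)
    also have "(\<Oplus>\<gamma>\<in>?S. \<Oplus>\<beta>\<in>?G. g \<beta> \<otimes> (?d \<gamma> \<alpha> \<beta> \<otimes> m \<gamma>)) = (\<Oplus>\<beta>\<in>?G. \<Oplus>\<gamma>\<in>?S. g \<beta> \<otimes> (?d \<gamma> \<alpha> \<beta> \<otimes> m \<gamma>))"
      by (intro finsum_swap) auto
    also have "\<dots> = (\<Oplus>\<beta>\<in>?G. g \<beta> \<otimes> m (expo_add \<alpha> \<beta>))"
    proof (intro finsum_cong')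
      fix \<beta> assume \<beta>: "\<beta> \<in> ?G"
      \<comment> \<open>For fixed \<alpha> and \<beta> the sum over \<gamma> collapses to the single
        index \<alpha> + \<beta>, which belongs to \<open>?S\<close> by its construction from both
        supports.\<close>
      have "(\<Oplus>\<gamma>\<in>?S. g \<beta> \<otimes> (?d \<gamma> \<alpha> \<beta> \<otimes> m \<gamma>)) = (\<Oplus>\<gamma>\<in>?S. if expo_add \<alpha> \<beta> = \<gamma> then g \<beta> \<otimes> m \<gamma> else \<zero>)"
        by (intro finsum_cong') auto
      also have "\<dots> = g \<beta> \<otimes> m (expo_add \<alpha> \<beta>)"
        using \<alpha> \<beta> by (intro finsum_singleton) auto
      finally show "(\<Oplus>\<gamma>\<in>?S. g \<beta> \<otimes> (?d \<gamma> \<alpha> \<beta> \<otimes> m \<gamma>)) = g \<beta> \<otimes> m (expo_add \<alpha> \<beta>)" .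
    qed auto
    finally show "(\<Oplus>\<gamma>\<in>?S. f \<alpha> \<otimes> (\<Oplus>\<beta>\<in>?G. g \<beta> \<otimes> (?d \<gamma> \<alpha> \<beta> \<otimes> m \<gamma>)))
        = f \<alpha> \<otimes> (\<Oplus>\<beta>\<in>?G. g \<beta> \<otimes> m (expo_add \<alpha> \<beta>))" .
  qed (auto intro!: finsum_closed)
  finally show ?thesis by (simp add: pairing_def)
qed

lemma mpoly_eqI:
  assumes "f \<in> carrier (mpoly n R)" "g \<in> carrier (mpoly n R)"
    and "\<And>m. (\<And>\<alpha>. m \<alpha> \<in> carrier R) \<Longrightarrow> pairing R f m = pairing R g m"
  shows "f = g"
proof
  fix \<alpha>
  show "f \<alpha> = g \<alpha>"
    using assms(3)[of "\<lambda>\<gamma>. if \<gamma> = \<alpha> then \<one> else \<zero>"] pairing_coeff[OF assms(1), of \<one> \<alpha>]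
      pairing_coeff[OF assms(2), of \<one> \<alpha>] mpoly_coeff[OF assms(1)] mpoly_coeff[OF assms(2)] by simp
qed

lemma mono_poly_closed [simp]: "\<alpha> \<in> expo n \<Longrightarrow> mono_poly R \<alpha> \<in> carrier (mpoly n R)"
  by (auto simp: mpoly_carrier mono_poly_def)

lemma mpoly_single_closed:
  "\<alpha> \<in> expo n \<Longrightarrow> c \<in> carrier R \<Longrightarrow> (\<lambda>\<gamma>. if \<gamma> = \<alpha> then c else \<zero>) \<in> carrier (mpoly n R)"
  by (auto simp: mpoly_carrier)

lemma mpoly_neg_closed: "f \<in> carrier (mpoly n R) \<Longrightarrow> (\<lambda>\<gamma>. \<ominus> f \<gamma>) \<in> carrier (mpoly n R)"
  by (simp add: mpoly_carrier)

section \<open>Ring axioms and subtraction for polynomials in n variables\<close>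

theorem mpoly_cring: "cring (mpoly n R)"
proof (rule cringI)
  let ?P = "mpoly n R"
  have one: "\<one>\<^bsub>?P\<^esub> \<in> carrier ?P" by (simp add: mpoly_one)
  show "abelian_group ?P"
  proof (rule abelian_groupI)
    fix x assume x: "x \<in> carrier ?P"
    have "(\<lambda>\<gamma>. \<ominus> x \<gamma>) \<oplus>\<^bsub>?P\<^esub> x = \<zero>\<^bsub>?P\<^esub>"
      using mpoly_coeff[OF x] by (simp add: mpoly_add mpoly_zero l_neg)
    then show "\<exists>y\<in>carrier ?P. y \<oplus>\<^bsub>?P\<^esub> x = \<zero>\<^bsub>?P\<^esub>" using mpoly_neg_closed[OF x] by blast
  next
    show "\<zero>\<^bsub>?P\<^esub> \<in> carrier ?P" by (simp add: mpoly_carrier mpoly_zero)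
  qed (auto simp: mpoly_add_closed, auto simp: mpoly_add mpoly_zero mpoly_coeff a_ac)
  show "comm_monoid ?P"
  proof (rule comm_monoidI)
    show "x \<otimes>\<^bsub>?P\<^esub> y \<in> carrier ?P" if "x \<in> carrier ?P" "y \<in> carrier ?P" for x y
      using that by (rule mpoly_mult_closed)
    show "\<one>\<^bsub>?P\<^esub> \<in> carrier ?P" by (rule one)
    show "x \<otimes>\<^bsub>?P\<^esub> y \<otimes>\<^bsub>?P\<^esub> z = x \<otimes>\<^bsub>?P\<^esub> (y \<otimes>\<^bsub>?P\<^esub> z)"
      if "x \<in> carrier ?P" "y \<in> carrier ?P" "z \<in> carrier ?P" for x y z
      using that by (intro mpoly_eqI[of _ n]) (simp_all add: pairing_mult mpoly_mult_closed expo_add_assoc)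
    show "\<one>\<^bsub>?P\<^esub> \<otimes>\<^bsub>?P\<^esub> x = x" if "x \<in> carrier ?P" for x
      using that one by (intro mpoly_eqI[of _ n]) (simp_all add: pairing_mult mpoly_mult_closed mpoly_one)
    show "x \<otimes>\<^bsub>?P\<^esub> y = y \<otimes>\<^bsub>?P\<^esub> x" if "x \<in> carrier ?P" "y \<in> carrier ?P" for x y
    proof (rule mpoly_eqI)
      fix m :: "(nat \<Rightarrow> nat) \<Rightarrow> 'a" assume "\<And>\<alpha>. m \<alpha> \<in> carrier R"
      then show "pairing R (x \<otimes>\<^bsub>?P\<^esub> y) m = pairing R (y \<otimes>\<^bsub>?P\<^esub> x) m"
        using that by (simp add: pairing_mult) (subst pairing_swap, simp_all add: expo_add_commute)
    qed (use that in \<open>auto intro: mpoly_mult_closed\<close>)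
  qed
  show "(x \<oplus>\<^bsub>?P\<^esub> y) \<otimes>\<^bsub>?P\<^esub> z = x \<otimes>\<^bsub>?P\<^esub> z \<oplus>\<^bsub>?P\<^esub> y \<otimes>\<^bsub>?P\<^esub> z"
    if "x \<in> carrier ?P" "y \<in> carrier ?P" "z \<in> carrier ?P" for x y z
    using that
    by (intro mpoly_eqI[of _ n]) (simp_all add: pairing_mult pairing_add mpoly_mult_closed mpoly_add_closed)
qed

lemma mpoly_minus:
  assumes f: "f \<in> carrier (mpoly n R)" and g: "g \<in> carrier (mpoly n R)"
  shows "f \<ominus>\<^bsub>mpoly n R\<^esub> g = (\<lambda>\<gamma>. f \<gamma> \<ominus> g \<gamma>)"
proof -
  interpret P: cring "mpoly n R" by (rule mpoly_cring)
  have "\<ominus>\<^bsub>mpoly n R\<^esub> g = (\<lambda>\<gamma>. \<ominus> g \<gamma>)"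
    using mpoly_coeff[OF g] mpoly_neg_closed[OF g] g
    by (intro P.minus_equality) (simp_all add: mpoly_add mpoly_zero l_neg)
  then show ?thesis by (simp add: a_minus_def mpoly_add)
qed

lemma pairing_minus:
  assumes f: "f \<in> carrier (mpoly n R)" and g: "g \<in> carrier (mpoly n R)" and m: "\<And>\<alpha>. m \<alpha> \<in> carrier R"
  shows "pairing R (f \<ominus>\<^bsub>mpoly n R\<^esub> g) m = pairing R f m \<ominus> pairing R g m"
proof -
  interpret P: cring "mpoly n R" by (rule mpoly_cring)
  have "pairing R ((f \<ominus>\<^bsub>mpoly n R\<^esub> g) \<oplus>\<^bsub>mpoly n R\<^esub> g) m = pairing R (f \<ominus>\<^bsub>mpoly n R\<^esub> g) m \<oplus> pairing R g m"
    using f g m by (intro pairing_add) auto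
  moreover have "(f \<ominus>\<^bsub>mpoly n R\<^esub> g) \<oplus>\<^bsub>mpoly n R\<^esub> g = f"
    using f g by (simp add: a_minus_def P.a_assoc P.l_neg)
  moreover have "pairing R (f \<ominus>\<^bsub>mpoly n R\<^esub> g) m \<in> carrier R" "pairing R g m \<in> carrier R"
    using pairing_closed[OF P.minus_closed[OF f g] m] pairing_closed[OF g m] by simp_all
  ultimately show ?thesis by (metis a_minus_def a_assoc a_inv_closed r_neg r_zero)
qed

end


section \<open>Monic ideals and normal forms\<close>

text \<open>For a monomial order, \<open>N\<close> is zero outside \<open>expo n\<close> and
  \<Delta>, because \<open>r\<close> relates elements of \<open>expo n\<close> only. This
  normalization makes \<open>N\<close> unique as a total function, so that equality of ideals
  becomes equality of functions.\<close>

definition nf_coeffs :: "((nat \<Rightarrow> nat) \<times> (nat \<Rightarrow> nat)) set \<Rightarrow> (nat \<Rightarrow> nat) set \<Rightarrow> ('a, 'm) ring_scheme \<Rightarrow>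
    ((nat \<Rightarrow> nat) \<Rightarrow> (nat \<Rightarrow> nat) \<Rightarrow> 'a) \<Rightarrow> bool" where
  "nf_coeffs r \<Delta> B N \<longleftrightarrow> (\<forall>\<alpha> \<beta>. N \<alpha> \<beta> \<in> carrier B) \<and>
     (\<forall>\<alpha>\<in>\<Delta>. \<forall>\<beta>\<in>\<Delta>. N \<alpha> \<beta> = (if \<alpha> = \<beta> then \<one>\<^bsub>B\<^esub> else \<zero>\<^bsub>B\<^esub>)) \<and>
     (\<forall>\<alpha> \<beta>. N \<alpha> \<beta> \<noteq> \<zero>\<^bsub>B\<^esub> \<longrightarrow> \<beta> \<in> \<Delta> \<and> (\<beta>, \<alpha>) \<in> r)"

text \<open>
  \<open>N \<alpha> \<beta>\<close> is the coefficient of $x^\beta$ in the normal form of $x^\alpha$ modulo a monic ideal;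
  the last equation expresses that the ideal is closed under multiplication by $x^\gamma$.
\<close>

definition normal_forms :: "nat \<Rightarrow> ((nat \<Rightarrow> nat) \<times> (nat \<Rightarrow> nat)) set \<Rightarrow> (nat \<Rightarrow> nat) set \<Rightarrow> ('a, 'm) ring_scheme \<Rightarrow>
    ((nat \<Rightarrow> nat) \<Rightarrow> (nat \<Rightarrow> nat) \<Rightarrow> 'a) \<Rightarrow> bool" where
  "normal_forms n r \<Delta> B N \<longleftrightarrow> nf_coeffs r \<Delta> B N \<and>
     (\<forall>\<alpha>\<in>expo n. \<forall>\<gamma>\<in>expo n. \<forall>\<beta>\<in>\<Delta>.
        N (expo_add \<alpha> \<gamma>) \<beta> = (\<Oplus>\<^bsub>B\<^esub>\<delta>\<in>\<Delta>. N \<alpha> \<delta> \<otimes>\<^bsub>B\<^esub> N (expo_add \<delta> \<gamma>) \<beta>))"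

text \<open>The kernel of the linear map from B[x] to the free module on \<Delta> that sends each
  monomial to its normal form.\<close>

definition nf_ideal :: "nat \<Rightarrow> (nat \<Rightarrow> nat) set \<Rightarrow> ('a, 'm) ring_scheme \<Rightarrow>
    ((nat \<Rightarrow> nat) \<Rightarrow> (nat \<Rightarrow> nat) \<Rightarrow> 'a) \<Rightarrow> ((nat \<Rightarrow> nat) \<Rightarrow> 'a) set" where
  "nf_ideal n \<Delta> B N = {f \<in> carrier (mpoly n B). \<forall>\<beta>\<in>\<Delta>. pairing B f (\<lambda>\<alpha>. N \<alpha> \<beta>) = \<zero>\<^bsub>B\<^esub>}"

text \<open>These polynomials act as a reduced Groebner basis, but with one element for each
  exponent outside \<Delta> instead of one for each minimal such exponent. Division then takes a
  single subtraction per term.\<close>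

definition reduced_poly :: "('a, 'm) ring_scheme \<Rightarrow> ((nat \<Rightarrow> nat) \<Rightarrow> (nat \<Rightarrow> nat) \<Rightarrow> 'a) \<Rightarrow>
    (nat \<Rightarrow> nat) \<Rightarrow> (nat \<Rightarrow> nat) \<Rightarrow> 'a" where
  "reduced_poly B N \<alpha> = (\<lambda>\<gamma>. (if \<gamma> = \<alpha> then \<one>\<^bsub>B\<^esub> else \<zero>\<^bsub>B\<^esub>) \<ominus>\<^bsub>B\<^esub> N \<alpha> \<gamma>)"

section \<open>From normal form coefficients to monic ideals\<close>

locale hilb_setting = cring R for R (structure) +
  fixes n :: nat and r :: "((nat \<Rightarrow> nat) \<times> (nat \<Rightarrow> nat)) set" and \<Delta> :: "(nat \<Rightarrow> nat) set"
  assumes mo: "monomial_order n r" and standard: "standard_set n \<Delta>" and finite_\<Delta>: "finite \<Delta>"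
begin

lemma \<Delta>_expo: "\<Delta> \<subseteq> expo n"
  using standard by (simp add: standard_set_def)

lemma nf_coeffsD:
  assumes "nf_coeffs r \<Delta> R N"
  shows "N \<alpha> \<beta> \<in> carrier R"
    and "\<alpha> \<in> \<Delta> \<Longrightarrow> \<beta> \<in> \<Delta> \<Longrightarrow> N \<alpha> \<beta> = (if \<alpha> = \<beta> then \<one> else \<zero>)"
    and "N \<alpha> \<beta> \<noteq> \<zero> \<Longrightarrow> \<beta> \<in> \<Delta>"
    and "N \<alpha> \<beta> \<noteq> \<zero> \<Longrightarrow> (\<beta>, \<alpha>) \<in> r"
  using assms unfolding nf_coeffs_def by blast+

lemma normal_forms_coeffs: "normal_forms n r \<Delta> R N \<Longrightarrow> nf_coeffs r \<Delta> R N"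
  by (simp add: normal_forms_def)

lemma reduced_poly_closed:
  assumes N: "nf_coeffs r \<Delta> R N" and \<alpha>: "\<alpha> \<in> expo n"
  shows "reduced_poly R N \<alpha> \<in> carrier (mpoly n R)"
proof -
  have "{\<gamma>. reduced_poly R N \<alpha> \<gamma> \<noteq> \<zero>} \<subseteq> insert \<alpha> \<Delta>"
  proof
    fix \<gamma> assume \<gamma>: "\<gamma> \<in> {\<gamma>. reduced_poly R N \<alpha> \<gamma> \<noteq> \<zero>}"
    show "\<gamma> \<in> insert \<alpha> \<Delta>"
    proof (rule ccontr)
      assume "\<gamma> \<notin> insert \<alpha> \<Delta>"
      then have "\<gamma> \<noteq> \<alpha>" "N \<alpha> \<gamma> = \<zero>" using nf_coeffsD(3)[OF N] by blast+
      with \<gamma> show False by (simp add: reduced_poly_def a_minus_def)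
    qed
  qed
  moreover have "insert \<alpha> \<Delta> \<subseteq> expo n" "finite (insert \<alpha> \<Delta>)" using \<alpha> \<Delta>_expo finite_\<Delta> by auto
  ultimately have "{\<gamma>. reduced_poly R N \<alpha> \<gamma> \<noteq> \<zero>} \<subseteq> expo n" "finite {\<gamma>. reduced_poly R N \<alpha> \<gamma> \<noteq> \<zero>}"
    by (blast, metis finite_subset)
  moreover have "reduced_poly R N \<alpha> \<gamma> \<in> carrier R" for \<gamma>
    using nf_coeffsD(1)[OF N] by (simp add: reduced_poly_def)
  ultimately show ?thesis by (simp add: mpoly_carrier)
qed

lemma nf_row_closed:
  assumes N: "nf_coeffs r \<Delta> R N"
  shows "N \<alpha> \<in> carrier (mpoly n R)"
proof -
  have "{\<gamma>. N \<alpha> \<gamma> \<noteq> \<zero>} \<subseteq> \<Delta>" using nf_coeffsD(3)[OF N] by blast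
  then have "{\<gamma>. N \<alpha> \<gamma> \<noteq> \<zero>} \<subseteq> expo n" "finite {\<gamma>. N \<alpha> \<gamma> \<noteq> \<zero>}"
    using \<Delta>_expo finite_\<Delta> by (blast, metis finite_subset)
  then show ?thesis using nf_coeffsD(1)[OF N] by (simp add: mpoly_carrier)
qed

lemma reduced_poly_eq:
  assumes N: "nf_coeffs r \<Delta> R N" and \<alpha>: "\<alpha> \<in> expo n"
  shows "reduced_poly R N \<alpha> = mono_poly R \<alpha> \<ominus>\<^bsub>mpoly n R\<^esub> N \<alpha>"
  by (subst mpoly_minus[OF mono_poly_closed[OF \<alpha>] nf_row_closed[OF N]])
    (simp add: reduced_poly_def mono_poly_def)

lemma pairing_reduced_poly:
  assumes N: "nf_coeffs r \<Delta> R N" and \<alpha>: "\<alpha> \<in> expo n" and m: "\<And>\<alpha>. m \<alpha> \<in> carrier R"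
  shows "pairing R (reduced_poly R N \<alpha>) m = m \<alpha> \<ominus> (\<Oplus>\<delta>\<in>\<Delta>. N \<alpha> \<delta> \<otimes> m \<delta>)"
proof -
  have "pairing R (N \<alpha>) m = (\<Oplus>\<delta>\<in>\<Delta>. N \<alpha> \<delta> \<otimes> m \<delta>)"
    using nf_coeffsD[OF N] finite_\<Delta> m by (intro pairing_superset) auto
  then show ?thesis
    using \<alpha> m nf_row_closed[OF N] by (subst reduced_poly_eq[OF N \<alpha>], subst pairing_minus) auto
qed

lemma finsum_nf_delta:
  assumes N: "nf_coeffs r \<Delta> R N" and \<beta>: "\<beta> \<in> \<Delta>" and c: "\<And>\<delta>. c \<delta> \<in> carrier R"
  shows "(\<Oplus>\<delta>\<in>\<Delta>. c \<delta> \<otimes> N \<delta> \<beta>) = c \<beta>"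
proof -
  have "(\<Oplus>\<delta>\<in>\<Delta>. c \<delta> \<otimes> N \<delta> \<beta>) = (\<Oplus>\<delta>\<in>\<Delta>. if \<beta> = \<delta> then c \<delta> else \<zero>)"
    using nf_coeffsD(2)[OF N] \<beta> c by (intro finsum_cong') auto
  also have "\<dots> = c \<beta>" using \<beta> c finite_\<Delta> by (intro finsum_singleton) auto
  finally show ?thesis .
qed

lemma reduced_poly_in_nf_ideal:
  assumes N: "nf_coeffs r \<Delta> R N" and \<alpha>: "\<alpha> \<in> expo n"
  shows "reduced_poly R N \<alpha> \<in> nf_ideal n \<Delta> R N"
proof -
  have "pairing R (reduced_poly R N \<alpha>) (\<lambda>\<alpha>. N \<alpha> \<beta>) = \<zero>" if "\<beta> \<in> \<Delta>" for \<beta>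
    using that nf_coeffsD(1)[OF N] finsum_nf_delta[OF N that, of "N \<alpha>"]
    by (subst pairing_reduced_poly[OF N \<alpha>]) (auto simp: a_minus_def r_neg)
  then show ?thesis using reduced_poly_closed[OF N \<alpha>] by (simp add: nf_ideal_def)
qed

text \<open>One inclusion suffices: the reduced polynomial of \<open>N\<close> at \<alpha> is killed
  by the functionals of \<open>N'\<close>, and the functional of \<beta> takes the value
  \<open>N' \<alpha> \<beta> \<ominus> N \<alpha> \<beta>\<close> on it.\<close>

lemma nf_ideal_determines_coeffs:
  assumes "nf_coeffs r \<Delta> R N" "nf_coeffs r \<Delta> R N'" "nf_ideal n \<Delta> R N \<subseteq> nf_ideal n \<Delta> R N'"
  shows "N = N'"
proof (intro ext)
  fix \<alpha> \<beta>
  note N = nf_coeffsD[OF assms(1)] and N' = nf_coeffsD[OF assms(2)]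
  show "N \<alpha> \<beta> = N' \<alpha> \<beta>"
  proof (cases "\<alpha> \<in> expo n \<and> \<beta> \<in> \<Delta>")
    case True
    have "reduced_poly R N \<alpha> \<in> nf_ideal n \<Delta> R N'"
      using reduced_poly_in_nf_ideal[OF assms(1)] assms(3) True by blast
    then have "pairing R (reduced_poly R N \<alpha>) (\<lambda>\<alpha>. N' \<alpha> \<beta>) = \<zero>"
      using True by (simp add: nf_ideal_def)
    moreover have "pairing R (reduced_poly R N \<alpha>) (\<lambda>\<alpha>. N' \<alpha> \<beta>) = N' \<alpha> \<beta> \<ominus> N \<alpha> \<beta>"
      using True N'(1) N(1) finsum_nf_delta[OF assms(2), of \<beta> "N \<alpha>"]
      by (subst pairing_reduced_poly[OF assms(1)]) auto
    ultimately show ?thesis using N(1) N'(1) r_right_minus_eq by metis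
  next
    case False
    then have "N \<alpha> \<beta> = \<zero>" "N' \<alpha> \<beta> = \<zero>" using N(3,4) N'(3,4) mo_field[OF mo] by blast+
    then show ?thesis by simp
  qed
qed

text \<open>Multiplication by the monomial of \<gamma> replaces the functional of \<beta> by
  \<open>\<lambda>\<alpha>. N (expo_add \<gamma> \<alpha>) \<beta>\<close>. The multiplication
  equation writes this as a linear combination of the functionals of all \<delta> \<in> \<Delta>,
  and these vanish on \<open>f\<close>.\<close>

lemma nf_ideal_is_ideal:
  assumes "normal_forms n r \<Delta> R N"
  shows "ideal (nf_ideal n \<Delta> R N) (mpoly n R)"
proof -
  interpret P: cring "mpoly n R" by (rule mpoly_cring)
  have N: "nf_coeffs r \<Delta> R N"
    and mult: "\<And>\<alpha> \<gamma> \<beta>. \<alpha> \<in> expo n \<Longrightarrow> \<gamma> \<in> expo n \<Longrightarrow> \<beta> \<in> \<Delta> \<Longrightarrow>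
        N (expo_add \<alpha> \<gamma>) \<beta> = (\<Oplus>\<delta>\<in>\<Delta>. N \<alpha> \<delta> \<otimes> N (expo_add \<delta> \<gamma>) \<beta>)"
    using assms by (auto simp: normal_forms_def)
  note [simp] = nf_coeffsD(1)[OF N]
  let ?I = "nf_ideal n \<Delta> R N"
  have sub: "?I \<subseteq> carrier (mpoly n R)" by (auto simp: nf_ideal_def)
  have l: "g \<otimes>\<^bsub>mpoly n R\<^esub> f \<in> ?I" if f: "f \<in> ?I" and g: "g \<in> carrier (mpoly n R)" for f g
  proof -
    have fc: "f \<in> carrier (mpoly n R)" using f sub by blast
    have "pairing R (g \<otimes>\<^bsub>mpoly n R\<^esub> f) (\<lambda>\<alpha>. N \<alpha> \<beta>) = \<zero>" if \<beta>: "\<beta> \<in> \<Delta>" for \<beta>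
    proof -
      have "pairing R f (\<lambda>\<alpha>. N (expo_add \<gamma> \<alpha>) \<beta>) = \<zero>" if \<gamma>: "\<gamma> \<in> expo n" for \<gamma>
      proof -
        have "pairing R f (\<lambda>\<alpha>. N (expo_add \<gamma> \<alpha>) \<beta>) = pairing R f (\<lambda>\<alpha>. \<Oplus>\<delta>\<in>\<Delta>. N \<alpha> \<delta> \<otimes> N (expo_add \<delta> \<gamma>) \<beta>)"
          using \<gamma> \<beta> by (intro pairing_cong[OF fc]) (auto simp: mult[symmetric] expo_add_commute)
        also have "\<dots> = (\<Oplus>\<delta>\<in>\<Delta>. pairing R f (\<lambda>\<alpha>. N \<alpha> \<delta>) \<otimes> N (expo_add \<delta> \<gamma>) \<beta>)"
          by (intro pairing_finsum[OF fc finite_\<Delta>]) auto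
        also have "\<dots> = \<zero>"
          using f by (intro add.finprod_one_eqI) (auto simp: nf_ideal_def)
        finally show ?thesis .
      qed
      then have "pairing R g (\<lambda>\<gamma>. pairing R f (\<lambda>\<alpha>. N (expo_add \<gamma> \<alpha>) \<beta>)) = pairing R g (\<lambda>\<gamma>. \<zero>)"
        by (intro pairing_cong[OF g]) auto
      also have "\<dots> = \<zero>"
        unfolding pairing_def using mpoly_coeff[OF g] by (intro add.finprod_one_eqI) auto
      finally show ?thesis by (subst pairing_mult[OF g fc]) auto
    qed
    then show ?thesis using P.m_closed[OF g fc] by (simp add: nf_ideal_def)
  qed
  show ?thesis
  proof (rule idealI)
    show "ring (mpoly n R)" by (rule P.ring_axioms)
    show "subgroup ?I (add_monoid (mpoly n R))"
    proof (rule P.add.subgroupI)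
      show "?I \<subseteq> carrier (mpoly n R)" by (rule sub)
      have "\<zero>\<^bsub>mpoly n R\<^esub> \<in> ?I" by (simp add: nf_ideal_def pairing_def mpoly_zero mpoly_carrier)
      then show "?I \<noteq> {}" by blast
      show "\<ominus>\<^bsub>mpoly n R\<^esub> f \<in> ?I" if "f \<in> ?I" for f
      proof -
        have "\<ominus>\<^bsub>mpoly n R\<^esub> f = (\<ominus>\<^bsub>mpoly n R\<^esub> \<one>\<^bsub>mpoly n R\<^esub>) \<otimes>\<^bsub>mpoly n R\<^esub> f"
          using that sub by (simp add: P.l_minus subset_iff)
        then show ?thesis using l[OF that] by simp
      qed
      show "f \<oplus>\<^bsub>mpoly n R\<^esub> g \<in> ?I" if "f \<in> ?I" "g \<in> ?I" for f g
        using that by (auto simp: nf_ideal_def pairing_add)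
    qed
    show "g \<otimes>\<^bsub>mpoly n R\<^esub> f \<in> ?I" "f \<otimes>\<^bsub>mpoly n R\<^esub> g \<in> ?I"
      if "f \<in> ?I" "g \<in> carrier (mpoly n R)" for f g
      using l[OF that] P.m_comm[of f g] that sub by auto
  qed
qed

lemma lead_exp_eqI:
  assumes "f \<alpha> \<noteq> \<zero>" "\<And>\<beta>. f \<beta> \<noteq> \<zero> \<Longrightarrow> (\<beta>, \<alpha>) \<in> r"
  shows "lead_exp r R f = \<alpha>"
  unfolding lead_exp_def using assms mo_antisym[OF mo] by (intro the_equality) blast+

lemma ex_max:
  assumes "finite S" "S \<noteq> {}" "S \<subseteq> expo n"
  shows "\<exists>\<alpha>\<in>S. \<forall>\<beta>\<in>S. (\<beta>, \<alpha>) \<in> r"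
  using assms
proof (induction S rule: finite_ne_induct)
  case (singleton x)
  then show ?case using mo_refl[OF mo] by simp
next
  case (insert x S)
  then obtain \<alpha> where \<alpha>: "\<alpha> \<in> S" "\<forall>\<beta>\<in>S. (\<beta>, \<alpha>) \<in> r" by auto
  have "(x, \<alpha>) \<in> r \<or> (\<alpha>, x) \<in> r" using mo_total[OF mo] insert.prems \<alpha>(1) by blast
  then show ?case
  proof
    assume "(\<alpha>, x) \<in> r"
    then have "\<forall>\<beta>\<in>insert x S. (\<beta>, x) \<in> r"
      using \<alpha>(2) mo_trans[OF mo] mo_refl[OF mo] insert.prems by blast
    then show ?case by blast
  qed (use \<alpha> in blast)
qed

lemma lead_exp_props:
  assumes f: "f \<in> carrier (mpoly n R)" and nz: "f \<noteq> \<zero>\<^bsub>mpoly n R\<^esub>"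
  shows "f (lead_exp r R f) \<noteq> \<zero>" and "\<And>\<beta>. f \<beta> \<noteq> \<zero> \<Longrightarrow> (\<beta>, lead_exp r R f) \<in> r"
    and "lead_exp r R f \<in> expo n"
proof -
  have "{\<alpha>. f \<alpha> \<noteq> \<zero>} \<noteq> {}" using nz by (auto simp: mpoly_zero)
  then obtain \<alpha> where \<alpha>: "f \<alpha> \<noteq> \<zero>" "\<And>\<beta>. f \<beta> \<noteq> \<zero> \<Longrightarrow> (\<beta>, \<alpha>) \<in> r"
    using ex_max[of "{\<alpha>. f \<alpha> \<noteq> \<zero>}"] mpoly_finite[OF f] mpoly_expo[OF f] by blast
  have "lead_exp r R f = \<alpha>" by (rule lead_exp_eqI) (use \<alpha> in auto)
  then show "f (lead_exp r R f) \<noteq> \<zero>" "\<And>\<beta>. f \<beta> \<noteq> \<zero> \<Longrightarrow> (\<beta>, lead_exp r R f) \<in> r" "lead_exp r R f \<in> expo n"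
    using \<alpha> mpoly_expo[OF f] by auto
qed

lemma zero_ring_mpoly:
  assumes "carrier R = {\<zero>}"
  shows "carrier (mpoly n R) = {\<zero>\<^bsub>mpoly n R\<^esub>}"
  using assms by (auto simp: mpoly_carrier mpoly_zero)

text \<open>If the leading exponent of \<open>f\<close> lay in \<Delta>, its functional would see
  the leading term only: a nonzero \<open>N \<alpha> \<beta>\<close> forces \<beta> \<preceq>
  \<alpha>, whereas the support of \<open>f\<close> lies below its leading exponent. The leading
  coefficient would be zero. Conversely, scalar multiples of reduced polynomials realize every
  leading coefficient, which gives monicity. Over the zero ring the convention of the functor
  applies.\<close>

lemma nf_ideal_in_Hilb:
  assumes "normal_forms n r \<Delta> R N"
  shows "nf_ideal n \<Delta> R N \<in> Hilb_functor n r \<Delta> R"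
proof (cases "carrier R = {\<zero>}")
  case True
  interpret P: cring "mpoly n R" by (rule mpoly_cring)
  interpret I: ideal "nf_ideal n \<Delta> R N" "mpoly n R" by (rule nf_ideal_is_ideal[OF assms])
  have "nf_ideal n \<Delta> R N = carrier (mpoly n R)"
    unfolding zero_ring_mpoly[OF True]
    using I.a_subset[unfolded zero_ring_mpoly[OF True]] I.zero_closed by auto
  then show ?thesis using True by (simp add: Hilb_functor_def)
next
  case False
  let ?I = "nf_ideal n \<Delta> R N"
  have N: "nf_coeffs r \<Delta> R N" using assms by (simp add: normal_forms_def)
  note Nc = nf_coeffsD[OF N]
  have nontriv: "\<one> \<noteq> \<zero>" using False one_zeroD by blast
  interpret P: cring "mpoly n R" by (rule mpoly_cring)
  interpret I: ideal ?I "mpoly n R" by (rule nf_ideal_is_ideal[OF assms])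
  have lead_notin: "lead_exp r R f \<in> expo n - \<Delta>" if f: "f \<in> ?I - {\<zero>\<^bsub>mpoly n R\<^esub>}" for f
  proof -
    have fc: "f \<in> carrier (mpoly n R)" using f I.a_subset by blast
    note lp = lead_exp_props[OF fc]
    let ?a = "lead_exp r R f"
    have False if a: "?a \<in> \<Delta>"
    proof -
      have "pairing R f (\<lambda>\<alpha>. N \<alpha> ?a) = (\<Oplus>\<alpha>\<in>{\<alpha>. f \<alpha> \<noteq> \<zero>}. if ?a = \<alpha> then f \<alpha> else \<zero>)"
        unfolding pairing_def
      proof (intro finsum_cong')
        fix \<alpha> assume "\<alpha> \<in> {\<alpha>. f \<alpha> \<noteq> \<zero>}"
        then have "(\<alpha>, ?a) \<in> r" using lp(2)[of \<alpha>] f by simp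
        then have "N \<alpha> ?a = \<zero>" if "\<alpha> \<noteq> ?a" using Nc(4)[of \<alpha> ?a] mo_antisym[OF mo, of \<alpha> ?a] that by blast
        then show "f \<alpha> \<otimes> N \<alpha> ?a = (if ?a = \<alpha> then f \<alpha> else \<zero>)"
          using mpoly_coeff[OF fc, of \<alpha>] Nc(2)[OF a a] by (cases "\<alpha> = ?a") simp_all
      qed (use mpoly_coeff[OF fc] in auto)
      also have "\<dots> = f ?a"
        using mpoly_coeff[OF fc] mpoly_finite[OF fc] lp(1) f by (intro finsum_singleton) simp_all
      finally have "pairing R f (\<lambda>\<alpha>. N \<alpha> ?a) = f ?a" .
      moreover have "pairing R f (\<lambda>\<alpha>. N \<alpha> ?a) = \<zero>" using f a unfolding nf_ideal_def by blast
      moreover have "f ?a \<noteq> \<zero>" using lp(1) f by blast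
      ultimately show False by metis
    qed
    moreover have "?a \<in> expo n" using lp(3) f by blast
    ultimately show ?thesis by blast
  qed
  have ex: "\<exists>f. f \<in> ?I - {\<zero>\<^bsub>mpoly n R\<^esub>} \<and> lead_exp r R f = \<alpha> \<and> f \<alpha> = a"
    if \<alpha>: "\<alpha> \<in> expo n - \<Delta>" and a: "a \<in> carrier R" "a \<noteq> \<zero>" for \<alpha> a
  proof -
    \<comment> \<open>\<open>?s\<close> is a constant polynomial. It scales all coefficients, and
      the coefficient 1 at \<alpha> becomes \<open>a\<close> itself, so zero divisors do no
      harm.\<close>
    let ?g = "reduced_poly R N \<alpha>" and ?s = "\<lambda>\<gamma>. if \<gamma> = (\<lambda>_. 0) then a else \<zero>"
    let ?f = "?s \<otimes>\<^bsub>mpoly n R\<^esub> ?g"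
    have g: "?g \<in> ?I" using reduced_poly_in_nf_ideal[OF N] \<alpha> by blast
    then have gc: "?g \<in> carrier (mpoly n R)" using I.a_subset by blast
    have s: "?s \<in> carrier (mpoly n R)" using a by (intro mpoly_single_closed) auto
    have f: "?f \<in> ?I" using g s by (rule I.I_l_closed)
    have coeff: "?f \<gamma> = a \<otimes> ?g \<gamma>" for \<gamma>
      unfolding mpoly_mult_coeff[OF s gc] using a gc mpoly_coeff[OF gc]
      by (subst pairing_single) (auto simp: pairing_coeff)
    have "N \<alpha> \<alpha> = \<zero>" using Nc(3)[of \<alpha> \<alpha>] \<alpha> by blast
    then have fa: "?f \<alpha> = a" unfolding coeff using a by (simp add: reduced_poly_def a_minus_def)
    moreover have "lead_exp r R ?f = \<alpha>"
    proof (rule lead_exp_eqI)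
      show "?f \<alpha> \<noteq> \<zero>" using fa a by simp
      fix \<beta> assume "?f \<beta> \<noteq> \<zero>"
      then have "?g \<beta> \<noteq> \<zero>" unfolding coeff using a by auto
      then have "\<beta> = \<alpha> \<or> N \<alpha> \<beta> \<noteq> \<zero>" by (auto simp: reduced_poly_def a_minus_def)
      then show "(\<beta>, \<alpha>) \<in> r" using Nc(4)[of \<alpha> \<beta>] mo_refl[OF mo, of \<alpha>] \<alpha> by blast
    qed
    moreover have "?f \<noteq> \<zero>\<^bsub>mpoly n R\<^esub>"
    proof
      assume "?f = \<zero>\<^bsub>mpoly n R\<^esub>"
      then show False using fa a by (simp add: mpoly_zero)
    qed
    ultimately show ?thesis using f by (intro exI[of _ ?f]) simp
  qed
  have "attached_standard_set n r R ?I = \<Delta>"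
  proof -
    have "lead_exp r R ` (?I - {\<zero>\<^bsub>mpoly n R\<^esub>}) = expo n - \<Delta>"
    proof (intro equalityI subsetI)
      fix \<alpha> assume "\<alpha> \<in> expo n - \<Delta>"
      from ex[OF this one_closed nontriv] show "\<alpha> \<in> lead_exp r R ` (?I - {\<zero>\<^bsub>mpoly n R\<^esub>})"
        by (metis imageI)
    qed (use lead_notin in fast)
    then show ?thesis using \<Delta>_expo unfolding attached_standard_set_def by auto
  qed
  moreover have "lead_coeffs n r R ?I \<alpha> = {\<zero>} \<or> lead_coeffs n r R ?I \<alpha> = carrier R" if "\<alpha> \<in> expo n" for \<alpha>
  proof (cases "\<alpha> \<in> \<Delta>")
    case True
    then have "{f \<alpha> |f. f \<in> ?I - {\<zero>\<^bsub>mpoly n R\<^esub>} \<and> lead_exp r R f = \<alpha>} = {}"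
      using lead_notin by fast
    then have "lead_coeffs n r R ?I \<alpha> = {\<zero>}" unfolding lead_coeffs_def by (metis sup_bot_right)
    then show ?thesis ..
  next
    case False
    have "carrier R \<subseteq> lead_coeffs n r R ?I \<alpha>"
    proof
      fix a assume a: "a \<in> carrier R"
      show "a \<in> lead_coeffs n r R ?I \<alpha>"
      proof (cases "a = \<zero>")
        case nz: False
        have "\<alpha> \<in> expo n - \<Delta>" using that False by simp
        from ex[OF this a nz] obtain f where "f \<in> ?I - {\<zero>\<^bsub>mpoly n R\<^esub>}" "lead_exp r R f = \<alpha>" "a = f \<alpha>"
          by metis
        then have "a \<in> {f \<alpha> |f. f \<in> ?I - {\<zero>\<^bsub>mpoly n R\<^esub>} \<and> lead_exp r R f = \<alpha>}" by (intro CollectI exI conjI)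
        then show ?thesis unfolding lead_coeffs_def by (rule UnI2)
      qed (simp add: lead_coeffs_def)
    qed
    moreover have "lead_coeffs n r R ?I \<alpha> \<subseteq> carrier R"
    proof
      fix a assume "a \<in> lead_coeffs n r R ?I \<alpha>"
      then consider "a = \<zero>" | f where "a = f \<alpha>" "f \<in> ?I" unfolding lead_coeffs_def by fast
      then show "a \<in> carrier R"
      proof cases
        case 2
        then have "f \<in> carrier (mpoly n R)" using I.a_subset by blast
        then show ?thesis unfolding 2(1) by (rule mpoly_coeff)
      qed simp
    qed
    ultimately show ?thesis by blast
  qed
  ultimately show ?thesis
    using False nf_ideal_is_ideal[OF assms] by (simp add: Hilb_functor_def monic_ideal_def)
qed

text \<open>Apart from its leading term, a reduced polynomial is supported in \<Delta>. Subtracting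
  a multiple therefore removes one term outside \<Delta> and creates none there, so the number of
  these terms is the induction measure. Since only \<open>nf_coeffs\<close> is assumed, the division
  is available while the multiplication equation is still to be derived.\<close>

lemma division_by_reduced_polys:
  assumes N: "nf_coeffs r \<Delta> R N" and J: "ideal J (mpoly n R)"
    and red: "\<And>\<alpha>. \<alpha> \<in> expo n - \<Delta> \<Longrightarrow> reduced_poly R N \<alpha> \<in> J"
    and f: "f \<in> carrier (mpoly n R)"
  shows "\<exists>p\<in>carrier (mpoly n R). f \<ominus>\<^bsub>mpoly n R\<^esub> p \<in> J \<and>
    (\<forall>\<beta>. p \<beta> = (if \<beta> \<in> \<Delta> then pairing R f (\<lambda>\<alpha>. N \<alpha> \<beta>) else \<zero>))"
  using f
proof (induction "card ({\<alpha>. f \<alpha> \<noteq> \<zero>} - \<Delta>)" arbitrary: f rule: less_induct)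
  case (less f)
  interpret P: cring "mpoly n R" by (rule mpoly_cring)
  interpret J: ideal J "mpoly n R" by (rule J)
  note f = less.prems and Nc = nf_coeffsD[OF N]
  note fc = mpoly_coeff[OF f]
  show ?case
  proof (cases "{\<alpha>. f \<alpha> \<noteq> \<zero>} \<subseteq> \<Delta>")
    case True
    have "f \<beta> = (if \<beta> \<in> \<Delta> then pairing R f (\<lambda>\<alpha>. N \<alpha> \<beta>) else \<zero>)" for \<beta>
    proof (cases "\<beta> \<in> \<Delta>")
      case \<beta>: True
      have "pairing R f (\<lambda>\<alpha>. N \<alpha> \<beta>) = (\<Oplus>\<alpha>\<in>\<Delta>. f \<alpha> \<otimes> N \<alpha> \<beta>)"
        using True finite_\<Delta> fc Nc(1) by (intro pairing_superset) auto
      then show ?thesis using finsum_nf_delta[OF N \<beta>, of f] fc \<beta> by simp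
    qed (use True in auto)
    moreover have "f \<ominus>\<^bsub>mpoly n R\<^esub> f \<in> J" using f by (simp add: a_minus_def P.r_neg)
    ultimately show ?thesis using f by blast
  next
    case False
    then obtain \<alpha> where \<alpha>: "f \<alpha> \<noteq> \<zero>" "\<alpha> \<notin> \<Delta>" by blast
    then have ae: "\<alpha> \<in> expo n" using mpoly_expo[OF f] by blast
    let ?g = "reduced_poly R N \<alpha>" and ?s = "\<lambda>\<gamma>. if \<gamma> = (\<lambda>_. 0) then f \<alpha> else \<zero>"
    define h where "h = ?s \<otimes>\<^bsub>mpoly n R\<^esub> ?g"
    have gc: "?g \<in> carrier (mpoly n R)" using reduced_poly_closed[OF N ae] .
    have s: "?s \<in> carrier (mpoly n R)" using fc by (intro mpoly_single_closed) auto
    have hJ: "h \<in> J" unfolding h_def using red \<alpha> ae s by (intro J.I_l_closed) auto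
    have hc: "h \<in> carrier (mpoly n R)" unfolding h_def using s gc by (rule P.m_closed)
    have hp: "pairing R h m = f \<alpha> \<otimes> pairing R ?g m" if "\<And>\<alpha>. m \<alpha> \<in> carrier R" for m
      unfolding h_def using that fc gc by (subst pairing_mult[OF s gc]) (auto simp: pairing_single)
    have coeff: "h \<gamma> = f \<alpha> \<otimes> ?g \<gamma>" for \<gamma>
      unfolding h_def mpoly_mult_coeff[OF s gc] using fc gc mpoly_coeff[OF gc]
      by (subst pairing_single) (auto simp: pairing_coeff)
    define f' where "f' = f \<ominus>\<^bsub>mpoly n R\<^esub> h"
    have f': "f' \<in> carrier (mpoly n R)" unfolding f'_def using f hc by (rule P.minus_closed)
    have f'_coeff: "f' \<gamma> = f \<gamma> \<ominus> f \<alpha> \<otimes> ?g \<gamma>" for \<gamma>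
      by (simp add: f'_def mpoly_minus[OF f hc] coeff)
    have "N \<alpha> \<gamma> = \<zero>" if "\<gamma> \<notin> \<Delta>" for \<gamma> using Nc(3) that by blast
    then have f'_off: "f' \<gamma> = (if \<gamma> = \<alpha> then \<zero> else f \<gamma>)" if "\<gamma> \<notin> \<Delta>" for \<gamma>
      unfolding f'_coeff reduced_poly_def a_minus_def
      using that fc[of \<gamma>] fc[of \<alpha>] by (cases "\<gamma> = \<alpha>") (simp_all add: r_neg)
    have "{\<gamma>. f' \<gamma> \<noteq> \<zero>} - \<Delta> \<subset> {\<alpha>. f \<alpha> \<noteq> \<zero>} - \<Delta>"
    proof (intro psubsetI subsetI)
      fix \<gamma> assume "\<gamma> \<in> {\<gamma>. f' \<gamma> \<noteq> \<zero>} - \<Delta>"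
      then show "\<gamma> \<in> {\<alpha>. f \<alpha> \<noteq> \<zero>} - \<Delta>" using f'_off[of \<gamma>] by (cases "\<gamma> = \<alpha>") simp_all
    next
      have "\<alpha> \<notin> {\<gamma>. f' \<gamma> \<noteq> \<zero>} - \<Delta>" using f'_off[OF \<alpha>(2)] by simp
      moreover have "\<alpha> \<in> {\<alpha>. f \<alpha> \<noteq> \<zero>} - \<Delta>" using \<alpha> by simp
      ultimately show "{\<gamma>. f' \<gamma> \<noteq> \<zero>} - \<Delta> \<noteq> {\<alpha>. f \<alpha> \<noteq> \<zero>} - \<Delta>" by metis
    qed
    then have "card ({\<gamma>. f' \<gamma> \<noteq> \<zero>} - \<Delta>) < card ({\<alpha>. f \<alpha> \<noteq> \<zero>} - \<Delta>)"
      using mpoly_finite[OF f] by (intro psubset_card_mono) auto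
    from less.hyps[OF this f'] obtain p where p: "p \<in> carrier (mpoly n R)" "f' \<ominus>\<^bsub>mpoly n R\<^esub> p \<in> J"
        "\<And>\<beta>. p \<beta> = (if \<beta> \<in> \<Delta> then pairing R f' (\<lambda>\<alpha>. N \<alpha> \<beta>) else \<zero>)" by blast
    \<comment> \<open>The subtracted multiple lies in the kernel of the functionals, so the formula
      for the remainder may be read with \<open>f\<close> in place of \<open>f'\<close>.\<close>
    have same: "pairing R f' (\<lambda>\<alpha>. N \<alpha> \<beta>) = pairing R f (\<lambda>\<alpha>. N \<alpha> \<beta>)" if "\<beta> \<in> \<Delta>" for \<beta>
    proof -
      have "pairing R ?g (\<lambda>\<alpha>. N \<alpha> \<beta>) = \<zero>"
        using reduced_poly_in_nf_ideal[OF N ae] that by (simp add: nf_ideal_def)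
      then have "pairing R h (\<lambda>\<alpha>. N \<alpha> \<beta>) = \<zero>" using hp[of "\<lambda>\<alpha>. N \<alpha> \<beta>"] Nc(1) fc by simp
      then show ?thesis
        unfolding f'_def using pairing_minus[OF f hc, of "\<lambda>\<alpha>. N \<alpha> \<beta>"] pairing_closed[OF f, of "\<lambda>\<alpha>. N \<alpha> \<beta>"] Nc(1)
        by (simp add: a_minus_def)
    qed
    have "f' \<oplus>\<^bsub>mpoly n R\<^esub> h = f" unfolding f'_def a_minus_def using f hc by (simp add: P.a_assoc P.l_neg)
    then have "f \<ominus>\<^bsub>mpoly n R\<^esub> p = (f' \<oplus>\<^bsub>mpoly n R\<^esub> h) \<ominus>\<^bsub>mpoly n R\<^esub> p" by simp
    also have "\<dots> = (f' \<ominus>\<^bsub>mpoly n R\<^esub> p) \<oplus>\<^bsub>mpoly n R\<^esub> h"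
      unfolding a_minus_def using f' hc p(1) by (simp add: P.a_ac)
    finally have "f \<ominus>\<^bsub>mpoly n R\<^esub> p \<in> J" using J.a_closed[OF p(2) hJ] by simp
    moreover have "\<forall>\<beta>. p \<beta> = (if \<beta> \<in> \<Delta> then pairing R f (\<lambda>\<alpha>. N \<alpha> \<beta>) else \<zero>)"
      using p(3) same by metis
    ultimately show ?thesis using p(1) by (intro bexI[of _ p] conjI)
  qed
qed

text \<open>Elements of the kernel have remainder zero. This yields the harder inclusion each time
  an ideal is identified with some \<open>nf_ideal\<close>: for the universal ideal, the monomial
  ideal and extended ideals.\<close>

lemma nf_ideal_minimal:
  assumes N: "nf_coeffs r \<Delta> R N" and J: "ideal J (mpoly n R)"
    and red: "\<And>\<alpha>. \<alpha> \<in> expo n - \<Delta> \<Longrightarrow> reduced_poly R N \<alpha> \<in> J"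
  shows "nf_ideal n \<Delta> R N \<subseteq> J"
proof
  fix f assume "f \<in> nf_ideal n \<Delta> R N"
  then have f: "f \<in> carrier (mpoly n R)" "\<And>\<beta>. \<beta> \<in> \<Delta> \<Longrightarrow> pairing R f (\<lambda>\<alpha>. N \<alpha> \<beta>) = \<zero>"
    by (auto simp: nf_ideal_def)
  interpret P: cring "mpoly n R" by (rule mpoly_cring)
  obtain p where p: "f \<ominus>\<^bsub>mpoly n R\<^esub> p \<in> J" "\<And>\<beta>. p \<beta> = (if \<beta> \<in> \<Delta> then pairing R f (\<lambda>\<alpha>. N \<alpha> \<beta>) else \<zero>)"
    using division_by_reduced_polys[OF N J red f(1)] by blast
  have "p = \<zero>\<^bsub>mpoly n R\<^esub>" using p(2) f(2) by (auto simp: mpoly_zero)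
  then show "f \<in> J" using p(1) f(1) by (simp add: a_minus_def)
qed

end

section \<open>From monic ideals to normal form coefficients\<close>

context hilb_setting
begin

lemma mpoly_support_minus:
  assumes "f \<in> carrier (mpoly n R)" "g \<in> carrier (mpoly n R)" "(f \<ominus>\<^bsub>mpoly n R\<^esub> g) \<beta> \<noteq> \<zero>"
  shows "f \<beta> \<noteq> \<zero> \<or> g \<beta> \<noteq> \<zero>"
  using assms(3) unfolding mpoly_minus[OF assms(1,2)] by (auto simp: a_minus_def)

lemma mpoly_zero_coeff: "\<zero>\<^bsub>mpoly n R\<^esub> \<beta> = \<zero>"
  by (simp add: mpoly_zero)

text \<open>Descent along the well-order replaces each monomial, modulo \<open>U\<close>, by a
  combination of monomials in \<Delta>; monicity provides the polynomials to subtract. The result is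
  rigid because \<open>U\<close> has no nonzero element supported in \<Delta>.\<close>

lemma Hilb_normal_forms_nonzero:
  assumes U: "U \<in> Hilb_functor n r \<Delta> R" and nonzero: "carrier R \<noteq> {\<zero>}"
  shows "\<exists>N. normal_forms n r \<Delta> R N \<and> U = nf_ideal n \<Delta> R N"
proof -
  let ?P = "mpoly n R"
  interpret P: cring ?P by (rule mpoly_cring)
  have monic: "monic_ideal n r R U" and att: "attached_standard_set n r R U = \<Delta>"
    using U nonzero by (simp_all add: Hilb_functor_def)
  interpret I: ideal U ?P using monic by (simp add: monic_ideal_def)
  have Uc: "f \<in> carrier ?P" if "f \<in> U" for f using that I.a_subset by blast
  have U_minus: "f \<ominus>\<^bsub>?P\<^esub> g \<in> U" if "f \<in> U" "g \<in> U" for f g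
    using that by (simp add: a_minus_def I.a_closed I.a_inv_closed)
  have independent: "f = \<zero>\<^bsub>?P\<^esub>" if f: "f \<in> U" and supp: "\<And>\<beta>. f \<beta> \<noteq> \<zero> \<Longrightarrow> \<beta> \<in> \<Delta>" for f
  proof (rule ccontr)
    assume nz: "f \<noteq> \<zero>\<^bsub>?P\<^esub>"
    have "lead_exp r R f \<in> \<Delta>" using lead_exp_props(1)[OF Uc[OF f] nz] supp by blast
    moreover have "lead_exp r R f \<notin> attached_standard_set n r R U"
      unfolding attached_standard_set_def using f nz by blast
    ultimately show False using att by simp
  qed
  \<comment> \<open>Once \<alpha> is a leading exponent, monicity makes every scalar a leading
    coefficient. The zero polynomial takes care of the scalar zero, so any top coefficient can be
    cancelled by one and the same rule.\<close>
  have leading: "\<exists>g\<in>U. g \<alpha> = a \<and> (\<forall>\<beta>. g \<beta> \<noteq> \<zero> \<longrightarrow> (\<beta>, \<alpha>) \<in> r)"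
    if \<alpha>: "\<alpha> \<in> expo n" "\<alpha> \<notin> \<Delta>" and a: "a \<in> carrier R" for \<alpha> a
  proof (cases "a = \<zero>")
    case True
    then show ?thesis using I.zero_closed by (intro bexI[of _ "\<zero>\<^bsub>?P\<^esub>"]) (simp_all add: mpoly_zero_coeff)
  next
    case False
    have "\<alpha> \<in> lead_exp r R ` (U - {\<zero>\<^bsub>?P\<^esub>})"
      using \<alpha> att unfolding attached_standard_set_def by blast
    then obtain f where f: "f \<in> U" "f \<noteq> \<zero>\<^bsub>?P\<^esub>" "lead_exp r R f = \<alpha>" by blast
    have "f \<alpha> \<in> lead_coeffs n r R U \<alpha>" unfolding lead_coeffs_def using f by blast
    moreover have "f \<alpha> \<noteq> \<zero>" using lead_exp_props(1)[OF Uc[OF f(1)] f(2)] f(3) by simp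
    ultimately have "lead_coeffs n r R U \<alpha> \<noteq> {\<zero>}" by blast
    then have "lead_coeffs n r R U \<alpha> = carrier R" using monic \<alpha>(1) unfolding monic_ideal_def by blast
    then have "a \<in> lead_coeffs n r R U \<alpha>" using a by simp
    then obtain g where g: "g \<in> U" "g \<noteq> \<zero>\<^bsub>?P\<^esub>" "lead_exp r R g = \<alpha>" "a = g \<alpha>"
      using False unfolding lead_coeffs_def by blast
    have "\<forall>\<beta>. g \<beta> \<noteq> \<zero> \<longrightarrow> (\<beta>, \<alpha>) \<in> r"
      using lead_exp_props(2)[OF Uc[OF g(1)] g(2)] g(3) by simp
    then show ?thesis using g by (intro bexI[of _ g]) simp_all
  qed
  \<comment> \<open>The bound by \<alpha> on the support of \<open>p\<close> is carried through the
    induction; it becomes the triangularity condition in \<open>nf_coeffs\<close>.\<close>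
  have reduce: "\<alpha> \<in> expo n \<longrightarrow> (\<forall>f\<in>carrier ?P. (\<forall>\<beta>. f \<beta> \<noteq> \<zero> \<longrightarrow> (\<beta>, \<alpha>) \<in> r) \<longrightarrow>
    (\<exists>p\<in>carrier ?P. (\<forall>\<beta>. p \<beta> \<noteq> \<zero> \<longrightarrow> \<beta> \<in> \<Delta> \<and> (\<beta>, \<alpha>) \<in> r) \<and> f \<ominus>\<^bsub>?P\<^esub> p \<in> U))" for \<alpha>
  proof (induction \<alpha> rule: wf_induct_rule[OF mo_wf[OF mo]])
    case (1 \<alpha>)
    show ?case
    proof (intro impI ballI)
      fix f assume \<alpha>: "\<alpha> \<in> expo n" and f: "f \<in> carrier ?P" and le: "\<forall>\<beta>. f \<beta> \<noteq> \<zero> \<longrightarrow> (\<beta>, \<alpha>) \<in> r"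
      have fa: "f \<alpha> \<in> carrier R" using mpoly_coeff[OF f] .
      \<comment> \<open>\<open>q\<close> takes away the top coefficient. If \<alpha> \<in> \<Delta>,
        the term is kept in the remainder \<open>p\<close>; otherwise \<open>q\<close> is an element
        of \<open>U\<close> and \<open>p\<close> is zero. What is left of \<open>f\<close> is zero
        or has a strictly smaller leading exponent.\<close>
      have "\<exists>q\<in>carrier ?P. \<exists>p\<in>carrier ?P. q \<alpha> = f \<alpha> \<and> (\<forall>\<beta>. q \<beta> \<noteq> \<zero> \<longrightarrow> (\<beta>, \<alpha>) \<in> r) \<and>
          (\<forall>\<beta>. p \<beta> \<noteq> \<zero> \<longrightarrow> \<beta> \<in> \<Delta> \<and> (\<beta>, \<alpha>) \<in> r) \<and> q \<ominus>\<^bsub>?P\<^esub> p \<in> U"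
      proof (cases "\<alpha> \<in> \<Delta>")
        case True
        let ?q = "\<lambda>\<gamma>. if \<gamma> = \<alpha> then f \<alpha> else \<zero>"
        have q: "?q \<in> carrier ?P" using \<alpha> fa by (rule mpoly_single_closed)
        then have "?q \<ominus>\<^bsub>?P\<^esub> ?q \<in> U" using I.zero_closed by (simp add: a_minus_def P.r_neg)
        then show ?thesis using q True mo_refl[OF mo \<alpha>]
          by (intro bexI[OF _ q] bexI[OF _ q]) simp
      next
        case False
        obtain g where g: "g \<in> U" "g \<alpha> = f \<alpha>" "\<forall>\<beta>. g \<beta> \<noteq> \<zero> \<longrightarrow> (\<beta>, \<alpha>) \<in> r"
          using leading[OF \<alpha> False fa] by blast
        have "g \<ominus>\<^bsub>?P\<^esub> \<zero>\<^bsub>?P\<^esub> \<in> U" using U_minus[OF g(1) I.zero_closed] .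
        then show ?thesis using g Uc[OF g(1)]
          by (intro bexI[of _ g] bexI[of _ "\<zero>\<^bsub>?P\<^esub>"]) (simp_all add: mpoly_zero_coeff)
      qed
      then obtain q p where q: "q \<in> carrier ?P" "q \<alpha> = f \<alpha>" "\<And>\<beta>. q \<beta> \<noteq> \<zero> \<Longrightarrow> (\<beta>, \<alpha>) \<in> r"
        and p: "p \<in> carrier ?P" "\<And>\<beta>. p \<beta> \<noteq> \<zero> \<Longrightarrow> \<beta> \<in> \<Delta> \<and> (\<beta>, \<alpha>) \<in> r" and qp: "q \<ominus>\<^bsub>?P\<^esub> p \<in> U" by blast
      define f' where "f' = f \<ominus>\<^bsub>?P\<^esub> q"
      have f': "f' \<in> carrier ?P" unfolding f'_def using f q(1) by (rule P.minus_closed)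
      have f'_le: "(\<beta>, \<alpha>) \<in> r" if "f' \<beta> \<noteq> \<zero>" for \<beta>
        using mpoly_support_minus[OF f q(1), folded f'_def, OF that] le q(3) by blast
      have f'a: "f' \<alpha> = \<zero>"
        unfolding f'_def mpoly_minus[OF f q(1)] using q(2) fa by (simp add: a_minus_def r_neg)
      have "\<exists>p'\<in>carrier ?P. (\<forall>\<beta>. p' \<beta> \<noteq> \<zero> \<longrightarrow> \<beta> \<in> \<Delta> \<and> (\<beta>, \<alpha>) \<in> r) \<and> f' \<ominus>\<^bsub>?P\<^esub> p' \<in> U"
      proof (cases "f' = \<zero>\<^bsub>?P\<^esub>")
        case True
        then have "f' \<ominus>\<^bsub>?P\<^esub> \<zero>\<^bsub>?P\<^esub> \<in> U" using U_minus[OF I.zero_closed I.zero_closed] by simp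
        then show ?thesis by (intro bexI[of _ "\<zero>\<^bsub>?P\<^esub>"]) (simp_all add: mpoly_zero_coeff)
      next
        case False
        note lp = lead_exp_props[OF f' False]
        have "(lead_exp r R f', \<alpha>) \<in> r" using f'_le lp(1) by blast
        moreover have "lead_exp r R f' \<noteq> \<alpha>" using f'a lp(1) by metis
        ultimately obtain p' where p': "p' \<in> carrier ?P" "f' \<ominus>\<^bsub>?P\<^esub> p' \<in> U"
            "\<forall>\<beta>. p' \<beta> \<noteq> \<zero> \<longrightarrow> \<beta> \<in> \<Delta> \<and> (\<beta>, lead_exp r R f') \<in> r"
          using "1.IH"[of "lead_exp r R f'"] lp(2,3) f' by auto
        have "\<forall>\<beta>. p' \<beta> \<noteq> \<zero> \<longrightarrow> \<beta> \<in> \<Delta> \<and> (\<beta>, \<alpha>) \<in> r"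
          using p'(3) mo_trans[OF mo _ \<open>(lead_exp r R f', \<alpha>) \<in> r\<close>] by blast
        then show ?thesis using p' by blast
      qed
      then obtain p' where p': "p' \<in> carrier ?P" "\<And>\<beta>. p' \<beta> \<noteq> \<zero> \<Longrightarrow> \<beta> \<in> \<Delta> \<and> (\<beta>, \<alpha>) \<in> r" "f' \<ominus>\<^bsub>?P\<^esub> p' \<in> U"
        by blast
      have "f' \<oplus>\<^bsub>?P\<^esub> q = f" unfolding f'_def a_minus_def using f q(1) by (simp add: P.a_assoc P.l_neg)
      then have "f \<ominus>\<^bsub>?P\<^esub> (p' \<oplus>\<^bsub>?P\<^esub> p) = (f' \<oplus>\<^bsub>?P\<^esub> q) \<ominus>\<^bsub>?P\<^esub> (p' \<oplus>\<^bsub>?P\<^esub> p)" by simp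
      also have "\<dots> = (f' \<ominus>\<^bsub>?P\<^esub> p') \<oplus>\<^bsub>?P\<^esub> (q \<ominus>\<^bsub>?P\<^esub> p)"
        unfolding a_minus_def using f' q(1) p(1) p'(1) by (simp add: P.minus_add P.a_ac)
      finally have "f \<ominus>\<^bsub>?P\<^esub> (p' \<oplus>\<^bsub>?P\<^esub> p) \<in> U" using I.a_closed[OF p'(3) qp] by simp
      moreover have "\<beta> \<in> \<Delta> \<and> (\<beta>, \<alpha>) \<in> r" if "(p' \<oplus>\<^bsub>?P\<^esub> p) \<beta> \<noteq> \<zero>" for \<beta>
      proof -
        have "p' \<beta> \<noteq> \<zero> \<or> p \<beta> \<noteq> \<zero>" using that unfolding mpoly_add by auto
        then show ?thesis using p(2) p'(2) by blast
      qed
      ultimately show "\<exists>p\<in>carrier ?P. (\<forall>\<beta>. p \<beta> \<noteq> \<zero> \<longrightarrow> \<beta> \<in> \<Delta> \<and> (\<beta>, \<alpha>) \<in> r) \<and> f \<ominus>\<^bsub>?P\<^esub> p \<in> U"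
        using P.a_closed[OF p'(1) p(1)] by blast
    qed
  qed
  have "\<exists>p. p \<in> carrier ?P \<and> (\<forall>\<beta>. p \<beta> \<noteq> \<zero> \<longrightarrow> \<beta> \<in> \<Delta> \<and> (\<beta>, \<alpha>) \<in> r) \<and> mono_poly R \<alpha> \<ominus>\<^bsub>?P\<^esub> p \<in> U"
    if \<alpha>: "\<alpha> \<in> expo n" for \<alpha>
  proof -
    have "\<forall>\<beta>. mono_poly R \<alpha> \<beta> \<noteq> \<zero> \<longrightarrow> (\<beta>, \<alpha>) \<in> r" using mo_refl[OF mo \<alpha>] by (simp add: mono_poly_def)
    then show ?thesis using reduce[of \<alpha>] mono_poly_closed[OF \<alpha>] \<alpha> by blast
  qed
  then obtain N0 where N0: "\<And>\<alpha>. \<alpha> \<in> expo n \<Longrightarrow> N0 \<alpha> \<in> carrier ?P"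
      "\<And>\<alpha> \<beta>. \<alpha> \<in> expo n \<Longrightarrow> N0 \<alpha> \<beta> \<noteq> \<zero> \<Longrightarrow> \<beta> \<in> \<Delta> \<and> (\<beta>, \<alpha>) \<in> r"
      "\<And>\<alpha>. \<alpha> \<in> expo n \<Longrightarrow> mono_poly R \<alpha> \<ominus>\<^bsub>?P\<^esub> N0 \<alpha> \<in> U"
    by metis
  \<comment> \<open>The value zero outside \<open>expo n\<close> is forced by the normalization in
    \<open>nf_coeffs\<close>.\<close>
  define N where "N \<alpha> = (if \<alpha> \<in> expo n then N0 \<alpha> else \<zero>\<^bsub>?P\<^esub>)" for \<alpha>
  have N_delta: "N \<alpha> \<beta> = (if \<alpha> = \<beta> then \<one> else \<zero>)" if "\<alpha> \<in> \<Delta>" for \<alpha> \<beta>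
  proof -
    have \<alpha>: "\<alpha> \<in> expo n" using that \<Delta>_expo by blast
    note c = mono_poly_closed[OF \<alpha>] N0(1)[OF \<alpha>]
    have "\<beta> \<in> \<Delta>" if "(mono_poly R \<alpha> \<ominus>\<^bsub>?P\<^esub> N0 \<alpha>) \<beta> \<noteq> \<zero>" for \<beta>
      using mpoly_support_minus[OF c that] N0(2)[OF \<alpha>] \<open>\<alpha> \<in> \<Delta>\<close> by (auto simp: mono_poly_def split: if_splits)
    then have "mono_poly R \<alpha> \<ominus>\<^bsub>?P\<^esub> N0 \<alpha> = \<zero>\<^bsub>?P\<^esub>" using independent[OF N0(3)[OF \<alpha>]] by blast
    then have "mono_poly R \<alpha> = N0 \<alpha>" using P.r_right_minus_eq[OF c] by blast
    then have "N \<alpha> \<beta> = mono_poly R \<alpha> \<beta>" using \<alpha> unfolding N_def by presburger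
    then show ?thesis by (simp add: mono_poly_def eq_commute)
  qed
  have N: "nf_coeffs r \<Delta> R N"
    unfolding nf_coeffs_def
  proof (intro conjI allI ballI impI)
    fix \<alpha> \<beta>
    show "N \<alpha> \<beta> \<in> carrier R"
      using mpoly_coeff[OF N0(1), of \<alpha>] by (cases "\<alpha> \<in> expo n") (simp_all add: N_def mpoly_zero_coeff)
    have "\<beta> \<in> \<Delta> \<and> (\<beta>, \<alpha>) \<in> r" if nz: "N \<alpha> \<beta> \<noteq> \<zero>"
    proof (cases "\<alpha> \<in> expo n")
      case True
      then have "N0 \<alpha> \<beta> \<noteq> \<zero>" using nz unfolding N_def by presburger
      then show ?thesis by (rule N0(2)[OF True])
    next
      case False
      then show ?thesis using nz unfolding N_def by (simp add: mpoly_zero_coeff)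
    qed
    then show "\<beta> \<in> \<Delta>" "(\<beta>, \<alpha>) \<in> r" if "N \<alpha> \<beta> \<noteq> \<zero>" using that by blast+
  qed (rule N_delta)
  note Nc = nf_coeffsD[OF N]
  have red: "reduced_poly R N \<alpha> \<in> U" if "\<alpha> \<in> expo n" for \<alpha>
    unfolding reduced_poly_eq[OF N that] using N0(3)[OF that] that by (simp add: N_def)
  have sub: "U \<subseteq> nf_ideal n \<Delta> R N"
  proof
    fix f assume f: "f \<in> U"
    obtain p where p: "p \<in> carrier ?P" "f \<ominus>\<^bsub>?P\<^esub> p \<in> U"
        "\<And>\<beta>. p \<beta> = (if \<beta> \<in> \<Delta> then pairing R f (\<lambda>\<alpha>. N \<alpha> \<beta>) else \<zero>)"
      using division_by_reduced_polys[OF N I.is_ideal red Uc[OF f]] by blast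
    \<comment> \<open>The remainder is a difference of two elements of \<open>U\<close> and is
      supported in \<Delta>, so it vanishes; its coefficients are the values of the functionals at
      \<open>f\<close>.\<close>
    have "f \<ominus>\<^bsub>?P\<^esub> (f \<ominus>\<^bsub>?P\<^esub> p) = p"
      unfolding a_minus_def using Uc[OF f] p(1) by (simp add: P.minus_add P.a_assoc[symmetric] P.r_neg)
    then have "p \<in> U" using U_minus[OF f p(2)] by simp
    moreover have "\<beta> \<in> \<Delta>" if "p \<beta> \<noteq> \<zero>" for \<beta> using p(3)[of \<beta>] that by metis
    ultimately have "p = \<zero>\<^bsub>?P\<^esub>" by (rule independent)
    then have "pairing R f (\<lambda>\<alpha>. N \<alpha> \<beta>) = \<zero>" if "\<beta> \<in> \<Delta>" for \<beta>
      using p(3)[of \<beta>] that by (simp add: mpoly_zero_coeff)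
    then show "f \<in> nf_ideal n \<Delta> R N" using Uc[OF f] by (simp add: nf_ideal_def)
  qed
  have "N (expo_add \<alpha> \<gamma>) \<beta> = (\<Oplus>\<delta>\<in>\<Delta>. N \<alpha> \<delta> \<otimes> N (expo_add \<delta> \<gamma>) \<beta>)"
    if \<alpha>: "\<alpha> \<in> expo n" and \<gamma>: "\<gamma> \<in> expo n" and \<beta>: "\<beta> \<in> \<Delta>" for \<alpha> \<beta> \<gamma>
  proof -
    note rc = reduced_poly_closed[OF N \<alpha>] and mc = mono_poly_closed[OF \<gamma>]
    \<comment> \<open>A monomial times a reduced polynomial stays in \<open>U\<close>, hence in the
      kernel. Evaluating the functional of \<beta> on this product is the multiplication
      equation.\<close>
    have "reduced_poly R N \<alpha> \<otimes>\<^bsub>?P\<^esub> mono_poly R \<gamma> \<in> nf_ideal n \<Delta> R N"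
      using sub I.I_r_closed[OF red[OF \<alpha>] mc] by blast
    then have "pairing R (reduced_poly R N \<alpha> \<otimes>\<^bsub>?P\<^esub> mono_poly R \<gamma>) (\<lambda>\<alpha>. N \<alpha> \<beta>) = \<zero>"
      using \<beta> by (simp add: nf_ideal_def)
    then have "N (expo_add \<alpha> \<gamma>) \<beta> \<ominus> (\<Oplus>\<delta>\<in>\<Delta>. N \<alpha> \<delta> \<otimes> N (expo_add \<delta> \<gamma>) \<beta>) = \<zero>"
      using Nc(1) by (simp add: pairing_mult[OF rc mc] pairing_reduced_poly[OF N \<alpha>])
    moreover have "(\<Oplus>\<delta>\<in>\<Delta>. N \<alpha> \<delta> \<otimes> N (expo_add \<delta> \<gamma>) \<beta>) \<in> carrier R"
      using Nc(1) by (intro finsum_closed) auto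
    ultimately show ?thesis using r_right_minus_eq[of "N (expo_add \<alpha> \<gamma>) \<beta>"] Nc(1) by metis
  qed
  then have "normal_forms n r \<Delta> R N" using N by (simp add: normal_forms_def)
  moreover have "U = nf_ideal n \<Delta> R N"
    using sub nf_ideal_minimal[OF N I.is_ideal] red by blast
  ultimately show ?thesis by blast
qed

lemma Hilb_normal_forms:
  assumes U: "U \<in> Hilb_functor n r \<Delta> R"
  obtains N where "normal_forms n r \<Delta> R N" "U = nf_ideal n \<Delta> R N"
proof (cases "carrier R = {\<zero>}")
  case True
  have one: "\<one> = \<zero>" using True one_closed by blast
  \<comment> \<open>With 1 = 0 the zero function meets every condition, including the value one on
    the diagonal of \<Delta>.\<close>
  have "normal_forms n r \<Delta> R (\<lambda>_ _. \<zero>)"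
    unfolding normal_forms_def nf_coeffs_def by (simp add: one)
  moreover have "U = carrier (mpoly n R)" using U True by (simp add: Hilb_functor_def)
  moreover have "nf_ideal n \<Delta> R (\<lambda>_ _. \<zero>) = carrier (mpoly n R)"
    using nf_ideal_in_Hilb[OF calculation(1)] True by (simp add: Hilb_functor_def)
  ultimately show ?thesis using that by metis
next
  case False
  then show ?thesis using Hilb_normal_forms_nonzero[OF U False] that by blast
qed

section \<open>The normal forms of the monomial ideal\<close>

definition monomial_nf :: "(nat \<Rightarrow> nat) \<Rightarrow> (nat \<Rightarrow> nat) \<Rightarrow> 'a" where
  "monomial_nf \<alpha> \<beta> = (if \<alpha> = \<beta> \<and> \<beta> \<in> \<Delta> then \<one> else \<zero>)"

lemma normal_forms_monomial: "normal_forms n r \<Delta> R monomial_nf"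
  unfolding normal_forms_def
proof (intro conjI ballI)
  show "nf_coeffs r \<Delta> R monomial_nf"
    unfolding nf_coeffs_def monomial_nf_def using \<Delta>_expo mo_refl[OF mo] by auto
  fix \<alpha> \<gamma> \<beta> assume *: "\<alpha> \<in> expo n" "\<gamma> \<in> expo n" "\<beta> \<in> \<Delta>"
  have "(\<Oplus>\<delta>\<in>\<Delta>. monomial_nf \<alpha> \<delta> \<otimes> monomial_nf (expo_add \<delta> \<gamma>) \<beta>)
      = (\<Oplus>\<delta>\<in>\<Delta>. if \<alpha> = \<delta> then monomial_nf (expo_add \<delta> \<gamma>) \<beta> else \<zero>)"
    by (intro finsum_cong') (auto simp: monomial_nf_def)
  also have "\<dots> = monomial_nf (expo_add \<alpha> \<gamma>) \<beta>"
  proof (cases "\<alpha> \<in> \<Delta>")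
    case True
    then show ?thesis using finite_\<Delta> by (intro finsum_singleton) (auto simp: monomial_nf_def)
  next
    case False
    \<comment> \<open>Here the standard set property enters: a monomial outside \<Delta> stays
      outside after multiplication, so both sides are zero.\<close>
    then have "expo_add \<alpha> \<gamma> \<notin> \<Delta>" using standard * unfolding standard_set_def by blast
    then have "monomial_nf (expo_add \<alpha> \<gamma>) \<beta> = \<zero>" using * by (auto simp: monomial_nf_def)
    moreover have "(\<Oplus>\<delta>\<in>\<Delta>. if \<alpha> = \<delta> then monomial_nf (expo_add \<delta> \<gamma>) \<beta> else \<zero>) = \<zero>"
      using False by (intro add.finprod_one_eqI) auto
    ultimately show ?thesis by simp
  qed
  finally show "monomial_nf (expo_add \<alpha> \<gamma>) \<beta> = (\<Oplus>\<delta>\<in>\<Delta>. monomial_nf \<alpha> \<delta> \<otimes> monomial_nf (expo_add \<delta> \<gamma>) \<beta>)" ..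
qed

text \<open>Outside \<Delta> the reduced polynomials of \<open>monomial_nf\<close> are the monomials
  themselves, so both inclusions follow from minimality, once of \<open>genideal\<close> and once of
  \<open>nf_ideal\<close>.\<close>

lemma monomial_ideal_eq: "monomial_ideal n \<Delta> R = nf_ideal n \<Delta> R monomial_nf"
proof -
  interpret P: cring "mpoly n R" by (rule mpoly_cring)
  have N: "nf_coeffs r \<Delta> R monomial_nf" using normal_forms_monomial by (simp add: normal_forms_def)
  have red: "reduced_poly R monomial_nf \<alpha> = mono_poly R \<alpha>" if "\<alpha> \<notin> \<Delta>" for \<alpha>
    using that by (auto simp: reduced_poly_def monomial_nf_def mono_poly_def a_minus_def)
  have sub: "mono_poly R ` (expo n - \<Delta>) \<subseteq> carrier (mpoly n R)" by auto
  have "mono_poly R \<alpha> \<in> nf_ideal n \<Delta> R monomial_nf" if "\<alpha> \<in> expo n - \<Delta>" for \<alpha>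
    using reduced_poly_in_nf_ideal[OF N, of \<alpha>] red[of \<alpha>] that by simp
  then have "monomial_ideal n \<Delta> R \<subseteq> nf_ideal n \<Delta> R monomial_nf"
    unfolding monomial_ideal_def using nf_ideal_is_ideal[OF normal_forms_monomial]
    by (intro P.genideal_minimal) auto
  moreover have "nf_ideal n \<Delta> R monomial_nf \<subseteq> monomial_ideal n \<Delta> R"
    unfolding monomial_ideal_def
    by (intro nf_ideal_minimal[OF N P.genideal_ideal[OF sub]])
      (use P.genideal_self[OF sub] red in auto)
  ultimately show ?thesis ..
qed

end

section \<open>Base change of normal forms and ideals\<close>

lemma (in ring_hom_cring) hom_pairing:
  assumes f: "f \<in> carrier (mpoly n R)" and m: "\<And>\<alpha>. m \<alpha> \<in> carrier R"
  shows "pairing S (\<lambda>\<alpha>. h (f \<alpha>)) (\<lambda>\<alpha>. h (m \<alpha>)) = h (pairing R f m)"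
proof -
  note [simp] = mpoly_coeff[OF f] m mpoly_finite[OF f]
  have "pairing S (\<lambda>\<alpha>. h (f \<alpha>)) (\<lambda>\<alpha>. h (m \<alpha>)) = (\<Oplus>\<^bsub>S\<^esub>\<alpha>\<in>{\<alpha>. f \<alpha> \<noteq> \<zero>}. h (f \<alpha>) \<otimes>\<^bsub>S\<^esub> h (m \<alpha>))"
    by (intro S.pairing_superset) auto
  also have "\<dots> = h (pairing R f m)"
    unfolding pairing_def by (subst hom_finsum) (auto intro!: S.finsum_cong')
  finally show ?thesis .
qed

lemma (in ring_hom_cring) hom_mpoly_closed:
  assumes f: "f \<in> carrier (mpoly n R)"
  shows "(\<lambda>\<alpha>. h (f \<alpha>)) \<in> carrier (mpoly n S)"
proof -
  have sub: "{\<alpha>. h (f \<alpha>) \<noteq> \<zero>\<^bsub>S\<^esub>} \<subseteq> {\<alpha>. f \<alpha> \<noteq> \<zero>}" by auto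
  then have "finite {\<alpha>. h (f \<alpha>) \<noteq> \<zero>\<^bsub>S\<^esub>}" using mpoly_finite[OF f] finite_subset by blast
  moreover have "{\<alpha>. h (f \<alpha>) \<noteq> \<zero>\<^bsub>S\<^esub>} \<subseteq> expo n" using sub mpoly_expo[OF f] by blast
  ultimately show ?thesis using mpoly_coeff[OF f] by (simp add: mpoly_carrier)
qed

locale hilb_base_change = hilb_setting R n r \<Delta> + ring_hom_cring R S h
  for R (structure) and S (structure) and h and n r \<Delta>
begin

sublocale target: hilb_setting S n r \<Delta>
  by unfold_locales (rule mo, rule standard, rule finite_\<Delta>)

lemma normal_forms_hom:
  assumes "normal_forms n r \<Delta> R N"
  shows "normal_forms n r \<Delta> S (\<lambda>\<alpha> \<beta>. h (N \<alpha> \<beta>))"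
proof -
  have N: "nf_coeffs r \<Delta> R N" using assms by (rule normal_forms_coeffs)
  note Nc = nf_coeffsD[OF N]
  have "nf_coeffs r \<Delta> S (\<lambda>\<alpha> \<beta>. h (N \<alpha> \<beta>))"
    unfolding nf_coeffs_def
  proof (intro conjI allI ballI impI)
    fix \<alpha> \<beta>
    show "h (N \<alpha> \<beta>) \<in> carrier S" using Nc(1) by simp
    show "\<beta> \<in> \<Delta>" "(\<beta>, \<alpha>) \<in> r" if "h (N \<alpha> \<beta>) \<noteq> \<zero>\<^bsub>S\<^esub>"
    proof -
      have "N \<alpha> \<beta> \<noteq> \<zero>" using that hom_zero by metis
      then show "\<beta> \<in> \<Delta>" "(\<beta>, \<alpha>) \<in> r" by (rule Nc(3), rule Nc(4))
    qed
  qed (simp add: Nc(2))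
  moreover have "h (N (expo_add \<alpha> \<gamma>) \<beta>) = (\<Oplus>\<^bsub>S\<^esub>\<delta>\<in>\<Delta>. h (N \<alpha> \<delta>) \<otimes>\<^bsub>S\<^esub> h (N (expo_add \<delta> \<gamma>) \<beta>))"
    if "\<alpha> \<in> expo n" "\<gamma> \<in> expo n" "\<beta> \<in> \<Delta>" for \<alpha> \<gamma> \<beta>
  proof -
    have "N (expo_add \<alpha> \<gamma>) \<beta> = (\<Oplus>\<delta>\<in>\<Delta>. N \<alpha> \<delta> \<otimes> N (expo_add \<delta> \<gamma>) \<beta>)"
      using assms that by (simp add: normal_forms_def)
    also have "h \<dots> = (\<Oplus>\<^bsub>S\<^esub>\<delta>\<in>\<Delta>. h (N \<alpha> \<delta>) \<otimes>\<^bsub>S\<^esub> h (N (expo_add \<delta> \<gamma>) \<beta>))"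
      using Nc(1) by (subst hom_finsum) (auto intro!: S.finsum_cong')
    finally show ?thesis .
  qed
  ultimately show ?thesis by (simp add: normal_forms_def)
qed

text \<open>A homomorphism maps reduced polynomials to reduced polynomials of the image
  coefficients. By \<open>nf_ideal_minimal\<close> these already generate the whole kernel over
  \<open>S\<close>, so extension of ideals amounts to applying \<open>h\<close> entrywise.\<close>

lemma extend_nf_ideal:
  assumes "normal_forms n r \<Delta> R N"
  shows "extend_ideal n S h (nf_ideal n \<Delta> R N) = nf_ideal n \<Delta> S (\<lambda>\<alpha> \<beta>. h (N \<alpha> \<beta>))"
proof -
  interpret P: cring "mpoly n S" by (rule S.mpoly_cring)
  let ?N = "\<lambda>\<alpha> \<beta>. h (N \<alpha> \<beta>)"
  let ?X = "(\<lambda>f \<alpha>. h (f \<alpha>)) ` nf_ideal n \<Delta> R N"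
  have N: "nf_coeffs r \<Delta> R N" using assms by (rule normal_forms_coeffs)
  note Nc = nf_coeffsD[OF N]
  have N': "nf_coeffs r \<Delta> S ?N" using normal_forms_hom[OF assms] by (rule target.normal_forms_coeffs)
  have sub: "?X \<subseteq> nf_ideal n \<Delta> S ?N"
  proof
    fix g assume "g \<in> ?X"
    then obtain f where f: "f \<in> nf_ideal n \<Delta> R N" "g = (\<lambda>\<alpha>. h (f \<alpha>))" by blast
    then have fc: "f \<in> carrier (mpoly n R)" by (simp add: nf_ideal_def)
    have "pairing S g (\<lambda>\<alpha>. ?N \<alpha> \<beta>) = \<zero>\<^bsub>S\<^esub>" if "\<beta> \<in> \<Delta>" for \<beta>
      using f that Nc(1) by (simp add: hom_pairing[OF fc] nf_ideal_def)
    then show "g \<in> nf_ideal n \<Delta> S ?N" using hom_mpoly_closed[OF fc] f(2) by (simp add: nf_ideal_def)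
  qed
  have Xc: "?X \<subseteq> carrier (mpoly n S)" using sub by (auto simp: nf_ideal_def)
  have "genideal (mpoly n S) ?X \<subseteq> nf_ideal n \<Delta> S ?N"
    using target.nf_ideal_is_ideal[OF normal_forms_hom[OF assms]] sub by (rule P.genideal_minimal)
  moreover have "nf_ideal n \<Delta> S ?N \<subseteq> genideal (mpoly n S) ?X"
  proof (rule target.nf_ideal_minimal[OF N' P.genideal_ideal[OF Xc]])
    fix \<alpha> assume "\<alpha> \<in> expo n - \<Delta>"
    then have "reduced_poly R N \<alpha> \<in> nf_ideal n \<Delta> R N" by (intro reduced_poly_in_nf_ideal[OF N]) simp
    moreover have "reduced_poly S ?N \<alpha> = (\<lambda>\<gamma>. h (reduced_poly R N \<alpha> \<gamma>))"
      using Nc(1) by (auto simp: reduced_poly_def a_minus_def)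
    ultimately show "reduced_poly S ?N \<alpha> \<in> genideal (mpoly n S) ?X"
      using P.genideal_self[OF Xc] by auto
  qed
  ultimately show ?thesis unfolding extend_ideal_def by (rule equalityI)
qed

end


section \<open>The deformation\<close>

lemma (in UP_cring) monom_finsum:
  assumes "finite D" "\<And>\<delta>. \<delta> \<in> D \<Longrightarrow> f \<delta> \<in> carrier R"
  shows "up_ring.monom P (\<Oplus>\<delta>\<in>D. f \<delta>) k = (\<Oplus>\<^bsub>P\<^esub>\<delta>\<in>D. up_ring.monom P (f \<delta>) k)"
  using assms
proof (induction D)
  case (insert x D)
  then have "up_ring.monom P (\<Oplus>\<delta>\<in>insert x D. f \<delta>) k = up_ring.monom P (f x) k \<oplus>\<^bsub>P\<^esub> (\<Oplus>\<^bsub>P\<^esub>\<delta>\<in>D. up_ring.monom P (f \<delta>) k)"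
    by (subst R.finsum_insert) auto
  also have "\<dots> = (\<Oplus>\<^bsub>P\<^esub>\<delta>\<in>insert x D. up_ring.monom P (f \<delta>) k)"
    using insert by (intro P.finsum_insert[symmetric]) auto
  finally show ?case .
qed simp

context hilb_setting
begin

text \<open>
  The substitution $x_i \mapsto t^{-w_i} x_i$ multiplies the coefficients of normal forms by the
  powers $t^{w(\alpha) - w(\beta)}$, whose exponents are nonnegative whenever the coefficient is
  nonzero (so that the truncated subtraction is harmless).
\<close>

lemma normal_forms_deform:
  assumes "normal_forms n r \<Delta> R N"
    and w: "\<And>\<alpha> \<beta>. \<beta> \<in> \<Delta> \<Longrightarrow> (\<beta>, \<alpha>) \<in> r \<Longrightarrow> \<beta> \<noteq> \<alpha> \<Longrightarrow> weight n w \<beta> < weight n w \<alpha>"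
  shows "normal_forms n r \<Delta> (UP R) (\<lambda>\<alpha> \<beta>. up_ring.monom (UP R) (N \<alpha> \<beta>) (weight n w \<alpha> - weight n w \<beta>))"
proof -
  interpret U: UP_cring R "UP R" by unfold_locales
  have N: "nf_coeffs r \<Delta> R N" using assms(1) by (rule normal_forms_coeffs)
  note Nc = nf_coeffsD[OF N]
  let ?w = "weight n w"
  let ?N = "\<lambda>\<alpha> \<beta>. up_ring.monom (UP R) (N \<alpha> \<beta>) (?w \<alpha> - ?w \<beta>)"
  have wle: "?w \<beta> \<le> ?w \<alpha>" if "N \<alpha> \<beta> \<noteq> \<zero>" for \<alpha> \<beta>
    using w[OF Nc(3)[OF that] Nc(4)[OF that]] by (cases "\<beta> = \<alpha>") auto
  have "nf_coeffs r \<Delta> (UP R) ?N"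
    unfolding nf_coeffs_def
  proof (intro conjI allI ballI impI)
    fix \<alpha> \<beta>
    show "?N \<alpha> \<beta> \<in> carrier (UP R)" using Nc(1) by simp
    show "\<beta> \<in> \<Delta>" "(\<beta>, \<alpha>) \<in> r" if "?N \<alpha> \<beta> \<noteq> \<zero>\<^bsub>UP R\<^esub>"
    proof -
      have "N \<alpha> \<beta> \<noteq> \<zero>" using that U.monom_zero by metis
      then show "\<beta> \<in> \<Delta>" "(\<beta>, \<alpha>) \<in> r" by (rule Nc(3), rule Nc(4))
    qed
  next
    fix \<alpha> \<beta> assume "\<alpha> \<in> \<Delta>" "\<beta> \<in> \<Delta>"
    then show "?N \<alpha> \<beta> = (if \<alpha> = \<beta> then \<one>\<^bsub>UP R\<^esub> else \<zero>\<^bsub>UP R\<^esub>)"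
      using Nc(2)[of \<alpha> \<beta>] by (cases "\<alpha> = \<beta>") simp_all
  qed
  moreover have "?N (expo_add \<alpha> \<gamma>) \<beta> = (\<Oplus>\<^bsub>UP R\<^esub>\<delta>\<in>\<Delta>. ?N \<alpha> \<delta> \<otimes>\<^bsub>UP R\<^esub> ?N (expo_add \<delta> \<gamma>) \<beta>)"
    if *: "\<alpha> \<in> expo n" "\<gamma> \<in> expo n" "\<beta> \<in> \<Delta>" for \<alpha> \<gamma> \<beta>
  proof -
    let ?k = "?w (expo_add \<alpha> \<gamma>) - ?w \<beta>"
    have "N (expo_add \<alpha> \<gamma>) \<beta> = (\<Oplus>\<delta>\<in>\<Delta>. N \<alpha> \<delta> \<otimes> N (expo_add \<delta> \<gamma>) \<beta>)"
      using assms(1) * by (simp add: normal_forms_def)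
    then have "?N (expo_add \<alpha> \<gamma>) \<beta> = (\<Oplus>\<^bsub>UP R\<^esub>\<delta>\<in>\<Delta>. up_ring.monom (UP R) (N \<alpha> \<delta> \<otimes> N (expo_add \<delta> \<gamma>) \<beta>) ?k)"
      using U.monom_finsum[OF finite_\<Delta>, of "\<lambda>\<delta>. N \<alpha> \<delta> \<otimes> N (expo_add \<delta> \<gamma>) \<beta>" ?k] Nc(1) by simp
    also have "\<dots> = (\<Oplus>\<^bsub>UP R\<^esub>\<delta>\<in>\<Delta>. ?N \<alpha> \<delta> \<otimes>\<^bsub>UP R\<^esub> ?N (expo_add \<delta> \<gamma>) \<beta>)"
    proof (intro U.finsum_cong')
      fix \<delta> assume "\<delta> \<in> \<Delta>"
      show "up_ring.monom (UP R) (N \<alpha> \<delta> \<otimes> N (expo_add \<delta> \<gamma>) \<beta>) ?k = ?N \<alpha> \<delta> \<otimes>\<^bsub>UP R\<^esub> ?N (expo_add \<delta> \<gamma>) \<beta>"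
      \<comment> \<open>If a factor is zero, both sides vanish. Otherwise all the subtractions are
        exact, and the two exponents add up to \<open>?k\<close> because the weight of \<delta>
        cancels.\<close>
      proof (cases "N \<alpha> \<delta> = \<zero> \<or> N (expo_add \<delta> \<gamma>) \<beta> = \<zero>")
        case True
        then show ?thesis using Nc(1) by auto
      next
        case False
        then have "?w \<delta> \<le> ?w \<alpha>" "?w \<beta> \<le> ?w \<delta> + ?w \<gamma>"
          using wle[of \<alpha> \<delta>] wle[of "expo_add \<delta> \<gamma>" \<beta>] by (auto simp: weight_add)
        then have "?k = (?w \<alpha> - ?w \<delta>) + (?w (expo_add \<delta> \<gamma>) - ?w \<beta>)" by (simp add: weight_add)
        then show ?thesis using U.monom_mult[OF Nc(1) Nc(1)] by simp
      qed
    qed (use Nc(1) in auto)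
    finally show ?thesis .
  qed
  ultimately show ?thesis by (simp add: normal_forms_def)
qed

end

section \<open>A copy of the polynomial ring in the universe type\<close>

lemma UP_embeds:
  fixes R :: "('a, 'm) ring_scheme"
  assumes "infinite (UNIV :: 'a set)"
  shows "\<exists>e :: (nat \<Rightarrow> 'a) \<Rightarrow> 'a. inj_on e (carrier (UP R))"
proof -
  obtain e0 :: "'a list \<Rightarrow> 'a" where e0: "bij e0"
    using lists_infinite_bij_betw_types[OF assms] by blast
  \<comment> \<open>A degree bound of \<open>f\<close>. The list of the first
    \<open>Suc (b f)\<close> coefficients determines \<open>f\<close>, because its length gives back
    \<open>b f\<close>; and an infinite type is in bijection with the lists over it.\<close>
  define b where "b f = (LEAST k. bound \<zero>\<^bsub>R\<^esub> k f)" for f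
  have b: "bound \<zero>\<^bsub>R\<^esub> (b f) f" if "f \<in> carrier (UP R)" for f
  proof -
    have "\<exists>k. bound \<zero>\<^bsub>R\<^esub> k f" using that by (auto simp: UP_def up_def)
    then show ?thesis unfolding b_def by (rule LeastI_ex)
  qed
  have "inj_on (\<lambda>f. map f [0..<Suc (b f)]) (carrier (UP R))"
  proof (rule inj_onI, rule ext)
    fix f g and i :: nat
    assume fg: "f \<in> carrier (UP R)" "g \<in> carrier (UP R)"
      and eq: "map f [0..<Suc (b f)] = map g [0..<Suc (b g)]"
    have len: "b f = b g" using arg_cong[OF eq, of length] by simp
    show "f i = g i"
    proof (cases "i \<le> b f")
      case True
      then show ?thesis using arg_cong[OF eq, of "\<lambda>xs. xs ! i"] len by (simp del: upt_Suc)
    next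
      case False
      then show ?thesis using b[OF fg(1)] b[OF fg(2)] len by (simp add: bound_def)
    qed
  qed
  then have "inj_on (e0 \<circ> (\<lambda>f. map f [0..<Suc (b f)])) (carrier (UP R))"
    using e0 by (intro comp_inj_on) (auto simp: bij_def intro: inj_on_subset)
  then show ?thesis by blast
qed

lemma UP_copy:
  fixes R :: "('a, 'm) ring_scheme"
  assumes "infinite (UNIV :: 'a set)" "cring R"
  shows "\<exists>(B :: 'a ring) e e'. cring B \<and> e \<in> ring_hom (UP R) B \<and> e' \<in> ring_hom B (UP R) \<and>
    (\<forall>x\<in>carrier (UP R). e' (e x) = x)"
proof -
  interpret cring R by fact
  interpret U: UP_cring R "UP R" by unfold_locales
  obtain e :: "(nat \<Rightarrow> 'a) \<Rightarrow> 'a" where e: "inj_on e (carrier (UP R))"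
    using UP_embeds[OF assms(1), of R] by blast
  let ?B = "image_ring e (UP R)"
  let ?e' = "inv_into (carrier (UP R)) e"
  have iso: "e \<in> ring_iso (UP R) ?B" by (rule inj_imp_image_ring_iso[OF e])
  \<comment> \<open>The zero of \<open>image_ring\<close> is already the image of zero, so the
    record update changes nothing.\<close>
  have "cring (?B\<lparr>ring.zero := e \<zero>\<^bsub>UP R\<^esub>\<rparr>)" by (rule U.ring_iso_imp_img_cring[OF iso])
  then have "cring ?B" by (simp add: image_ring_def image_group_def monoid.defs)
  moreover have "e \<in> ring_hom (UP R) ?B" using iso by (simp add: ring_iso_def)
  moreover have "?e' \<in> ring_hom ?B (UP R)"
    using ring_iso_set_sym[OF U.UP_ring iso] by (simp add: ring_iso_def)
  moreover have "\<forall>x\<in>carrier (UP R). ?e' (e x) = x" using e by simp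
  ultimately show ?thesis by blast
qed

section \<open>The universal coefficients and the deformation homomorphism\<close>

locale hilb_representation =
  fixes k R :: "'a ring" and c :: "'a \<Rightarrow> 'a" and n :: nat and r :: "((nat \<Rightarrow> nat) \<times> (nat \<Rightarrow> nat)) set"
    and \<Delta> :: "(nat \<Rightarrow> nat) set" and U :: "((nat \<Rightarrow> nat) \<Rightarrow> 'a) set"
  assumes infinite_UNIV: "infinite (UNIV :: 'a set)"
    and monomial_order: "monomial_order n r" and standard: "standard_set n \<Delta>" and finite_\<Delta>: "finite \<Delta>"
    and represents: "represents_Hilb k n r \<Delta> R c U"
begin

lemma cring_k: "cring k" and cring_R: "cring R" and c_hom: "c \<in> ring_hom k R"
  and U_Hilb: "U \<in> Hilb_functor n r \<Delta> R"
  using represents by (auto simp: represents_Hilb_def kalgebra_def)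

lemma hilb_settingI: "cring B \<Longrightarrow> hilb_setting B n r \<Delta>"
  using monomial_order standard finite_\<Delta> by (simp add: hilb_setting_def hilb_setting_axioms_def)

lemma hilb_base_changeI: "cring B \<Longrightarrow> cring C \<Longrightarrow> h \<in> ring_hom B C \<Longrightarrow> hilb_base_change B C h n r \<Delta>"
  unfolding hilb_base_change_def using hilb_settingI ring_hom_cringI by blast

lemma ex_N: "\<exists>N. normal_forms n r \<Delta> R N \<and> U = nf_ideal n \<Delta> R N"
proof -
  interpret hilb_setting R n r \<Delta> by (rule hilb_settingI[OF cring_R])
  show ?thesis using Hilb_normal_forms[OF U_Hilb] by blast
qed

text \<open>The choice is unique by \<open>nf_ideal_determines_coeffs\<close>. These elements of
  \<open>R\<close> are the normal form coefficients of the universal family.\<close>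

definition "univ_nf = (SOME N. normal_forms n r \<Delta> R N \<and> U = nf_ideal n \<Delta> R N)"

lemma univ_nf: "normal_forms n r \<Delta> R univ_nf" "U = nf_ideal n \<Delta> R univ_nf"
  using someI_ex[OF ex_N] unfolding univ_nf_def by blast+

lemma univ_nf_carrier: "univ_nf \<alpha> \<beta> \<in> carrier R"
  using univ_nf(1) by (simp add: normal_forms_def nf_coeffs_def)

lemma extend_U:
  assumes "cring B" "h \<in> ring_hom R B"
  shows "extend_ideal n B h U = nf_ideal n \<Delta> B (\<lambda>\<alpha> \<beta>. h (univ_nf \<alpha> \<beta>))"
    and "normal_forms n r \<Delta> B (\<lambda>\<alpha> \<beta>. h (univ_nf \<alpha> \<beta>))"
proof -
  interpret hilb_base_change R B h n r \<Delta> by (rule hilb_base_changeI[OF cring_R assms])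
  show "extend_ideal n B h U = nf_ideal n \<Delta> B (\<lambda>\<alpha> \<beta>. h (univ_nf \<alpha> \<beta>))"
    by (rule extend_nf_ideal[OF univ_nf(1), folded univ_nf(2)])
  show "normal_forms n r \<Delta> B (\<lambda>\<alpha> \<beta>. h (univ_nf \<alpha> \<beta>))" by (rule normal_forms_hom[OF univ_nf(1)])
qed

lemma ex1_hom:
  fixes B :: "'a ring"
  assumes B: "kalgebra k B b" and N: "normal_forms n r \<Delta> B N"
  shows "\<exists>!h. h \<in> kalgebra_hom k R c B b \<and> extend_ideal n B h U = nf_ideal n \<Delta> B N"
proof -
  have "cring B" using B by (simp add: kalgebra_def)
  then interpret B: hilb_setting B n r \<Delta> by (rule hilb_settingI)
  have "\<forall>(B :: 'a ring) b. kalgebra k B b \<longrightarrow>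
        (\<forall>I\<in>Hilb_functor n r \<Delta> B. \<exists>!h. h \<in> kalgebra_hom k R c B b \<and> extend_ideal n B h U = I)"
    using represents unfolding represents_Hilb_def by (elim conjE)
  then show ?thesis using B B.nf_ideal_in_Hilb[OF N] by simp
qed

text \<open>The universal property speaks of extended ideals. Since extension acts entrywise on
  coefficients and an ideal determines its coefficients, the classifying homomorphism sends the
  universal coefficients to \<open>N\<close>.\<close>

lemma classifying_hom:
  fixes B :: "'a ring"
  assumes B: "kalgebra k B b" and N: "normal_forms n r \<Delta> B N"
  defines "h \<equiv> classifying_hom k n R c U B b (nf_ideal n \<Delta> B N)"
  shows "h \<in> ring_hom R B" "\<And>x. x \<in> carrier k \<Longrightarrow> h (c x) = b x" "\<And>\<alpha> \<beta>. h (univ_nf \<alpha> \<beta>) = N \<alpha> \<beta>"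
proof -
  have "cring B" using B by (simp add: kalgebra_def)
  then interpret B: hilb_setting B n r \<Delta> by (rule hilb_settingI)
  have h: "h \<in> kalgebra_hom k R c B b \<and> extend_ideal n B h U = nf_ideal n \<Delta> B N"
    unfolding h_def classifying_hom_def by (rule theI'[OF ex1_hom[OF B N]])
  then show hom: "h \<in> ring_hom R B" "\<And>x. x \<in> carrier k \<Longrightarrow> h (c x) = b x"
    by (auto simp: kalgebra_hom_def)
  have "(\<lambda>\<alpha> \<beta>. h (univ_nf \<alpha> \<beta>)) = N"
    using extend_U[OF \<open>cring B\<close> hom(1)] h N B.normal_forms_coeffs by (intro B.nf_ideal_determines_coeffs) auto
  then show "\<And>\<alpha> \<beta>. h (univ_nf \<alpha> \<beta>) = N \<alpha> \<beta>" by metis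
qed

text \<open>Both homomorphisms classify the same ideal over the same k-algebra, whose structure map
  is \<open>?b\<close>. So \<open>R\<close> behaves as if generated over k by the universal
  coefficients. Restriction to the carrier provides the extensionality that
  \<open>kalgebra_hom\<close> demands.\<close>

lemma hom_unique:
  fixes B :: "'a ring"
  assumes B: "cring B" and h: "h \<in> ring_hom R B" "h' \<in> ring_hom R B"
    and kh: "\<And>x. x \<in> carrier k \<Longrightarrow> h (c x) = h' (c x)"
    and nf: "\<And>\<alpha> \<beta>. h (univ_nf \<alpha> \<beta>) = h' (univ_nf \<alpha> \<beta>)" and x: "x \<in> carrier R"
  shows "h x = h' x"
proof -
  interpret R: cring R by (rule cring_R)
  let ?b = "\<lambda>x. h (c x)" and ?N = "\<lambda>\<alpha> \<beta>. h (univ_nf \<alpha> \<beta>)"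
  have c: "c x \<in> carrier R" if "x \<in> carrier k" for x using c_hom that by (rule ring_hom_closed)
  have alg: "kalgebra k B ?b"
    unfolding kalgebra_def using cring_k B ring_hom_trans[OF c_hom h(1)] by (simp add: comp_def)
  have *: "restrict g (carrier R) \<in> kalgebra_hom k R c B ?b \<and> extend_ideal n B (restrict g (carrier R)) U = nf_ideal n \<Delta> B ?N"
    if g: "g \<in> ring_hom R B" "\<And>x. x \<in> carrier k \<Longrightarrow> g (c x) = ?b x" "\<And>\<alpha> \<beta>. g (univ_nf \<alpha> \<beta>) = ?N \<alpha> \<beta>" for g
  proof -
    have hom: "restrict g (carrier R) \<in> ring_hom R B"
      using R.ring_hom_restrict[OF g(1), of "restrict g (carrier R)"] by simp
    have "extend_ideal n B (restrict g (carrier R)) U = nf_ideal n \<Delta> B ?N"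
      using extend_U(1)[OF B hom] univ_nf_carrier g(3) by simp
    then show ?thesis using hom g(2) c by (simp add: kalgebra_hom_def)
  qed
  obtain g0 where "\<forall>g. g \<in> kalgebra_hom k R c B ?b \<and> extend_ideal n B g U = nf_ideal n \<Delta> B ?N \<longrightarrow> g = g0"
    using ex1_hom[OF alg extend_U(2)[OF B h(1)]] unfolding Ex1_def by blast
  then have "restrict h (carrier R) = restrict h' (carrier R)"
    using *[OF h(1) refl refl] *[OF h(2) kh[symmetric] nf[symmetric]] by metis
  from fun_cong[OF this, of x] show ?thesis using x by simp
qed

text \<open>\<open>\<phi>\<close> is the ring map dual to the morphism g, and \<open>\<psi>\<close>
  is dual to the section of the monomial ideal. The identities at t = 1 and t = 0 compare
  endomorphisms of \<open>R\<close>, so \<open>hom_unique\<close> leaves only k and the universal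
  coefficients to be checked.\<close>

lemma deformation:
  defines "\<psi> \<equiv> classifying_hom k n R c U k id (monomial_ideal n \<Delta> k)"
  shows "\<exists>\<phi>. \<phi> \<in> ring_hom R (UP R) \<and> \<psi> \<in> ring_hom R k \<and>
    (\<forall>x\<in>carrier k. \<phi> (c x) = const_poly R (c x)) \<and>
    (\<forall>x\<in>carrier R. UnivPoly.eval R R id \<one>\<^bsub>R\<^esub> (\<phi> x) = x \<and>
      UnivPoly.eval R R id \<zero>\<^bsub>R\<^esub> (\<phi> x) = c (\<psi> x))"
proof -
  interpret R: hilb_setting R n r \<Delta> by (rule hilb_settingI[OF cring_R])
  interpret k: hilb_setting k n r \<Delta> by (rule hilb_settingI[OF cring_k])
  interpret E: UP_pre_univ_prop R R id "UP R"
    using UP_pre_univ_propI[OF cring_R cring_R] by simp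
  let ?w = "weight n"
  obtain w where w: "\<And>\<alpha> \<beta>. \<beta> \<in> \<Delta> \<Longrightarrow> (\<beta>, \<alpha>) \<in> r \<Longrightarrow> \<beta> \<noteq> \<alpha> \<Longrightarrow> ?w w \<beta> < ?w w \<alpha>"
    using ex_weight[OF monomial_order finite_\<Delta> R.\<Delta>_expo] by blast
  define Nt where "Nt \<alpha> \<beta> = up_ring.monom (UP R) (univ_nf \<alpha> \<beta>) (?w w \<alpha> - ?w w \<beta>)" for \<alpha> \<beta>
  have Nt: "normal_forms n r \<Delta> (UP R) Nt"
    unfolding Nt_def[abs_def] by (rule R.normal_forms_deform[OF univ_nf(1) w])
  have Nt_closed: "Nt \<alpha> \<beta> \<in> carrier (UP R)" for \<alpha> \<beta>
    unfolding Nt_def by (rule E.monom_closed[OF univ_nf_carrier])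
  obtain B :: "'a ring" and e e' where B: "cring B" and e: "e \<in> ring_hom (UP R) B"
    and e': "e' \<in> ring_hom B (UP R)" and e'e: "\<And>x. x \<in> carrier (UP R) \<Longrightarrow> e' (e x) = x"
    using UP_copy[OF infinite_UNIV cring_R] by blast
  interpret D: hilb_base_change "UP R" B e n r \<Delta> by (rule hilb_base_changeI[OF E.UP_cring B e])
  have const: "(\<lambda>a. const_poly R a) \<in> ring_hom R (UP R)"
    unfolding const_poly_def by (rule E.const_ring_hom)
  have cc: "c x \<in> carrier R" if "x \<in> carrier k" for x using c_hom that by (rule ring_hom_closed)
  \<comment> \<open>The copy becomes a k-algebra through constant polynomials; this makes g
    compatible with the projections to Spec k.\<close>
  define b where "b x = e (const_poly R (c x))" for x
  have b: "kalgebra k B b"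
    unfolding kalgebra_def b_def[abs_def]
    using cring_k B ring_hom_trans[OF ring_hom_trans[OF c_hom const] e] by (simp add: comp_def)
  define h where "h = classifying_hom k n R c U B b (nf_ideal n \<Delta> B (\<lambda>\<alpha> \<beta>. e (Nt \<alpha> \<beta>)))"
  note h = classifying_hom[OF b D.normal_forms_hom[OF Nt], folded h_def]
  define \<phi> where "\<phi> x = e' (h x)" for x
  have \<phi>: "\<phi> \<in> ring_hom R (UP R)"
    unfolding \<phi>_def[abs_def] using ring_hom_trans[OF h(1) e'] by (simp add: comp_def)
  have \<phi>_c: "\<phi> (c x) = const_poly R (c x)" if "x \<in> carrier k" for x
    unfolding \<phi>_def h(2)[OF that] b_def using cc[OF that] by (intro e'e) (simp add: const_poly_def)
  have \<phi>_N: "\<phi> (univ_nf \<alpha> \<beta>) = Nt \<alpha> \<beta>" for \<alpha> \<beta>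
    unfolding \<phi>_def h(3) by (rule e'e[OF Nt_closed])
  have id: "kalgebra k k id" using cring_k by (simp add: kalgebra_def)
  note \<psi> = classifying_hom[OF id k.normal_forms_monomial, folded k.monomial_ideal_eq, folded \<psi>_def]
  have \<psi>_c: "\<psi> (c x) = x" if "x \<in> carrier k" for x using \<psi>(2)[OF that] by simp
  have ev: "(\<lambda>x. UnivPoly.eval R R id s (\<phi> x)) \<in> ring_hom R R" if "s \<in> carrier R" for s
    using ring_hom_trans[OF \<phi> E.eval_ring_hom[OF that]] by (simp add: comp_def)
  have ev_c: "UnivPoly.eval R R id s (\<phi> (c x)) = c x" if "s \<in> carrier R" "x \<in> carrier k" for s x
    using \<phi>_c[OF that(2)] E.eval_const[OF that(1) cc[OF that(2)]] by (simp add: const_poly_def)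
  \<comment> \<open>Evaluation at \<open>s\<close> multiplies a universal coefficient by the power
    of \<open>s\<close> given by the weights. At 1 all powers are one; at 0 only exponent zero
    survives, as the zeroth power of zero is one.\<close>
  have ev_N: "UnivPoly.eval R R id s (\<phi> (univ_nf \<alpha> \<beta>)) = univ_nf \<alpha> \<beta> \<otimes>\<^bsub>R\<^esub> s [^]\<^bsub>R\<^esub> (?w w \<alpha> - ?w w \<beta>)"
    if "s \<in> carrier R" for s \<alpha> \<beta>
    using E.eval_monom[OF univ_nf_carrier that] by (simp add: \<phi>_N Nt_def)
  have one: "UnivPoly.eval R R id \<one>\<^bsub>R\<^esub> (\<phi> x) = x" if "x \<in> carrier R" for x
    using hom_unique[OF cring_R ev[OF R.one_closed] id_ring_hom _ _ that]
      ev_c[OF R.one_closed] ev_N[OF R.one_closed] univ_nf_carrier by simp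
  have zero: "UnivPoly.eval R R id \<zero>\<^bsub>R\<^esub> (\<phi> x) = c (\<psi> x)" if "x \<in> carrier R" for x
  proof (rule hom_unique[OF cring_R ev[OF R.zero_closed] _ _ _ that])
    show "(\<lambda>x. c (\<psi> x)) \<in> ring_hom R R" using ring_hom_trans[OF \<psi>(1) c_hom] by (simp add: comp_def)
    show "UnivPoly.eval R R id \<zero>\<^bsub>R\<^esub> (\<phi> (c x)) = c (\<psi> (c x))" if "x \<in> carrier k" for x
      using ev_c[OF R.zero_closed that] \<psi>_c[OF that] by simp
    fix \<alpha> \<beta>
    interpret c: ring_hom_cring k R c by (rule ring_hom_cringI[OF cring_k cring_R c_hom])
    note nc = R.nf_coeffsD[OF R.normal_forms_coeffs[OF univ_nf(1)]]
    have rhs: "c (\<psi> (univ_nf \<alpha> \<beta>)) = (if \<alpha> = \<beta> \<and> \<beta> \<in> \<Delta> then \<one>\<^bsub>R\<^esub> else \<zero>\<^bsub>R\<^esub>)"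
      unfolding \<psi>(3) k.monomial_nf_def by simp
    show "UnivPoly.eval R R id \<zero>\<^bsub>R\<^esub> (\<phi> (univ_nf \<alpha> \<beta>)) = c (\<psi> (univ_nf \<alpha> \<beta>))"
    proof (cases "univ_nf \<alpha> \<beta> = \<zero>\<^bsub>R\<^esub>")
      case True
      \<comment> \<open>On the diagonal of \<Delta> the coefficient is both zero and one, so the
        ring is trivial there and the right-hand side is zero as well.\<close>
      then have "\<one>\<^bsub>R\<^esub> = \<zero>\<^bsub>R\<^esub>" if "\<alpha> = \<beta> \<and> \<beta> \<in> \<Delta>" using nc(2)[of \<alpha> \<beta>] that by simp
      then show ?thesis unfolding ev_N[OF R.zero_closed] rhs using True by auto
    next
      case False
      note \<beta> = nc(3)[OF False] and le = nc(4)[OF False]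
      show ?thesis
      proof (cases "\<alpha> = \<beta>")
        case True
        then show ?thesis unfolding ev_N[OF R.zero_closed] rhs using \<beta> nc(2)[of \<alpha> \<beta>] by simp
      next
        case ne: False
        \<comment> \<open>A nonzero coefficient off the diagonal has \<beta> strictly below
          \<alpha>, so the weights differ and a positive power of zero appears.\<close>
        then have "?w w \<alpha> - ?w w \<beta> \<noteq> 0" using w[OF \<beta> le] by auto
        then have "\<zero>\<^bsub>R\<^esub> [^]\<^bsub>R\<^esub> (?w w \<alpha> - ?w w \<beta>) = \<zero>\<^bsub>R\<^esub>" by (simp add: R.nat_pow_zero)
        then show ?thesis unfolding ev_N[OF R.zero_closed] rhs using ne nc(1) by simp
      qed
    qed
  qed
  show ?thesis using \<phi> \<psi>(1) \<phi>_c one zero by (intro exI[of _ \<phi>] conjI ballI)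
qed

end


section \<open>Localization\<close>

text \<open>Operations on fractions and on germs are defined as unions over all representatives.
  When every representative yields the same class, the union is that class; this is how each such
  operation is computed.\<close>

lemma UN_constant:
  assumes "P \<noteq> {}" "\<And>a s. (a, s) \<in> P \<Longrightarrow> F a s = C"
  shows "(\<Union>(a, s)\<in>P. F a s) = C"
proof -
  have "(\<Union>(a, s)\<in>P. F a s) = (\<Union>p\<in>P. C)"
    using assms(2) by (intro SUP_cong) (auto split: prod.splits)
  then show ?thesis using assms(1) by simp
qed

lemma UN_pair_constant:
  assumes "P \<noteq> {}" "Q \<noteq> {}" "\<And>a s b t. (a, s) \<in> P \<Longrightarrow> (b, t) \<in> Q \<Longrightarrow> F a s b t = C"
  shows "(\<Union>(a, s)\<in>P. \<Union>(b, t)\<in>Q. F a s b t) = C"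
  using assms by (intro UN_constant) simp_all

context primeideal
begin

abbreviation denom where "denom \<equiv> carrier R - I"

lemma denom_closed: "s \<in> denom \<Longrightarrow> t \<in> denom \<Longrightarrow> s \<otimes> t \<in> denom"
  using I_prime by auto

lemma one_denom: "\<one> \<in> denom"
  using I_notcarr one_imp_carrier by auto

lemma fraction_mem: "(b, t) \<in> fraction R I a s \<longleftrightarrow> b \<in> carrier R \<and> t \<in> denom \<and>
    (\<exists>u\<in>denom. u \<otimes> (a \<otimes> t) = u \<otimes> (b \<otimes> s))"
  by (simp add: fraction_def)

lemma fraction_self: "a \<in> carrier R \<Longrightarrow> s \<in> denom \<Longrightarrow> (a, s) \<in> fraction R I a s"
  using one_denom by (auto simp: fraction_mem)

lemma fraction_subset:
  assumes "a \<in> carrier R" "b \<in> carrier R" "s \<in> denom" "t \<in> denom" "u \<in> denom"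
    and eq: "u \<otimes> (a \<otimes> t) = u \<otimes> (b \<otimes> s)"
  shows "fraction R I a s \<subseteq> fraction R I b t"
proof (rule subsetI)
  fix p assume p: "p \<in> fraction R I a s"
  obtain c v where cv: "p = (c, v)" by (cases p)
  with p obtain u' where *: "c \<in> carrier R" "v \<in> denom" "u' \<in> denom" "u' \<otimes> (a \<otimes> v) = u' \<otimes> (c \<otimes> s)"
    by (auto simp: fraction_mem)
  note [simp] = assms(1,2) *(1)
  have [simp]: "s \<in> carrier R" "t \<in> carrier R" "u \<in> carrier R" "v \<in> carrier R" "u' \<in> carrier R"
    using assms * by auto
  \<comment> \<open>The multiplier \<open>u \<otimes> u' \<otimes> s\<close> brings in both given
    equations at once, and it is again a denominator by primality.\<close>
  have "u \<otimes> u' \<otimes> s \<otimes> (b \<otimes> v) = u' \<otimes> v \<otimes> (u \<otimes> (b \<otimes> s))" by (simp add: m_ac)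
  also have "\<dots> = u \<otimes> t \<otimes> (u' \<otimes> (a \<otimes> v))" unfolding eq[symmetric] by (simp add: m_ac)
  also have "\<dots> = u \<otimes> u' \<otimes> s \<otimes> (c \<otimes> t)" unfolding *(4) by (simp add: m_ac)
  finally have "u \<otimes> u' \<otimes> s \<otimes> (b \<otimes> v) = u \<otimes> u' \<otimes> s \<otimes> (c \<otimes> t)" .
  moreover have "u \<otimes> u' \<otimes> s \<in> denom" using assms * by (intro denom_closed)
  ultimately show "p \<in> fraction R I b t" using * unfolding cv fraction_mem by blast
qed

lemma fraction_eq_iff:
  assumes "a \<in> carrier R" "b \<in> carrier R" "s \<in> denom" "t \<in> denom"
  shows "fraction R I a s = fraction R I b t \<longleftrightarrow> (\<exists>u\<in>denom. u \<otimes> (a \<otimes> t) = u \<otimes> (b \<otimes> s))"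
proof
  assume "fraction R I a s = fraction R I b t"
  then have "(b, t) \<in> fraction R I a s" using fraction_self assms by simp
  then show "\<exists>u\<in>denom. u \<otimes> (a \<otimes> t) = u \<otimes> (b \<otimes> s)" by (simp add: fraction_mem)
next
  assume "\<exists>u\<in>denom. u \<otimes> (a \<otimes> t) = u \<otimes> (b \<otimes> s)"
  then obtain u where u: "u \<in> denom" "u \<otimes> (a \<otimes> t) = u \<otimes> (b \<otimes> s)" by blast
  show "fraction R I a s = fraction R I b t"
    using fraction_subset[OF assms u] fraction_subset[OF assms(2,1,4,3) u(1) u(2)[symmetric]] by blast
qed

lemma fraction_eqI:
  assumes "a \<in> carrier R" "b \<in> carrier R" "s \<in> denom" "t \<in> denom" "a \<otimes> t = b \<otimes> s"
  shows "fraction R I a s = fraction R I b t"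
  using assms one_denom by (subst fraction_eq_iff) auto

lemma localization_carrier: "x \<in> carrier (localization R I) \<longleftrightarrow>
    (\<exists>a\<in>carrier R. \<exists>s\<in>denom. x = fraction R I a s)"
  by (auto simp: localization_def)

lemma fraction_closed: "a \<in> carrier R \<Longrightarrow> s \<in> denom \<Longrightarrow> fraction R I a s \<in> carrier (localization R I)"
  unfolding localization_carrier by blast

lemma localization_zero: "\<zero>\<^bsub>localization R I\<^esub> = fraction R I \<zero> \<one>"
  and localization_one: "\<one>\<^bsub>localization R I\<^esub> = fraction R I \<one> \<one>"
  by (simp_all add: localization_def)

lemma fraction_mult_cong:
  assumes "a \<in> carrier R" "s \<in> denom" "b \<in> carrier R" "t \<in> denom"
    and "(a', s') \<in> fraction R I a s" "(b', t') \<in> fraction R I b t"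
  shows "fraction R I (a' \<otimes> b') (s' \<otimes> t') = fraction R I (a \<otimes> b) (s \<otimes> t)"
proof -
  from assms obtain u v where *: "a' \<in> carrier R" "s' \<in> denom" "u \<in> denom" "u \<otimes> (a \<otimes> s') = u \<otimes> (a' \<otimes> s)"
    "b' \<in> carrier R" "t' \<in> denom" "v \<in> denom" "v \<otimes> (b \<otimes> t') = v \<otimes> (b' \<otimes> t)" by (auto simp: fraction_mem)
  have [simp]: "a \<in> carrier R" "s \<in> carrier R" "b \<in> carrier R" "t \<in> carrier R" "a' \<in> carrier R" "s' \<in> carrier R"
    "b' \<in> carrier R" "t' \<in> carrier R" "u \<in> carrier R" "v \<in> carrier R" using assms * by auto
  have "u \<otimes> v \<otimes> (a' \<otimes> b' \<otimes> (s \<otimes> t)) = (u \<otimes> (a' \<otimes> s)) \<otimes> (v \<otimes> (b' \<otimes> t))" by (simp add: m_ac)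
  also have "\<dots> = u \<otimes> v \<otimes> (a \<otimes> b \<otimes> (s' \<otimes> t'))" unfolding *(4,8)[symmetric] by (simp add: m_ac)
  finally have "\<exists>w\<in>denom. w \<otimes> (a' \<otimes> b' \<otimes> (s \<otimes> t)) = w \<otimes> (a \<otimes> b \<otimes> (s' \<otimes> t'))"
    using denom_closed[OF *(3,7)] by blast
  then show ?thesis using assms * denom_closed by (subst fraction_eq_iff) auto
qed

lemma fraction_add_cong:
  assumes "a \<in> carrier R" "s \<in> denom" "b \<in> carrier R" "t \<in> denom"
    and "(a', s') \<in> fraction R I a s" "(b', t') \<in> fraction R I b t"
  shows "fraction R I (a' \<otimes> t' \<oplus> b' \<otimes> s') (s' \<otimes> t') = fraction R I (a \<otimes> t \<oplus> b \<otimes> s) (s \<otimes> t)"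
proof -
  from assms obtain u v where *: "a' \<in> carrier R" "s' \<in> denom" "u \<in> denom" "u \<otimes> (a \<otimes> s') = u \<otimes> (a' \<otimes> s)"
    "b' \<in> carrier R" "t' \<in> denom" "v \<in> denom" "v \<otimes> (b \<otimes> t') = v \<otimes> (b' \<otimes> t)" by (auto simp: fraction_mem)
  have [simp]: "a \<in> carrier R" "s \<in> carrier R" "b \<in> carrier R" "t \<in> carrier R" "a' \<in> carrier R" "s' \<in> carrier R"
    "b' \<in> carrier R" "t' \<in> carrier R" "u \<in> carrier R" "v \<in> carrier R" using assms * by auto
  have "u \<otimes> v \<otimes> ((a' \<otimes> t' \<oplus> b' \<otimes> s') \<otimes> (s \<otimes> t))
      = (u \<otimes> (a' \<otimes> s)) \<otimes> (v \<otimes> t \<otimes> t') \<oplus> (v \<otimes> (b' \<otimes> t)) \<otimes> (u \<otimes> s \<otimes> s')"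
    by (simp add: l_distr r_distr m_ac)
  also have "\<dots> = u \<otimes> v \<otimes> ((a \<otimes> t \<oplus> b \<otimes> s) \<otimes> (s' \<otimes> t'))"
    unfolding *(4,8)[symmetric] by (simp add: l_distr r_distr m_ac)
  finally have "\<exists>w\<in>denom. w \<otimes> ((a' \<otimes> t' \<oplus> b' \<otimes> s') \<otimes> (s \<otimes> t)) = w \<otimes> ((a \<otimes> t \<oplus> b \<otimes> s) \<otimes> (s' \<otimes> t'))"
    using denom_closed[OF *(3,7)] by blast
  then show ?thesis using assms * denom_closed by (subst fraction_eq_iff) auto
qed

lemma localization_mult:
  assumes "a \<in> carrier R" "s \<in> denom" "b \<in> carrier R" "t \<in> denom"
  shows "fraction R I a s \<otimes>\<^bsub>localization R I\<^esub> fraction R I b t = fraction R I (a \<otimes> b) (s \<otimes> t)"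
proof -
  have "(\<Union>(a, s)\<in>fraction R I a s. \<Union>(b, t)\<in>fraction R I b t. fraction R I (a \<otimes> b) (s \<otimes> t))
      = fraction R I (a \<otimes> b) (s \<otimes> t)"
    using fraction_self[OF assms(1,2)] fraction_self[OF assms(3,4)]
    by (intro UN_pair_constant fraction_mult_cong assms) auto
  then show ?thesis by (simp add: localization_def)
qed

lemma localization_add:
  assumes "a \<in> carrier R" "s \<in> denom" "b \<in> carrier R" "t \<in> denom"
  shows "fraction R I a s \<oplus>\<^bsub>localization R I\<^esub> fraction R I b t = fraction R I (a \<otimes> t \<oplus> b \<otimes> s) (s \<otimes> t)"
proof -
  have "(\<Union>(a, s)\<in>fraction R I a s. \<Union>(b, t)\<in>fraction R I b t. fraction R I (a \<otimes> t \<oplus> b \<otimes> s) (s \<otimes> t))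
      = fraction R I (a \<otimes> t \<oplus> b \<otimes> s) (s \<otimes> t)"
    using fraction_self[OF assms(1,2)] fraction_self[OF assms(3,4)]
    by (intro UN_pair_constant fraction_add_cong assms) auto
  then show ?thesis by (simp add: localization_def)
qed

lemma localizationE:
  assumes "x \<in> carrier (localization R I)"
  obtains a s where "a \<in> carrier R" "s \<in> carrier R" "s \<in> denom" "x = fraction R I a s"
  using assms unfolding localization_carrier by blast

lemma localization_add_same:
  assumes "a \<in> carrier R" "b \<in> carrier R" "s \<in> denom"
  shows "fraction R I a s \<oplus>\<^bsub>localization R I\<^esub> fraction R I b s = fraction R I (a \<oplus> b) s"
proof -
  have s: "s \<in> carrier R" using assms(3) by simp
  have "fraction R I (a \<otimes> s \<oplus> b \<otimes> s) (s \<otimes> s) = fraction R I (a \<oplus> b) s"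
    using assms s denom_closed[OF assms(3,3)] by (intro fraction_eqI) (simp_all add: l_distr r_distr m_ac)
  then show ?thesis using assms by (simp add: localization_add)
qed

lemma localization_cring: "cring (localization R I)"
proof (rule cringI)
  let ?L = "localization R I"
  have add_closed: "x \<oplus>\<^bsub>?L\<^esub> y \<in> carrier ?L" if "x \<in> carrier ?L" "y \<in> carrier ?L" for x y
    using that denom_closed by (elim localizationE) (auto simp: localization_add intro!: fraction_closed)
  have mult_closed: "x \<otimes>\<^bsub>?L\<^esub> y \<in> carrier ?L" if "x \<in> carrier ?L" "y \<in> carrier ?L" for x y
    using that denom_closed by (elim localizationE) (auto simp: localization_mult intro!: fraction_closed)
  show "abelian_group ?L"
  proof (rule abelian_groupI)
    show "\<zero>\<^bsub>?L\<^esub> \<in> carrier ?L" using one_denom by (simp add: localization_zero fraction_closed)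
  next
    fix x y z assume xyz: "x \<in> carrier ?L" "y \<in> carrier ?L" "z \<in> carrier ?L"
    obtain a s where h1: "a \<in> carrier R" "s \<in> carrier R" "s \<in> denom" "x = fraction R I a s"
      by (rule localizationE[OF xyz(1)])
    obtain b t where h2: "b \<in> carrier R" "t \<in> carrier R" "t \<in> denom" "y = fraction R I b t"
      by (rule localizationE[OF xyz(2)])
    obtain c v where h3: "c \<in> carrier R" "v \<in> carrier R" "v \<in> denom" "z = fraction R I c v"
      by (rule localizationE[OF xyz(3)])
    note * = h1(1) h2(1) h3(1) h1(2) h2(2) h3(2) h1(3) h2(3) h3(3) and eq = h1(4) h2(4) h3(4)
    show "x \<oplus>\<^bsub>?L\<^esub> y \<oplus>\<^bsub>?L\<^esub> z = x \<oplus>\<^bsub>?L\<^esub> (y \<oplus>\<^bsub>?L\<^esub> z)"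
      unfolding eq using * denom_closed[OF *(7,8)] denom_closed[OF *(8,9)]
      by (simp add: localization_add m_assoc l_distr a_assoc) (simp add: m_ac a_ac)
  next
    fix x y assume xyz: "x \<in> carrier ?L" "y \<in> carrier ?L"
    obtain a s where h1: "a \<in> carrier R" "s \<in> carrier R" "s \<in> denom" "x = fraction R I a s"
      by (rule localizationE[OF xyz(1)])
    obtain b t where h2: "b \<in> carrier R" "t \<in> carrier R" "t \<in> denom" "y = fraction R I b t"
      by (rule localizationE[OF xyz(2)])
    note * = h1(1) h2(1) h1(2) h2(2) h1(3) h2(3) and eq = h1(4) h2(4)
    show "x \<oplus>\<^bsub>?L\<^esub> y = y \<oplus>\<^bsub>?L\<^esub> x"
      unfolding eq using * by (simp add: localization_add m_ac a_ac)
  next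
    fix x assume "x \<in> carrier ?L"
    then obtain a s where *: "a \<in> carrier R" "s \<in> carrier R" "s \<in> denom" and eq: "x = fraction R I a s"
      by (rule localizationE)
    show "\<zero>\<^bsub>?L\<^esub> \<oplus>\<^bsub>?L\<^esub> x = x"
      unfolding eq localization_zero using * one_denom by (simp add: localization_add)
    have "fraction R I (\<ominus> a) s \<oplus>\<^bsub>?L\<^esub> x = \<zero>\<^bsub>?L\<^esub>"
      unfolding eq localization_zero using * one_denom denom_closed[OF *(3,3)]
      by (simp add: localization_add_same l_neg) (rule fraction_eqI, auto)
    then show "\<exists>y\<in>carrier ?L. y \<oplus>\<^bsub>?L\<^esub> x = \<zero>\<^bsub>?L\<^esub>"
      using fraction_closed[of "\<ominus> a" s] * by blast
  qed (rule add_closed)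
  show "comm_monoid ?L"
  proof (rule comm_monoidI)
    show "\<one>\<^bsub>?L\<^esub> \<in> carrier ?L" using one_denom by (simp add: localization_one fraction_closed)
  next
    fix x y z assume xyz: "x \<in> carrier ?L" "y \<in> carrier ?L" "z \<in> carrier ?L"
    obtain a s where h1: "a \<in> carrier R" "s \<in> carrier R" "s \<in> denom" "x = fraction R I a s"
      by (rule localizationE[OF xyz(1)])
    obtain b t where h2: "b \<in> carrier R" "t \<in> carrier R" "t \<in> denom" "y = fraction R I b t"
      by (rule localizationE[OF xyz(2)])
    obtain c v where h3: "c \<in> carrier R" "v \<in> carrier R" "v \<in> denom" "z = fraction R I c v"
      by (rule localizationE[OF xyz(3)])
    note * = h1(1) h2(1) h3(1) h1(2) h2(2) h3(2) h1(3) h2(3) h3(3) and eq = h1(4) h2(4) h3(4)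
    show "x \<otimes>\<^bsub>?L\<^esub> y \<otimes>\<^bsub>?L\<^esub> z = x \<otimes>\<^bsub>?L\<^esub> (y \<otimes>\<^bsub>?L\<^esub> z)"
      unfolding eq using * denom_closed[OF *(7,8)] denom_closed[OF *(8,9)]
      by (simp add: localization_mult m_assoc)
  next
    fix x y assume xyz: "x \<in> carrier ?L" "y \<in> carrier ?L"
    obtain a s where h1: "a \<in> carrier R" "s \<in> carrier R" "s \<in> denom" "x = fraction R I a s"
      by (rule localizationE[OF xyz(1)])
    obtain b t where h2: "b \<in> carrier R" "t \<in> carrier R" "t \<in> denom" "y = fraction R I b t"
      by (rule localizationE[OF xyz(2)])
    note * = h1(1) h2(1) h1(2) h2(2) h1(3) h2(3) and eq = h1(4) h2(4)
    show "x \<otimes>\<^bsub>?L\<^esub> y = y \<otimes>\<^bsub>?L\<^esub> x"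
      unfolding eq using * by (simp add: localization_mult m_ac)
  next
    fix x assume "x \<in> carrier ?L"
    then obtain a s where *: "a \<in> carrier R" "s \<in> carrier R" "s \<in> denom" and eq: "x = fraction R I a s"
      by (rule localizationE)
    show "\<one>\<^bsub>?L\<^esub> \<otimes>\<^bsub>?L\<^esub> x = x"
      unfolding eq localization_one using * one_denom by (simp add: localization_mult)
  qed (rule mult_closed)
  fix x y z assume xyz: "x \<in> carrier ?L" "y \<in> carrier ?L" "z \<in> carrier ?L"
  obtain a s where h1: "a \<in> carrier R" "s \<in> carrier R" "s \<in> denom" "x = fraction R I a s"
    by (rule localizationE[OF xyz(1)])
  obtain b t where h2: "b \<in> carrier R" "t \<in> carrier R" "t \<in> denom" "y = fraction R I b t"
    by (rule localizationE[OF xyz(2)])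
  obtain c v where h3: "c \<in> carrier R" "v \<in> carrier R" "v \<in> denom" "z = fraction R I c v"
    by (rule localizationE[OF xyz(3)])
  note * = h1(1) h2(1) h3(1) h1(2) h2(2) h3(2) and d = h1(3) h2(3) h3(3) and eq = h1(4) h2(4) h3(4)
  note d' = denom_closed[OF d(1,2)] denom_closed[OF d(1,3)] denom_closed[OF d(2,3)]
  have "(x \<oplus>\<^bsub>?L\<^esub> y) \<otimes>\<^bsub>?L\<^esub> z = fraction R I ((a \<otimes> t \<oplus> b \<otimes> s) \<otimes> c) (s \<otimes> t \<otimes> v)"
    unfolding eq using * d d' by (simp add: localization_add localization_mult)
  \<comment> \<open>Adding the two products gives a denominator with one more factor
    \<open>v\<close>, which the numerator on this side matches.\<close>
  also have "\<dots> = fraction R I (a \<otimes> c \<otimes> (t \<otimes> v) \<oplus> b \<otimes> c \<otimes> (s \<otimes> v)) (s \<otimes> v \<otimes> (t \<otimes> v))"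
    using * denom_closed[OF d'(1) d(3)] denom_closed[OF d'(2,3)]
    by (intro fraction_eqI) (auto simp: l_distr r_distr m_ac)
  also have "\<dots> = x \<otimes>\<^bsub>?L\<^esub> z \<oplus>\<^bsub>?L\<^esub> y \<otimes>\<^bsub>?L\<^esub> z"
    unfolding eq using * d d' by (simp add: localization_add localization_mult)
  finally show "(x \<oplus>\<^bsub>?L\<^esub> y) \<otimes>\<^bsub>?L\<^esub> z = x \<otimes>\<^bsub>?L\<^esub> z \<oplus>\<^bsub>?L\<^esub> y \<otimes>\<^bsub>?L\<^esub> z" .
qed

lemma localization_hom: "(\<lambda>a. fraction R I a \<one>) \<in> ring_hom R (localization R I)"
  using one_denom
  by (intro ring_hom_memI) (auto simp: fraction_closed localization_mult localization_add_same localization_one)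

lemma localization_max_ideal: "ideal (localization_max_ideal R I) (localization R I)"
proof (rule idealI)
  let ?L = "localization R I" and ?M = "localization_max_ideal R I"
  interpret L: cring ?L by (rule localization_cring)
  have mem: "x \<in> ?M \<longleftrightarrow> (\<exists>a s. a \<in> I \<and> s \<in> denom \<and> x = fraction R I a s)" for x
    unfolding localization_max_ideal_def by auto
  have memI: "fraction R I a s \<in> ?M" if "a \<in> I" "s \<in> denom" for a s
    unfolding mem using that by (intro exI[of _ a] exI[of _ s]) simp
  have sub: "?M \<subseteq> carrier ?L"
    unfolding subset_iff mem using fraction_closed Icarr by blast
  have l: "y \<otimes>\<^bsub>?L\<^esub> x \<in> ?M" if xy: "x \<in> ?M" "y \<in> carrier ?L" for x y
  proof -
    obtain a s b t where *: "a \<in> I" "s \<in> denom" "x = fraction R I a s"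
        "b \<in> carrier R" "t \<in> denom" "y = fraction R I b t"
      using xy unfolding mem localization_carrier by blast
    have "y \<otimes>\<^bsub>?L\<^esub> x = fraction R I (b \<otimes> a) (t \<otimes> s)"
      using * Icarr by (simp add: localization_mult)
    moreover have "b \<otimes> a \<in> I" using * by (simp add: I_l_closed)
    ultimately show ?thesis using memI[OF _ denom_closed[OF *(5,2)]] by simp
  qed
  show "ring ?L" by (rule L.ring_axioms)
  show "subgroup ?M (add_monoid ?L)"
  proof (rule L.add.subgroupI)
    show "?M \<subseteq> carrier ?L" by (rule sub)
    show "?M \<noteq> {}" using memI[OF additive_subgroup.zero_closed[OF is_additive_subgroup] one_denom] by blast
    show "\<ominus>\<^bsub>?L\<^esub> x \<in> ?M" if "x \<in> ?M" for x
    proof -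
      have "\<ominus>\<^bsub>?L\<^esub> x = (\<ominus>\<^bsub>?L\<^esub> \<one>\<^bsub>?L\<^esub>) \<otimes>\<^bsub>?L\<^esub> x" using that sub by (simp add: L.l_minus subset_iff)
      then show ?thesis using l[OF that] by simp
    qed
    show "x \<oplus>\<^bsub>?L\<^esub> y \<in> ?M" if "x \<in> ?M" "y \<in> ?M" for x y
    proof -
      obtain a s b t where *: "a \<in> I" "s \<in> denom" "x = fraction R I a s"
          "b \<in> I" "t \<in> denom" "y = fraction R I b t"
        using \<open>x \<in> ?M\<close> \<open>y \<in> ?M\<close> unfolding mem by blast
      have "x \<oplus>\<^bsub>?L\<^esub> y = fraction R I (a \<otimes> t \<oplus> b \<otimes> s) (s \<otimes> t)"
        using * Icarr by (simp add: localization_add)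
      moreover have "a \<otimes> t \<oplus> b \<otimes> s \<in> I" using * I_r_closed by (intro additive_subgroup.a_closed[OF is_additive_subgroup]) auto
      ultimately show ?thesis using memI[OF _ denom_closed[OF *(2,5)]] by simp
    qed
  qed
  show "y \<otimes>\<^bsub>?L\<^esub> x \<in> ?M" "x \<otimes>\<^bsub>?L\<^esub> y \<in> ?M" if "x \<in> ?M" "y \<in> carrier ?L" for x y
    using l[OF that] L.m_comm[of x y] that sub by auto
qed

lemma residue_field_cring: "cring (residue_field R I)"
  unfolding residue_field_def
  by (rule ideal.quotient_is_cring[OF localization_max_ideal localization_cring])

lemma residue_map_hom: "residue_map R I \<in> ring_hom R (residue_field R I)"
proof -
  have "residue_map R I = (\<lambda>x. localization_max_ideal R I +>\<^bsub>localization R I\<^esub> x) \<circ> (\<lambda>a. fraction R I a \<one>)"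
    by (simp add: fun_eq_iff residue_map_def)
  then show ?thesis
    unfolding residue_field_def
    using ring_hom_trans[OF localization_hom ideal.rcos_ring_hom[OF localization_max_ideal]] by simp
qed

text \<open>The algebraic half of the locality of stalk maps: after clearing denominators, a
  numerator in the prime ideal would put a product of denominators into it.\<close>

lemma fraction_unit:
  assumes "a \<in> carrier R" "s \<in> denom" "x \<in> carrier (localization R I)"
    and "fraction R I a s \<otimes>\<^bsub>localization R I\<^esub> x = \<one>\<^bsub>localization R I\<^esub>"
  shows "a \<notin> I"
proof
  assume a: "a \<in> I"
  obtain b t where bt: "b \<in> carrier R" "t \<in> carrier R" "t \<in> denom" "x = fraction R I b t"
    by (rule localizationE[OF assms(3)])
  have "fraction R I (a \<otimes> b) (s \<otimes> t) = fraction R I \<one> \<one>"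
    using assms bt by (simp add: localization_mult localization_one)
  then obtain u where u: "u \<in> denom" "u \<otimes> (a \<otimes> b \<otimes> \<one>) = u \<otimes> (\<one> \<otimes> (s \<otimes> t))"
    using assms bt denom_closed[OF assms(2) bt(3)] one_denom by (subst (asm) fraction_eq_iff) auto
  have "u \<otimes> (a \<otimes> b \<otimes> \<one>) \<in> I" using a bt u(1) by (intro I_l_closed I_r_closed) auto
  moreover have "u \<otimes> (\<one> \<otimes> (s \<otimes> t)) \<in> denom" using u(1) assms(2) bt(3) one_denom by (intro denom_closed)
  ultimately show False using u(2) by auto
qed

end

section \<open>Localization maps over a ring homomorphism\<close>

lemma primeideal_preimage:
  assumes "cring A" "h \<in> ring_hom A B" "primeideal q B"
  shows "primeideal {a \<in> carrier A. h a \<in> q} A"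
proof -
  have "ring B" using assms(3) by (simp add: primeideal_def cring_def)
  then have "ring_hom_ring A B h" using assms by (intro ring_hom_ringI2) (auto simp: cring_def)
  then show ?thesis by (rule ring_hom_ring.primeideal_vimage) (use assms in auto)
qed

locale prime_comap =
  A: cring A + B: primeideal q B for A (structure) and B (structure) and q +
  fixes h and p
  assumes hom: "h \<in> ring_hom A B" and p_def: "p = {a \<in> carrier A. h a \<in> q}"
begin

sublocale p: primeideal p A
  unfolding p_def by (rule primeideal_preimage[OF A.cring_axioms hom B.primeideal_axioms])

lemma h_closed: "a \<in> carrier A \<Longrightarrow> h a \<in> carrier B"
  by (rule ring_hom_closed[OF hom])

lemma h_denom: "s \<in> carrier A - p \<Longrightarrow> h s \<in> carrier B - q"
  using h_closed unfolding p_def by blast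

lemma localization_map_fraction:
  assumes a: "a \<in> carrier A" and s: "s \<in> carrier A - p"
  shows "localization_map B q h (fraction A p a s) = fraction B q (h a) (h s)"
  unfolding localization_map_def
proof (rule UN_constant)
  show "fraction A p a s \<noteq> {}" using p.fraction_self[OF a s] by blast
  fix b t assume "(b, t) \<in> fraction A p a s"
  then obtain u where *: "b \<in> carrier A" "t \<in> carrier A - p" "u \<in> carrier A - p"
      "u \<otimes> (a \<otimes> t) = u \<otimes> (b \<otimes> s)" unfolding p.fraction_mem by blast
  have "h u \<otimes>\<^bsub>B\<^esub> (h b \<otimes>\<^bsub>B\<^esub> h s) = h (u \<otimes> (b \<otimes> s))"
    using *(1-3) a s by (simp add: ring_hom_mult[OF hom])
  also have "\<dots> = h u \<otimes>\<^bsub>B\<^esub> (h a \<otimes>\<^bsub>B\<^esub> h t)"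
    unfolding *(4)[symmetric] using *(1-3) a s by (simp add: ring_hom_mult[OF hom])
  finally show "fraction B q (h b) (h t) = fraction B q (h a) (h s)"
    using h_denom[OF *(3)] h_denom[OF *(2)] h_denom[OF s] h_closed * a
    by (subst B.fraction_eq_iff) auto
qed

lemma localization_map_hom: "localization_map B q h \<in> ring_hom (localization A p) (localization B q)"
proof (rule ring_hom_memI)
  fix x y assume "x \<in> carrier (localization A p)" "y \<in> carrier (localization A p)"
  then obtain a s b t where *: "a \<in> carrier A" "s \<in> carrier A" "s \<in> carrier A - p" "x = fraction A p a s"
      "b \<in> carrier A" "t \<in> carrier A" "t \<in> carrier A - p" "y = fraction A p b t"
    by (elim p.localizationE)
  note st = p.denom_closed[OF *(3,7)]
  note hs = h_denom[OF *(3)] h_denom[OF *(7)] B.denom_closed[OF h_denom[OF *(3)] h_denom[OF *(7)]]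
  note simps = ring_hom_mult[OF hom] ring_hom_add[OF hom]
  show "localization_map B q h (x \<otimes>\<^bsub>localization A p\<^esub> y) =
      localization_map B q h x \<otimes>\<^bsub>localization B q\<^esub> localization_map B q h y"
    unfolding *(4,8) p.localization_mult[OF *(1,3,5,7)] localization_map_fraction[OF *(1,3)]
      localization_map_fraction[OF *(5,7)] localization_map_fraction[OF A.m_closed[OF *(1,5)] st]
      B.localization_mult[OF h_closed[OF *(1)] hs(1) h_closed[OF *(5)] hs(2)]
    using * by (simp add: simps)
  have num: "a \<otimes> t \<oplus> b \<otimes> s \<in> carrier A" using * by simp
  show "localization_map B q h (x \<oplus>\<^bsub>localization A p\<^esub> y) =
      localization_map B q h x \<oplus>\<^bsub>localization B q\<^esub> localization_map B q h y"
    unfolding *(4,8) p.localization_add[OF *(1,3,5,7)] localization_map_fraction[OF *(1,3)]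
      localization_map_fraction[OF *(5,7)] localization_map_fraction[OF num st]
      B.localization_add[OF h_closed[OF *(1)] hs(1) h_closed[OF *(5)] hs(2)]
    using * by (simp add: simps)
next
  fix x assume "x \<in> carrier (localization A p)"
  then obtain a s where *: "a \<in> carrier A" "s \<in> carrier A - p" "x = fraction A p a s"
    by (elim p.localizationE)
  show "localization_map B q h x \<in> carrier (localization B q)"
    unfolding *(3) localization_map_fraction[OF *(1,2)]
    by (rule B.fraction_closed[OF h_closed[OF *(1)] h_denom[OF *(2)]])
next
  show "localization_map B q h \<one>\<^bsub>localization A p\<^esub> = \<one>\<^bsub>localization B q\<^esub>"
    unfolding p.localization_one B.localization_one
      localization_map_fraction[OF A.one_closed p.one_denom] ring_hom_one[OF hom] ..
qed

end


section \<open>Morphisms of affine schemes\<close>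

definition basic_open :: "('a, 'm) ring_scheme \<Rightarrow> 'a set \<Rightarrow> 'a set set" where
  "basic_open R E = {p. primeideal p R \<and> \<not> E \<subseteq> p}"

text \<open>\<open>E\<close> may be any set of elements, so \<open>basic_open\<close> covers all
  open sets. Intersections come from products of elements, as a prime ideal containing all products
  contains one of the two sets; unions come from the union of all defining sets.\<close>

lemma istopology_zariski:
  assumes "cring R"
  shows "istopology (\<lambda>V. \<exists>E\<subseteq>carrier R. V = basic_open R E)"
  unfolding istopology_def
proof (intro conjI allI impI)
  interpret cring R by fact
  fix V W assume "\<exists>E\<subseteq>carrier R. V = basic_open R E" "\<exists>E\<subseteq>carrier R. W = basic_open R E"
  then obtain E F where E: "E \<subseteq> carrier R" "V = basic_open R E" and F: "F \<subseteq> carrier R" "W = basic_open R F"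
    by blast
  let ?G = "(\<lambda>(a, b). a \<otimes>\<^bsub>R\<^esub> b) ` (E \<times> F)"
  have "?G \<subseteq> carrier R" using E F by auto
  moreover have "?G \<subseteq> p \<longleftrightarrow> E \<subseteq> p \<or> F \<subseteq> p" if p: "primeideal p R" for p
  proof -
    interpret primeideal p R by (rule p)
    show ?thesis
    proof
      assume G: "?G \<subseteq> p"
      show "E \<subseteq> p \<or> F \<subseteq> p"
      proof (rule ccontr)
        assume "\<not> (E \<subseteq> p \<or> F \<subseteq> p)"
        then obtain a b where ab: "a \<in> E" "a \<notin> p" "b \<in> F" "b \<notin> p" by blast
        then have "a \<otimes>\<^bsub>R\<^esub> b \<in> p" using G by auto
        then show False using I_prime[of a b] ab E F by blast
      qed
    next
      assume "E \<subseteq> p \<or> F \<subseteq> p"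
      then have "a \<otimes>\<^bsub>R\<^esub> b \<in> p" if "a \<in> E" "b \<in> F" for a b
        using that E F I_l_closed[of b a] I_r_closed[of a b] by blast
      then show "?G \<subseteq> p" by auto
    qed
  qed
  then have "V \<inter> W = basic_open R ?G" unfolding E F basic_open_def by blast
  ultimately show "\<exists>E\<subseteq>carrier R. V \<inter> W = basic_open R E" by blast
next
  fix K assume K: "\<forall>V\<in>K. \<exists>E\<subseteq>carrier R. V = basic_open R E"
  let ?E = "\<Union>{E. E \<subseteq> carrier R \<and> basic_open R E \<in> K}"
  have "\<Union>K = basic_open R ?E"
  proof (intro equalityI subsetI)
    fix p assume "p \<in> \<Union>K"
    then obtain V where V: "p \<in> V" "V \<in> K" by blast
    then obtain E where E: "E \<subseteq> carrier R" "V = basic_open R E" using K by blast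
    then have "E \<subseteq> ?E" using V by blast
    then show "p \<in> basic_open R ?E" using V E unfolding basic_open_def by blast
  next
    fix p assume "p \<in> basic_open R ?E"
    then obtain E where "primeideal p R" "basic_open R E \<in> K" "\<not> E \<subseteq> p" unfolding basic_open_def by blast
    then show "p \<in> \<Union>K" unfolding basic_open_def by blast
  qed
  then show "\<exists>E\<subseteq>carrier R. \<Union>K = basic_open R E" by (intro exI[of _ ?E]) blast
qed

lemma openin_zariski:
  "cring R \<Longrightarrow> openin (zariski R) V \<longleftrightarrow> (\<exists>E\<subseteq>carrier R. V = basic_open R E)"
  unfolding zariski_def basic_open_def[symmetric] by (simp add: topology_inverse' istopology_zariski)

lemma topspace_zariski:
  assumes "cring R"
  shows "topspace (zariski R) = {p. primeideal p R}"
proof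
  show "topspace (zariski R) \<subseteq> {p. primeideal p R}"
    using openin_topspace[of "zariski R"] unfolding openin_zariski[OF assms] basic_open_def by blast
  \<comment> \<open>Prime ideals are proper, so \<open>E = carrier R\<close> defines the whole
    spectrum.\<close>
  have "\<not> carrier R \<subseteq> p" if "primeideal p R" for p
  proof -
    interpret primeideal p R by (rule that)
    show ?thesis using I_notcarr a_subset by blast
  qed
  then have "basic_open R (carrier R) = {p. primeideal p R}" unfolding basic_open_def by blast
  then have "openin (zariski R) {p. primeideal p R}" unfolding openin_zariski[OF assms] by blast
  then show "{p. primeideal p R} \<subseteq> topspace (zariski R)" by (rule openin_subset)
qed

lemma open_prime: "cring R \<Longrightarrow> openin (zariski R) V \<Longrightarrow> p \<in> V \<Longrightarrow> primeideal p R"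
  using openin_subset[of "zariski R" V] by (auto simp: topspace_zariski)

section \<open>Sections, germs and stalks of an affine scheme\<close>

lemma Spec_topology [simp]: "rs_topology (Spec R) = zariski R"
  and Spec_restr [simp]: "restr (Spec R) V W \<sigma> = restrict \<sigma> W"
  by (simp_all add: Spec_def)

lemma Spec_sections_mult: "\<sigma> \<otimes>\<^bsub>sections (Spec R) V\<^esub> \<tau> = (\<lambda>p\<in>V. \<sigma> p \<otimes>\<^bsub>localization R p\<^esub> \<tau> p)"
  and Spec_sections_add: "\<sigma> \<oplus>\<^bsub>sections (Spec R) V\<^esub> \<tau> = (\<lambda>p\<in>V. \<sigma> p \<oplus>\<^bsub>localization R p\<^esub> \<tau> p)"
  and Spec_sections_one: "\<one>\<^bsub>sections (Spec R) V\<^esub> = (\<lambda>p\<in>V. \<one>\<^bsub>localization R p\<^esub>)"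
  by (simp_all add: Spec_def)

lemma Spec_section: "\<sigma> \<in> carrier (sections (Spec R) V) \<longleftrightarrow>
    (\<forall>p\<in>V. \<sigma> p \<in> carrier (localization R p)) \<and> \<sigma> \<in> extensional V \<and>
    (\<forall>p\<in>V. \<exists>W a s. openin (zariski R) W \<and> p \<in> W \<and> W \<subseteq> V \<and> a \<in> carrier R \<and> s \<in> carrier R \<and>
             (\<forall>q\<in>W. s \<notin> q \<and> \<sigma> q = fraction R q a s))"
  by (auto simp: Spec_def PiE_def Pi_def)

lemma section_closed: "\<sigma> \<in> carrier (sections (Spec R) V) \<Longrightarrow> p \<in> V \<Longrightarrow> \<sigma> p \<in> carrier (localization R p)"
  by (simp add: Spec_section)

lemma section_extensional: "\<sigma> \<in> carrier (sections (Spec R) V) \<Longrightarrow> \<sigma> \<in> extensional V"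
  by (simp add: Spec_section)

lemma section_local:
  assumes "\<sigma> \<in> carrier (sections (Spec R) V)" "p \<in> V"
  shows "\<exists>W a s. openin (zariski R) W \<and> p \<in> W \<and> W \<subseteq> V \<and> a \<in> carrier R \<and> s \<in> carrier R \<and>
             (\<forall>q\<in>W. s \<notin> q \<and> \<sigma> q = fraction R q a s)"
  using assms by (simp add: Spec_section)

lemma fraction_section:
  assumes "cring R" "openin (zariski R) V" "a \<in> carrier R" "s \<in> carrier R" "\<And>q. q \<in> V \<Longrightarrow> s \<notin> q"
  shows "(\<lambda>p\<in>V. fraction R p a s) \<in> carrier (sections (Spec R) V)"
proof -
  have "fraction R p a s \<in> carrier (localization R p)" if "p \<in> V" for p
    using primeideal.fraction_closed[OF open_prime[OF assms(1,2) that] assms(3)] assms(4) assms(5)[OF that] by simp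
  moreover have "\<exists>W a' s'. openin (zariski R) W \<and> p \<in> W \<and> W \<subseteq> V \<and> a' \<in> carrier R \<and> s' \<in> carrier R \<and>
      (\<forall>q\<in>W. s' \<notin> q \<and> (\<lambda>p\<in>V. fraction R p a s) q = fraction R q a' s')" if "p \<in> V" for p
    using assms that by (intro exI[of _ V] exI[of _ a] exI[of _ s]) simp
  ultimately show ?thesis unfolding Spec_section by simp
qed

lemma germ_mem: "(W, t) \<in> germ (Spec R) x V s \<longleftrightarrow>
    openin (zariski R) W \<and> x \<in> W \<and> t \<in> carrier (sections (Spec R) W) \<and>
    (\<exists>N. openin (zariski R) N \<and> x \<in> N \<and> N \<subseteq> V \<inter> W \<and> (\<forall>p\<in>N. s p = t p))"
proof -
  have "restrict s N = restrict t N \<longleftrightarrow> (\<forall>p\<in>N. s p = t p)" for N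
    by (metis restrict_apply' restrict_ext)
  then show ?thesis by (simp add: germ_def)
qed

lemma germ_self:
  "openin (zariski R) V \<Longrightarrow> x \<in> V \<Longrightarrow> s \<in> carrier (sections (Spec R) V) \<Longrightarrow> (V, s) \<in> germ (Spec R) x V s"
  unfolding germ_mem by (intro conjI exI[of _ V]) auto

lemma germ_subset:
  assumes N: "openin (zariski R) N" "x \<in> N" "N \<subseteq> V \<inter> V'" "\<And>p. p \<in> N \<Longrightarrow> s p = s' p"
  shows "germ (Spec R) x V s \<subseteq> germ (Spec R) x V' s'"
proof (rule subrelI)
  fix W t assume "(W, t) \<in> germ (Spec R) x V s"
  then obtain M where *: "openin (zariski R) W" "x \<in> W" "t \<in> carrier (sections (Spec R) W)"
      "openin (zariski R) M" "x \<in> M" "M \<subseteq> V \<inter> W" "\<forall>p\<in>M. s p = t p"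
    unfolding germ_mem by blast
  have "openin (zariski R) (N \<inter> M)" using N(1) *(4) by (rule openin_Int)
  moreover have "\<forall>p\<in>N \<inter> M. s' p = t p" using N(4) *(7) by (metis IntE)
  ultimately show "(W, t) \<in> germ (Spec R) x V' s'"
    unfolding germ_mem using *(1-3,5,6) N(2,3) by (intro conjI exI[of _ "N \<inter> M"]) auto
qed

lemma germ_eqI:
  assumes N: "openin (zariski R) N" "x \<in> N" "N \<subseteq> V \<inter> V'" "\<And>p. p \<in> N \<Longrightarrow> s p = s' p"
  shows "germ (Spec R) x V s = germ (Spec R) x V' s'"
proof
  show "germ (Spec R) x V s \<subseteq> germ (Spec R) x V' s'" using N by (rule germ_subset)
  show "germ (Spec R) x V' s' \<subseteq> germ (Spec R) x V s"
    by (rule germ_subset[of R N]) (use N in auto)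
qed

lemma stalk_carrier: "x \<in> carrier (stalk (Spec R) p) \<longleftrightarrow>
    (\<exists>V s. openin (zariski R) V \<and> p \<in> V \<and> s \<in> carrier (sections (Spec R) V) \<and> x = germ (Spec R) p V s)"
  by (auto simp: stalk_def)

lemma stalk_one: "\<one>\<^bsub>stalk (Spec R) p\<^esub> = germ (Spec R) p (topspace (zariski R)) (\<lambda>p\<in>topspace (zariski R). \<one>\<^bsub>localization R p\<^esub>)"
  by (simp add: stalk_def Spec_sections_one)

lemma stalk_mult:
  assumes V: "openin (zariski R) V" "x \<in> V" "s \<in> carrier (sections (Spec R) V)"
    and W: "openin (zariski R) W" "x \<in> W" "t \<in> carrier (sections (Spec R) W)"
  shows "germ (Spec R) x V s \<otimes>\<^bsub>stalk (Spec R) x\<^esub> germ (Spec R) x W t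
    = germ (Spec R) x (V \<inter> W) (\<lambda>p\<in>V \<inter> W. s p \<otimes>\<^bsub>localization R p\<^esub> t p)"
proof -
  have "(\<Union>(V, s)\<in>germ (Spec R) x V s. \<Union>(W, t)\<in>germ (Spec R) x W t. germ (Spec R) x (V \<inter> W)
         (\<lambda>p\<in>V \<inter> W. restrict s (V \<inter> W) p \<otimes>\<^bsub>localization R p\<^esub> restrict t (V \<inter> W) p))
    = germ (Spec R) x (V \<inter> W) (\<lambda>p\<in>V \<inter> W. s p \<otimes>\<^bsub>localization R p\<^esub> t p)"
  proof (rule UN_pair_constant)
    fix V' s' W' t' assume "(V', s') \<in> germ (Spec R) x V s" "(W', t') \<in> germ (Spec R) x W t"
    then obtain N M where N: "openin (zariski R) N" "x \<in> N" "N \<subseteq> V \<inter> V'" "\<forall>p\<in>N. s p = s' p"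
      and M: "openin (zariski R) M" "x \<in> M" "M \<subseteq> W \<inter> W'" "\<forall>p\<in>M. t p = t' p"
      unfolding germ_mem by blast
    show "germ (Spec R) x (V' \<inter> W')
         (\<lambda>p\<in>V' \<inter> W'. restrict s' (V' \<inter> W') p \<otimes>\<^bsub>localization R p\<^esub> restrict t' (V' \<inter> W') p)
      = germ (Spec R) x (V \<inter> W) (\<lambda>p\<in>V \<inter> W. s p \<otimes>\<^bsub>localization R p\<^esub> t p)"
    proof (rule germ_eqI)
      show "openin (zariski R) (N \<inter> M)" using N(1) M(1) by (rule openin_Int)
      fix p assume p: "p \<in> N \<inter> M"
      then have "p \<in> V' \<inter> W'" "p \<in> V \<inter> W" "s p = s' p" "t p = t' p" using N M by auto
      then show "(\<lambda>p\<in>V' \<inter> W'. restrict s' (V' \<inter> W') p \<otimes>\<^bsub>localization R p\<^esub> restrict t' (V' \<inter> W') p) p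
        = (\<lambda>p\<in>V \<inter> W. s p \<otimes>\<^bsub>localization R p\<^esub> t p) p" by simp
    qed (use N M in auto)
  qed (use germ_self[OF V] germ_self[OF W] in auto)
  then show ?thesis by (simp add: stalk_def Spec_sections_mult)
qed

section \<open>The morphism induced by a ring homomorphism\<close>

definition comap :: "('a, 'm) ring_scheme \<Rightarrow> ('a \<Rightarrow> 'b) \<Rightarrow> 'b set \<Rightarrow> 'a set" where
  "comap A h q = {a \<in> carrier A. h a \<in> q}"

locale spec_hom = A: cring A + B: cring B for A (structure) and B (structure) +
  fixes h
  assumes hom: "h \<in> ring_hom A B"
begin

abbreviation "f \<equiv> Spec_map A B h"

lemma comap_prime: "primeideal q B \<Longrightarrow> primeideal (comap A h q) A"
  unfolding comap_def by (rule primeideal_preimage[OF A.cring_axioms hom])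

lemma comap_locale: "primeideal q B \<Longrightarrow> prime_comap A B q h (comap A h q)"
  unfolding prime_comap_def prime_comap_axioms_def comap_def
  using A.cring_axioms hom by simp

lemma point_map_eq: "point_map f q = comap A h q"
  by (simp add: Spec_map_def comap_def)

lemma preimage_eq: "preimage (Spec B) f V = {q. primeideal q B \<and> comap A h q \<in> V}"
  by (simp add: preimage_def point_map_eq topspace_zariski[OF B.cring_axioms])

lemma pullback_eq: "pullback f V \<sigma> = (\<lambda>q\<in>preimage (Spec B) f V. localization_map B q h (\<sigma> (comap A h q)))"
  by (simp add: preimage_eq) (simp add: Spec_map_def comap_def)

lemma h_closed: "a \<in> carrier A \<Longrightarrow> h a \<in> carrier B"
  by (rule ring_hom_closed[OF hom])

lemma preimage_open:
  assumes "openin (zariski A) V"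
  shows "openin (zariski B) (preimage (Spec B) f V)"
proof -
  obtain E where E: "E \<subseteq> carrier A" "V = basic_open A E"
    using assms openin_zariski[OF A.cring_axioms] by blast
  have "h ` E \<subseteq> q \<longleftrightarrow> E \<subseteq> comap A h q" for q unfolding comap_def using E(1) by blast
  then have "preimage (Spec B) f V = basic_open B (h ` E)"
    unfolding preimage_eq E(2) basic_open_def using comap_prime by auto
  moreover have "h ` E \<subseteq> carrier B" using E(1) h_closed by blast
  ultimately show ?thesis unfolding openin_zariski[OF B.cring_axioms] by blast
qed

lemma localization_map_fraction:
  assumes "primeideal q B" "a \<in> carrier A" "s \<in> carrier A" "s \<notin> comap A h q"
  shows "localization_map B q h (fraction A (comap A h q) a s) = fraction B q (h a) (h s)"
  using prime_comap.localization_map_fraction[OF comap_locale[OF assms(1)]] assms by simp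

lemma localization_map_hom:
  "primeideal q B \<Longrightarrow> localization_map B q h \<in> ring_hom (localization A (comap A h q)) (localization B q)"
  by (rule prime_comap.localization_map_hom[OF comap_locale])

lemma pullback_section:
  assumes V: "openin (zariski A) V" and \<sigma>: "\<sigma> \<in> carrier (sections (Spec A) V)"
  shows "pullback f V \<sigma> \<in> carrier (sections (Spec B) (preimage (Spec B) f V))"
  unfolding Spec_section
proof (intro conjI ballI)
  show "pullback f V \<sigma> \<in> extensional (preimage (Spec B) f V)" by (simp add: pullback_eq)
  fix q assume q: "q \<in> preimage (Spec B) f V"
  then have qp: "primeideal q B" "comap A h q \<in> V" by (auto simp: preimage_eq)
  show "pullback f V \<sigma> q \<in> carrier (localization B q)"
    using q ring_hom_closed[OF localization_map_hom[OF qp(1)] section_closed[OF \<sigma> qp(2)]]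
    by (simp add: pullback_eq)
  obtain W a s where W: "openin (zariski A) W" "comap A h q \<in> W" "W \<subseteq> V" "a \<in> carrier A" "s \<in> carrier A"
    "\<And>q. q \<in> W \<Longrightarrow> s \<notin> q" "\<And>q. q \<in> W \<Longrightarrow> \<sigma> q = fraction A q a s"
    using section_local[OF \<sigma> qp(2)] by blast
  \<comment> \<open>Near the image of \<open>q\<close> the section is a/s on \<open>W\<close>; on
    the preimage of \<open>W\<close> its pullback is h(a)/h(s).\<close>
  let ?W = "preimage (Spec B) f W"
  have "?W \<subseteq> preimage (Spec B) f V" using W(3) by (auto simp: preimage_eq)
  moreover have "h s \<notin> q' \<and> pullback f V \<sigma> q' = fraction B q' (h a) (h s)" if q': "q' \<in> ?W" for q'
  proof -
    have p: "primeideal q' B" "comap A h q' \<in> W" using q' by (auto simp: preimage_eq)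
    then have ns: "s \<notin> comap A h q'" using W(6) by blast
    then have "h s \<notin> q'" using W(5) by (simp add: comap_def)
    moreover have "q' \<in> preimage (Spec B) f V" using q' \<open>?W \<subseteq> preimage (Spec B) f V\<close> by blast
    ultimately show ?thesis
      using localization_map_fraction[OF p(1) W(4,5) ns] W(7)[OF p(2)] by (simp add: pullback_eq)
  qed
  moreover have "q \<in> ?W" using qp W(2) by (simp add: preimage_eq)
  ultimately show "\<exists>W a s. openin (zariski B) W \<and> q \<in> W \<and> W \<subseteq> preimage (Spec B) f V \<and> a \<in> carrier B \<and>
      s \<in> carrier B \<and> (\<forall>q\<in>W. s \<notin> q \<and> pullback f V \<sigma> q = fraction B q a s)"
    using preimage_open[OF W(1)] h_closed[OF W(4)] h_closed[OF W(5)]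
    by (intro exI[of _ ?W] exI[of _ "h a"] exI[of _ "h s"]) simp
qed

lemma pullback_hom:
  assumes V: "openin (zariski A) V"
  shows "pullback f V \<in> ring_hom (sections (Spec A) V) (sections (Spec B) (preimage (Spec B) f V))"
proof (rule ring_hom_memI)
  fix \<sigma> \<tau> assume *: "\<sigma> \<in> carrier (sections (Spec A) V)" "\<tau> \<in> carrier (sections (Spec A) V)"
  have lm: "primeideal q B" "comap A h q \<in> V"
    "\<sigma> (comap A h q) \<in> carrier (localization A (comap A h q))"
    "\<tau> (comap A h q) \<in> carrier (localization A (comap A h q))"
    if "q \<in> preimage (Spec B) f V" for q
    using that section_closed[OF *(1)] section_closed[OF *(2)] by (simp_all add: preimage_eq)
  show "pullback f V (\<sigma> \<otimes>\<^bsub>sections (Spec A) V\<^esub> \<tau>) =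
      pullback f V \<sigma> \<otimes>\<^bsub>sections (Spec B) (preimage (Spec B) f V)\<^esub> pullback f V \<tau>"
    unfolding pullback_eq Spec_sections_mult
    by (rule restrict_ext) (simp add: lm ring_hom_mult[OF localization_map_hom[OF lm(1)]])
  show "pullback f V (\<sigma> \<oplus>\<^bsub>sections (Spec A) V\<^esub> \<tau>) =
      pullback f V \<sigma> \<oplus>\<^bsub>sections (Spec B) (preimage (Spec B) f V)\<^esub> pullback f V \<tau>"
    unfolding pullback_eq Spec_sections_add
    by (rule restrict_ext) (simp add: lm ring_hom_add[OF localization_map_hom[OF lm(1)]])
next
  show "pullback f V \<one>\<^bsub>sections (Spec A) V\<^esub> = \<one>\<^bsub>sections (Spec B) (preimage (Spec B) f V)\<^esub>"
    unfolding pullback_eq Spec_sections_one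
    by (rule restrict_ext) (simp add: preimage_eq ring_hom_one[OF localization_map_hom])
qed (rule pullback_section[OF V])

lemma stalk_map_germ:
  assumes V: "openin (zariski A) V" "comap A h q \<in> V" "\<sigma> \<in> carrier (sections (Spec A) V)"
    and q: "primeideal q B"
  shows "stalk_map (Spec B) f q (germ (Spec A) (comap A h q) V \<sigma>)
    = germ (Spec B) q (preimage (Spec B) f V) (pullback f V \<sigma>)"
  unfolding stalk_map_def
proof (rule UN_constant)
  show "germ (Spec A) (comap A h q) V \<sigma> \<noteq> {}" using germ_self[OF V] by blast
  fix V' \<sigma>' assume "(V', \<sigma>') \<in> germ (Spec A) (comap A h q) V \<sigma>"
  then obtain N where N: "openin (zariski A) N" "comap A h q \<in> N" "N \<subseteq> V \<inter> V'" "\<forall>p\<in>N. \<sigma> p = \<sigma>' p"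
    unfolding germ_mem by blast
  show "germ (Spec B) q (preimage (Spec B) f V') (pullback f V' \<sigma>')
      = germ (Spec B) q (preimage (Spec B) f V) (pullback f V \<sigma>)"
  proof (rule germ_eqI)
    show "openin (zariski B) (preimage (Spec B) f N)" by (rule preimage_open[OF N(1)])
    show "q \<in> preimage (Spec B) f N" using q N(2) by (simp add: preimage_eq)
    show sub: "preimage (Spec B) f N \<subseteq> preimage (Spec B) f V' \<inter> preimage (Spec B) f V"
      using N(3) by (auto simp: preimage_eq)
    fix q' assume q': "q' \<in> preimage (Spec B) f N"
    then have "\<sigma> (comap A h q') = \<sigma>' (comap A h q')" using N(4) by (simp add: preimage_eq)
    then show "pullback f V' \<sigma>' q' = pullback f V \<sigma> q'" using q' sub by (simp add: pullback_eq subset_iff)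
  qed
qed

text \<open>Where the numerator does not vanish, the inverted fraction s/a is a section and an
  inverse. This is the geometric half of locality, complementing
  \<open>fraction_unit\<close>.\<close>

lemma unit_germ:
  assumes V: "openin (zariski A) V" "p \<in> V" "\<sigma> \<in> carrier (sections (Spec A) V)"
    and a: "a \<in> carrier A" "a \<notin> p" and s: "s \<in> carrier A"
    and W: "openin (zariski A) W" "p \<in> W" "W \<subseteq> V" "\<And>q. q \<in> W \<Longrightarrow> s \<notin> q" "\<And>q. q \<in> W \<Longrightarrow> \<sigma> q = fraction A q a s"
  shows "germ (Spec A) p V \<sigma> \<in> Units (stalk (Spec A) p)"
proof -
  let ?M = "W \<inter> basic_open A {a}"
  let ?\<tau> = "\<lambda>q\<in>?M. fraction A q s a"
  have "openin (zariski A) (basic_open A {a})" unfolding openin_zariski[OF A.cring_axioms] using a by blast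
  then have M: "openin (zariski A) ?M" using W(1) by (intro openin_Int)
  have Mp: "primeideal q A" "a \<notin> q" "s \<notin> q" "q \<in> V" if "q \<in> ?M" for q
    using that W(3,4) by (auto simp: basic_open_def)
  have pM: "p \<in> ?M" using W(2) a open_prime[OF A.cring_axioms V(1,2)] by (simp add: basic_open_def)
  have \<tau>: "?\<tau> \<in> carrier (sections (Spec A) ?M)"
    using Mp by (intro fraction_section[OF A.cring_axioms M s a(1)]) blast
  have unit: "\<sigma> q \<otimes>\<^bsub>localization A q\<^esub> ?\<tau> q = \<one>\<^bsub>localization A q\<^esub>"
    "?\<tau> q \<otimes>\<^bsub>localization A q\<^esub> \<sigma> q = \<one>\<^bsub>localization A q\<^esub>" if q: "q \<in> ?M" for q
  proof -
    interpret q: primeideal q A by (rule Mp(1)[OF q])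
    have d: "a \<in> q.denom" "s \<in> q.denom" using a s Mp[OF q] by auto
    have "fraction A q (a \<otimes> s) (s \<otimes> a) = fraction A q \<one> \<one>"
      using a s d q.denom_closed[OF d(2,1)] q.one_denom by (intro q.fraction_eqI) (simp_all add: A.m_comm)
    then show "\<sigma> q \<otimes>\<^bsub>localization A q\<^esub> ?\<tau> q = \<one>\<^bsub>localization A q\<^esub>"
      "?\<tau> q \<otimes>\<^bsub>localization A q\<^esub> \<sigma> q = \<one>\<^bsub>localization A q\<^esub>"
      using q W(5)[of q] a s d by (simp_all add: q.localization_mult q.localization_one A.m_comm)
  qed
  have top: "?M \<subseteq> topspace (zariski A)" using M by (rule openin_subset)
  have germ_one: "germ (Spec A) p Y (\<lambda>q\<in>Y. \<rho> q) = \<one>\<^bsub>stalk (Spec A) p\<^esub>"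
    if "?M \<subseteq> Y" "\<And>q. q \<in> ?M \<Longrightarrow> \<rho> q = \<one>\<^bsub>localization A q\<^esub>" for Y \<rho>
    unfolding stalk_one
  proof (rule germ_eqI[OF M pM])
    show "?M \<subseteq> Y \<inter> topspace (zariski A)" using that(1) top by blast
    fix q assume q: "q \<in> ?M"
    then have "q \<in> Y" "q \<in> topspace (zariski A)" using that(1) top by blast+
    then show "(\<lambda>q\<in>Y. \<rho> q) q = (\<lambda>p\<in>topspace (zariski A). \<one>\<^bsub>localization A p\<^esub>) q"
      using that(2)[OF q] by simp
  qed
  have MV: "?M \<subseteq> V \<inter> ?M" "?M \<subseteq> ?M \<inter> V" using Mp(4) by blast+
  have "germ (Spec A) p V \<sigma> \<otimes>\<^bsub>stalk (Spec A) p\<^esub> germ (Spec A) p ?M ?\<tau> = \<one>\<^bsub>stalk (Spec A) p\<^esub>"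
    unfolding stalk_mult[OF V M pM \<tau>] by (rule germ_one[OF MV(1) unit(1)])
  moreover have "germ (Spec A) p ?M ?\<tau> \<otimes>\<^bsub>stalk (Spec A) p\<^esub> germ (Spec A) p V \<sigma> = \<one>\<^bsub>stalk (Spec A) p\<^esub>"
    unfolding stalk_mult[OF M pM \<tau> V] by (rule germ_one[OF MV(2) unit(2)])
  moreover have "germ (Spec A) p V \<sigma> \<in> carrier (stalk (Spec A) p)"
    "germ (Spec A) p ?M ?\<tau> \<in> carrier (stalk (Spec A) p)"
    unfolding stalk_carrier using V M pM \<tau> by blast+
  ultimately show ?thesis unfolding Units_def by blast
qed

text \<open>If the image germ has an inverse, evaluating the product at \<open>q\<close> shows that
  h(a)/h(s) is a unit of the local ring at \<open>q\<close>. So h(a) is outside \<open>q\<close>, a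
  is outside its preimage, and the original germ is a unit by \<open>unit_germ\<close>.\<close>

lemma stalk_map_local:
  assumes q: "primeideal q B" and x: "x \<in> carrier (stalk (Spec A) (comap A h q))"
  shows "stalk_map (Spec B) f q x \<in> carrier (stalk (Spec B) q)"
    and "stalk_map (Spec B) f q x \<in> Units (stalk (Spec B) q) \<Longrightarrow> x \<in> Units (stalk (Spec A) (comap A h q))"
proof -
  let ?p = "comap A h q"
  obtain V \<sigma> where V: "openin (zariski A) V" "?p \<in> V" "\<sigma> \<in> carrier (sections (Spec A) V)"
    and xg: "x = germ (Spec A) ?p V \<sigma>" using x unfolding stalk_carrier by blast
  let ?V = "preimage (Spec B) f V" and ?\<sigma> = "pullback f V \<sigma>"
  have sm: "stalk_map (Spec B) f q x = germ (Spec B) q ?V ?\<sigma>"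
    unfolding xg by (rule stalk_map_germ[OF V q])
  have qV: "q \<in> ?V" using q V(2) by (simp add: preimage_eq)
  note V' = preimage_open[OF V(1)] qV pullback_section[OF V(1,3)]
  show "stalk_map (Spec B) f q x \<in> carrier (stalk (Spec B) q)"
    unfolding sm stalk_carrier using V' by blast
  assume "stalk_map (Spec B) f q x \<in> Units (stalk (Spec B) q)"
  then obtain y where y: "y \<in> carrier (stalk (Spec B) q)"
      "germ (Spec B) q ?V ?\<sigma> \<otimes>\<^bsub>stalk (Spec B) q\<^esub> y = \<one>\<^bsub>stalk (Spec B) q\<^esub>"
    unfolding sm Units_def by blast
  obtain W \<tau> where W: "openin (zariski B) W" "q \<in> W" "\<tau> \<in> carrier (sections (Spec B) W)"
    and yg: "y = germ (Spec B) q W \<tau>" using y(1) unfolding stalk_carrier by blast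
  let ?\<rho> = "\<lambda>p\<in>?V \<inter> W. ?\<sigma> p \<otimes>\<^bsub>localization B p\<^esub> \<tau> p"
  let ?T = "topspace (zariski B)"
  let ?one = "\<lambda>p\<in>?T. \<one>\<^bsub>localization B p\<^esub>"
  have germ: "germ (Spec B) q (?V \<inter> W) ?\<rho> = germ (Spec B) q ?T ?one"
    using y(2) unfolding yg stalk_mult[OF V' W] stalk_one .
  \<comment> \<open>Germs are sets of pairs. To extract agreement near \<open>q\<close> from the
    equality of two germs, a concrete member is needed; the constant section one over the whole
    space serves as such.\<close>
  have "?one \<in> carrier (sections (Spec B) ?T)"
  proof -
    have "?one = (\<lambda>p\<in>?T. fraction B p \<one>\<^bsub>B\<^esub> \<one>\<^bsub>B\<^esub>)"
      by (rule restrict_ext) (simp add: topspace_zariski[OF B.cring_axioms] primeideal.localization_one)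
    moreover have "\<one>\<^bsub>B\<^esub> \<notin> p" if "p \<in> ?T" for p
      using that primeideal.one_denom[of p B] by (simp add: topspace_zariski[OF B.cring_axioms])
    ultimately show ?thesis
      using fraction_section[OF B.cring_axioms openin_topspace B.one_closed B.one_closed] by simp
  qed
  then have "(?T, ?one) \<in> germ (Spec B) q ?T ?one"
    by (rule germ_self[OF openin_topspace, rotated]) (simp add: topspace_zariski[OF B.cring_axioms] q)
  then have "(?T, ?one) \<in> germ (Spec B) q (?V \<inter> W) ?\<rho>" unfolding germ .
  then obtain N where N: "q \<in> N" "\<forall>p\<in>N. ?\<rho> p = ?one p" unfolding germ_mem by blast
  have "?\<rho> q = ?one q" using N by blast
  then have unit: "?\<sigma> q \<otimes>\<^bsub>localization B q\<^esub> \<tau> q = \<one>\<^bsub>localization B q\<^esub>"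
    using qV W(2) q by (simp add: topspace_zariski[OF B.cring_axioms])
  obtain M a s where M: "openin (zariski A) M" "?p \<in> M" "M \<subseteq> V" "a \<in> carrier A" "s \<in> carrier A"
    "\<And>q. q \<in> M \<Longrightarrow> s \<notin> q" "\<And>q. q \<in> M \<Longrightarrow> \<sigma> q = fraction A q a s"
    using section_local[OF V(3,2)] by blast
  have val: "\<sigma> ?p = fraction A ?p a s" and ns: "s \<notin> ?p" using M(2,6,7) by blast+
  have "?\<sigma> q = fraction B q (h a) (h s)"
    using qV localization_map_fraction[OF q M(4,5) ns] val by (simp add: pullback_eq)
  moreover have "h s \<in> carrier B - q" using ns M(5) h_closed[OF M(5)] by (simp add: comap_def)
  ultimately have "h a \<notin> q"
    using primeideal.fraction_unit[OF q h_closed[OF M(4)] _ section_closed[OF W(3,2)]] unit by simp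
  then have "a \<notin> ?p" by (simp add: comap_def)
  then show "x \<in> Units (stalk (Spec A) ?p)"
    unfolding xg by (rule unit_germ[OF V M(4) _ M(5,1,2,3,6,7)])
qed

theorem morphism_Spec_map: "morphism (Spec B) (Spec A) f"
  unfolding morphism_def
proof (intro conjI allI impI ballI)
  have "preimage (Spec B) f V = {x \<in> topspace (zariski B). point_map f x \<in> V}" for V
    by (simp add: preimage_def)
  then show "continuous_map (rs_topology (Spec B)) (rs_topology (Spec A)) (point_map f)"
    using preimage_open comap_prime
    by (simp add: continuous_map_def topspace_zariski[OF A.cring_axioms] topspace_zariski[OF B.cring_axioms] point_map_eq)
  fix V assume V: "openin (rs_topology (Spec A)) V"
  show "pullback f V \<in> ring_hom (sections (Spec A) V) (sections (Spec B) (preimage (Spec B) f V))"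
    using V by (intro pullback_hom) simp
  fix W s assume "W \<subseteq> V"
  then have "preimage (Spec B) f W \<subseteq> preimage (Spec B) f V" by (auto simp: preimage_eq)
  moreover have "comap A h q \<in> W" if "q \<in> preimage (Spec B) f W" for q using that by (simp add: preimage_eq)
  ultimately show "restr (Spec B) (preimage (Spec B) f V) (preimage (Spec B) f W) (pullback f V s)
      = pullback f W (restr (Spec A) V W s)"
    by (simp add: pullback_eq Int_absorb1 restrict_restrict) (rule restrict_ext, simp)
next
  fix q assume "q \<in> topspace (rs_topology (Spec B))"
  then have q: "primeideal q B" by (simp add: topspace_zariski[OF B.cring_axioms])
  show "stalk_map (Spec B) f q ` (carrier (stalk (Spec A) (point_map f q)) - Units (stalk (Spec A) (point_map f q)))
    \<subseteq> carrier (stalk (Spec B) q) - Units (stalk (Spec B) q)"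
    unfolding point_map_eq using stalk_map_local[OF q] by blast
qed

end

section \<open>Equality and composition of morphisms\<close>

lemma morphism_eq_sym: "morphism_eq S T f g \<Longrightarrow> morphism_eq S T g f"
  by (simp add: morphism_eq_def)

lemma morphism_eq_trans: "morphism_eq S T f g \<Longrightarrow> morphism_eq S T g h \<Longrightarrow> morphism_eq S T f h"
  by (simp add: morphism_eq_def)

lemma preimage_cong: "morphism_eq S T f g \<Longrightarrow> preimage S f V = preimage S g V"
  unfolding preimage_def by (rule Collect_cong) (auto simp: morphism_eq_def)

lemma morphism_continuous: "morphism S T f \<Longrightarrow> continuous_map (rs_topology S) (rs_topology T) (point_map f)"
  unfolding morphism_def by (elim conjE)

lemma morphism_point:
  "morphism S T f \<Longrightarrow> x \<in> topspace (rs_topology S) \<Longrightarrow> point_map f x \<in> topspace (rs_topology T)"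
  using continuous_map_funspace[OF morphism_continuous] by (rule funcset_mem)

lemma morphism_preimage_open:
  "morphism S T f \<Longrightarrow> openin (rs_topology T) V \<Longrightarrow> openin (rs_topology S) (preimage S f V)"
  unfolding preimage_def by (rule openin_continuous_map_preimage[OF morphism_continuous])

lemma morphism_pullback_hom:
  "morphism S T f \<Longrightarrow> openin (rs_topology T) V \<Longrightarrow>
    pullback f V \<in> ring_hom (sections T V) (sections S (preimage S f V))"
  unfolding morphism_def by (elim conjE) simp

lemma morphism_restr:
  "morphism S T f \<Longrightarrow> openin (rs_topology T) V \<Longrightarrow> openin (rs_topology T) W \<Longrightarrow> W \<subseteq> V \<Longrightarrow>
    s \<in> carrier (sections T V) \<Longrightarrow>
    restr S (preimage S f V) (preimage S f W) (pullback f V s) = pullback f W (restr T V W s)"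
  unfolding morphism_def by (elim conjE) simp

lemma preimage_comp:
  assumes "morphism S T f"
  shows "preimage S (comp_morphism T g f) V = preimage S f (preimage T g V)"
  using morphism_point[OF assms] unfolding preimage_def comp_morphism_def by auto

lemma comp_morphism_cong_left:
  assumes f: "morphism S T f" and eq: "morphism_eq T Z g g'"
  shows "morphism_eq S Z (comp_morphism T g f) (comp_morphism T g' f)"
  using morphism_point[OF f] eq preimage_cong[OF eq]
  unfolding morphism_eq_def comp_morphism_def by simp

lemma comp_morphism_cong_right:
  assumes g: "morphism T Z g" and eq: "morphism_eq S T f f'"
  shows "morphism_eq S Z (comp_morphism T g f) (comp_morphism T g f')"
  using eq morphism_preimage_open[OF g] ring_hom_closed[OF morphism_pullback_hom[OF g]]
  unfolding morphism_eq_def comp_morphism_def by simp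

lemma stalk_map_cong:
  assumes eq: "morphism_eq S T f g" and x: "A \<in> carrier (stalk T y)"
  shows "stalk_map S f x A = stalk_map S g x A"
proof -
  obtain V0 s0 where A: "A = germ T y V0 s0" using x by (auto simp: stalk_def)
  have "germ S x (preimage S f V) (pullback f V s) = germ S x (preimage S g V) (pullback g V s)"
    if "(V, s) \<in> A" for V s
  proof -
    have "openin (rs_topology T) V" "s \<in> carrier (sections T V)" using that by (auto simp: A germ_def)
    then have "pullback f V s = pullback g V s" using eq by (simp add: morphism_eq_def)
    then show ?thesis by (simp add: preimage_cong[OF eq])
  qed
  then show ?thesis unfolding stalk_map_def by (intro SUP_cong) auto
qed

text \<open>
  The stalk condition for a composite is inherited from any morphism that the composite
  agrees with.
\<close>

lemma morphism_comp:
  assumes f: "morphism S T f" and g: "morphism T Z g" and h: "morphism S Z h"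
    and eq: "morphism_eq S Z h (comp_morphism T g f)"
  shows "morphism S Z (comp_morphism T g f)"
  unfolding morphism_def
proof (intro conjI allI impI ballI)
  let ?c = "comp_morphism T g f"
  have pb: "pullback ?c V = (\<lambda>s. pullback f (preimage T g V) (pullback g V s))" for V
    by (simp add: comp_morphism_def)
  have pm: "point_map h x = point_map ?c x" if "x \<in> topspace (rs_topology S)" for x
    using eq that by (simp add: morphism_eq_def)
  have "continuous_map (rs_topology S) (rs_topology Z) (point_map h)"
    using h by (simp add: morphism_def)
  then show "continuous_map (rs_topology S) (rs_topology Z) (point_map ?c)"
    by (rule continuous_map_eq[OF _ pm])
  fix V assume V: "openin (rs_topology Z) V"
  note V' = morphism_preimage_open[OF g V]
  show "pullback ?c V \<in> ring_hom (sections Z V) (sections S (preimage S ?c V))"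
    unfolding preimage_comp[OF f] pb
    using ring_hom_trans[OF morphism_pullback_hom[OF g V] morphism_pullback_hom[OF f V']] by (simp add: comp_def)
  fix W s assume W: "openin (rs_topology Z) W" "W \<subseteq> V" and s: "s \<in> carrier (sections Z V)"
  have "preimage T g W \<subseteq> preimage T g V" using W(2) by (auto simp: preimage_def)
  then show "restr S (preimage S ?c V) (preimage S ?c W) (pullback ?c V s) = pullback ?c W (restr Z V W s)"
    unfolding preimage_comp[OF f] pb
    using morphism_restr[OF f V' morphism_preimage_open[OF g W(1)] _ ring_hom_closed[OF morphism_pullback_hom[OF g V] s]]
      morphism_restr[OF g V W s] by simp
next
  let ?c = "comp_morphism T g f"
  fix x assume x: "x \<in> topspace (rs_topology S)"
  let ?Y = "stalk Z (point_map h x)"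
  have "point_map h x = point_map ?c x" using eq x by (simp add: morphism_eq_def)
  moreover have "stalk_map S h x ` (carrier ?Y - Units ?Y) \<subseteq> carrier (stalk S x) - Units (stalk S x)"
    using h x unfolding morphism_def by blast
  moreover have "stalk_map S h x ` (carrier ?Y - Units ?Y) = stalk_map S ?c x ` (carrier ?Y - Units ?Y)"
    by (intro image_cong refl stalk_map_cong[OF eq]) blast
  ultimately show "stalk_map S ?c x ` (carrier (stalk Z (point_map ?c x)) - Units (stalk Z (point_map ?c x)))
      \<subseteq> carrier (stalk S x) - Units (stalk S x)" by simp
qed

section \<open>Functoriality of Spec\<close>

lemma morphism_Spec_map: "cring A \<Longrightarrow> cring B \<Longrightarrow> h \<in> ring_hom A B \<Longrightarrow> morphism (Spec B) (Spec A) (Spec_map A B h)"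
  using spec_hom.morphism_Spec_map[of A B h] by (simp add: spec_hom_def spec_hom_axioms_def)

text \<open>The map \<open>g\<close> is asked to agree with the composite on the carrier only, so
  one lemma covers composition as well as replacement of a ring map by another with the same values.
  On sections the claim is checked on a fraction representing the value at each point.\<close>

lemma Spec_map_comp:
  assumes A: "cring A" and B: "cring B" and C: "cring C"
    and f: "f \<in> ring_hom A B" and h: "h \<in> ring_hom B C" and g: "\<And>a. a \<in> carrier A \<Longrightarrow> h (f a) = g a"
  shows "morphism_eq (Spec C) (Spec A) (comp_morphism (Spec B) (Spec_map A B f) (Spec_map B C h)) (Spec_map A C g)"
proof -
  interpret f: spec_hom A B f using A B f by (simp add: spec_hom_def spec_hom_axioms_def)
  interpret h: spec_hom B C h using B C h by (simp add: spec_hom_def spec_hom_axioms_def)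
  have "g \<in> ring_hom A C"
    using ring.ring_hom_restrict[OF _ ring_hom_trans[OF f h], of g] A g by (simp add: cring_def)
  then interpret g: spec_hom A C g using A C by (simp add: spec_hom_def spec_hom_axioms_def)
  have point: "comap A f (comap B h q) = comap A g q" for q
  proof (intro equalityI subsetI)
    show "a \<in> comap A g q" if "a \<in> comap A f (comap B h q)" for a
      using that g[of a] by (simp add: comap_def)
    show "a \<in> comap A f (comap B h q)" if "a \<in> comap A g q" for a
      using that g[of a] f.h_closed[of a] by (simp add: comap_def)
  qed
  show ?thesis
    unfolding morphism_eq_def
  proof (intro conjI ballI allI impI)
    fix q
    show "point_map (comp_morphism (Spec B) (Spec_map A B f) (Spec_map B C h)) q = point_map (Spec_map A C g) q"
      by (simp add: comp_morphism_def f.point_map_eq h.point_map_eq g.point_map_eq point)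
  next
    fix V s assume "openin (rs_topology (Spec A)) V" and s: "s \<in> carrier (sections (Spec A) V)"
    have dom: "preimage (Spec C) (Spec_map B C h) (preimage (Spec B) (Spec_map A B f) V)
        = preimage (Spec C) (Spec_map A C g) V"
      unfolding f.preimage_eq h.preimage_eq g.preimage_eq point[symmetric] using h.comap_prime by blast
    have "localization_map C q h (localization_map B (comap B h q) f (s (comap A g q)))
        = localization_map C q g (s (comap A g q))" if q: "q \<in> preimage (Spec C) (Spec_map A C g) V" for q
    proof -
      have qp: "primeideal q C" "comap A g q \<in> V" using q by (auto simp: g.preimage_eq)
      obtain a t where at': "a \<in> carrier A" "t \<in> carrier A" "t \<in> carrier A - comap A g q"
          "s (comap A g q) = fraction A (comap A g q) a t"
        by (rule primeideal.localizationE[OF g.comap_prime[OF qp(1)] section_closed[OF s qp(2)]])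
      then have at: "a \<in> carrier A" "t \<in> carrier A" "t \<notin> comap A g q"
          "s (comap A g q) = fraction A (comap A g q) a t" by simp_all
      have "t \<notin> comap A f (comap B h q)" using at(3) by (simp add: point)
      then have "f t \<notin> comap B h q" using at(2) by (simp add: comap_def)
      then show ?thesis
        using f.localization_map_fraction[OF h.comap_prime[OF qp(1)] at(1,2)]
          h.localization_map_fraction[OF qp(1) f.h_closed[OF at(1)] f.h_closed[OF at(2)]]
          g.localization_map_fraction[OF qp(1) at(1-3)] at(3,4) g[OF at(1)] g[OF at(2)]
        by (simp add: point)
    qed
    moreover have "comap B h q \<in> preimage (Spec B) (Spec_map A B f) V"
      if "q \<in> preimage (Spec C) (Spec_map A C g) V" for q
      using that unfolding dom[symmetric] h.preimage_eq by blast
    ultimately show "pullback (comp_morphism (Spec B) (Spec_map A B f) (Spec_map B C h)) V s = pullback (Spec_map A C g) V s"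
      unfolding comp_morphism_def
      by (simp add: f.pullback_eq h.pullback_eq g.pullback_eq dom) (rule restrict_ext, simp add: point)
  qed
qed

text \<open>Pullback along \<open>Spec_map\<close> passes through \<open>localization_map\<close>
  and a restriction, so it is not literally the identity. On \<open>V\<close> each value is a
  fraction and is returned unchanged; off \<open>V\<close> both sides are \<open>undefined\<close>,
  as sections are extensional.\<close>

lemma Spec_map_id:
  assumes R: "cring R" and g: "\<And>a. a \<in> carrier R \<Longrightarrow> g a = a"
  shows "morphism_eq (Spec R) (Spec R) (Spec_map R R g) id_morphism"
proof -
  have "g \<in> ring_hom R R"
    using ring.ring_hom_restrict[OF _ id_ring_hom, of R g] R g by (simp add: cring_def)
  then interpret spec_hom R R g using R by (simp add: spec_hom_def spec_hom_axioms_def)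
  have point: "comap R g p = p" if "primeideal p R" for p
  proof -
    have "p \<subseteq> carrier R" using that by (meson ideal.Icarr primeideal_def subsetI)
    then have "a \<in> carrier R \<and> g a \<in> p \<longleftrightarrow> a \<in> p" for a using g[of a] by (cases "a \<in> carrier R") auto
    then show ?thesis unfolding comap_def by simp
  qed
  show ?thesis
    unfolding morphism_eq_def
  proof (intro conjI ballI allI impI)
    fix p assume "p \<in> topspace (rs_topology (Spec R))"
    then show "point_map (Spec_map R R g) p = point_map id_morphism p"
      by (simp add: point_map_eq id_morphism_def topspace_zariski[OF R] point)
  next
    fix V s assume V: "openin (rs_topology (Spec R)) V" and s: "s \<in> carrier (sections (Spec R) V)"
    have Vp: "primeideal p R" if "p \<in> V" for p using open_prime[OF R _ that] V by simp
    have dom: "preimage (Spec R) (Spec_map R R g) V = V"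
      unfolding preimage_eq using point Vp by auto
    show "pullback (Spec_map R R g) V s = pullback id_morphism V s"
    proof
      fix p
      show "pullback (Spec_map R R g) V s p = pullback id_morphism V s p"
      proof (cases "p \<in> V")
        case True
        obtain a t where "a \<in> carrier R" "t \<in> carrier R" "t \<in> carrier R - p" "s p = fraction R p a t"
          by (rule primeideal.localizationE[OF Vp[OF True] section_closed[OF s True]])
        then have at: "a \<in> carrier R" "t \<in> carrier R" "t \<notin> p" "s p = fraction R p a t" by simp_all
        note pt = point[OF Vp[OF True]]
        have "localization_map R p g (s p) = s p"
          using localization_map_fraction[OF Vp[OF True] at(1,2), unfolded pt, OF at(3)]
          unfolding at(4) g[OF at(1)] g[OF at(2)] .
        moreover have "pullback (Spec_map R R g) V s p = localization_map R p g (s (comap R g p))"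
          using True by (simp only: pullback_eq dom restrict_apply if_True)
        ultimately have "pullback (Spec_map R R g) V s p = s p" unfolding pt by (rule trans[rotated])
        also have "s p = pullback id_morphism V s p" unfolding id_morphism_def rs_map.simps ..
        finally show ?thesis .
      next
        case False
        then have "pullback (Spec_map R R g) V s p = undefined"
          by (simp only: pullback_eq dom restrict_apply if_False)
        also have "undefined = pullback id_morphism V s p"
          unfolding id_morphism_def rs_map.simps
          by (rule extensional_arb[OF section_extensional[OF s] False, symmetric])
        finally show ?thesis .
      qed
    qed
  qed
qed

section \<open>Polynomial rings, change of coefficients and evaluation\<close>

lemma up_map_hom:
  assumes R: "cring R" and S: "cring S" and h: "h \<in> ring_hom R S"
  shows "up_map h \<in> ring_hom (UP R) (UP S)"
proof -
  interpret h: ring_hom_cring R S h by (rule ring_hom_cringI[OF R S h])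
  have UP_carrier: "carrier (UP R) = up R" "carrier (UP S) = up S" by (simp_all add: UP_def)
  have closed: "up_map h f \<in> carrier (UP S)" if "f \<in> carrier (UP R)" for f
  proof -
    have f: "f \<in> up R" using that by (simp only: UP_carrier)
    then obtain k where k: "bound \<zero>\<^bsub>R\<^esub> k f" unfolding up_def by blast
    have "bound \<zero>\<^bsub>S\<^esub> k (up_map h f)"
    proof
      fix m assume "k < m"
      with k have "f m = \<zero>\<^bsub>R\<^esub>" by (rule bound.bound)
      then show "up_map h f m = \<zero>\<^bsub>S\<^esub>" by (simp add: up_map_def)
    qed
    moreover have "up_map h f i \<in> carrier S" for i
      unfolding up_map_def by (rule h.hom_closed[OF mem_upD[OF f]])
    ultimately show ?thesis unfolding UP_carrier by (intro mem_upI exI[of _ k])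
  qed
  show ?thesis
  proof (rule ring_hom_memI)
    fix f g assume fg: "f \<in> carrier (UP R)" "g \<in> carrier (UP R)"
    then have c: "f i \<in> carrier R" "g i \<in> carrier R" for i
      unfolding UP_carrier by (simp_all add: mem_upD)
    have up: "f \<in> up R" "g \<in> up R" "up_map h f \<in> up S" "up_map h g \<in> up S"
      using fg closed[OF fg(1)] closed[OF fg(2)] by (simp_all only: UP_carrier)
    have "h (\<Oplus>\<^bsub>R\<^esub>i\<in>{..k}. f i \<otimes>\<^bsub>R\<^esub> g (k - i)) = (\<Oplus>\<^bsub>S\<^esub>i\<in>{..k}. h (f i) \<otimes>\<^bsub>S\<^esub> h (g (k - i)))" for k
      using c by (subst h.hom_finsum) (auto intro!: h.S.finsum_cong')
    then show "up_map h (f \<otimes>\<^bsub>UP R\<^esub> g) = up_map h f \<otimes>\<^bsub>UP S\<^esub> up_map h g"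
      using up by (simp add: UP_def up_map_def fun_eq_iff)
    show "up_map h (f \<oplus>\<^bsub>UP R\<^esub> g) = up_map h f \<oplus>\<^bsub>UP S\<^esub> up_map h g"
      using up c by (simp add: UP_def up_map_def fun_eq_iff)
  next
    show "up_map h \<one>\<^bsub>UP R\<^esub> = \<one>\<^bsub>UP S\<^esub>" by (simp add: UP_def up_map_def fun_eq_iff)
  qed (rule closed)
qed

text \<open>Both sides are homomorphisms from R[t] to \<open>S\<close> that agree with
  \<open>h\<close> on constants and send t to \<open>h s\<close>; by the universal property of R[t]
  they coincide.\<close>

lemma eval_up_map:
  assumes R: "cring R" and S: "cring S" and h: "h \<in> ring_hom R S"
    and s: "s \<in> carrier R" and f: "f \<in> carrier (UP R)"
  shows "eval S S id (h s) (up_map h f) = h (eval R R id s f)"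
proof -
  interpret E: UP_pre_univ_prop R S h "UP R" by (rule UP_pre_univ_propI[OF R S h])
  interpret ER: UP_pre_univ_prop R R id "UP R" using UP_pre_univ_propI[OF R R] by simp
  interpret ES: UP_pre_univ_prop S S id "UP S" using UP_pre_univ_propI[OF S S] by simp
  have hs: "h s \<in> carrier S" using s by simp
  have monom: "up_map h (up_ring.monom (UP R) a k) = up_ring.monom (UP S) (h a) k" if "a \<in> carrier R" for a k
    using that by (simp add: up_map_def UP_def fun_eq_iff)
  show ?thesis
  proof (rule E.UP_hom_unique[OF _ _ _ _ _ _ f hs])
    show "ring_hom_cring (UP R) S (\<lambda>f. UnivPoly.eval S S id (h s) (up_map h f))"
      using ring_hom_trans[OF up_map_hom[OF R S h] ES.eval_ring_hom[OF hs]]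
      by (intro E.ring_homD) (simp add: comp_def)
    show "ring_hom_cring (UP R) S (\<lambda>f. h (UnivPoly.eval R R id s f))"
      using ring_hom_trans[OF ER.eval_ring_hom[OF s] h] by (intro E.ring_homD) (simp add: comp_def)
    show "UnivPoly.eval S S id (h s) (up_map h (up_ring.monom (UP R) \<one>\<^bsub>R\<^esub> (Suc 0))) = h s"
      unfolding monom[OF E.R.one_closed] E.hom_one using ES.eval_monom1[OF hs] unfolding One_nat_def .
    show "h (UnivPoly.eval R R id s (up_ring.monom (UP R) \<one>\<^bsub>R\<^esub> (Suc 0))) = h s"
      using ER.eval_monom1[OF s] unfolding One_nat_def by (rule arg_cong)
    fix a assume a: "a \<in> carrier R"
    show "UnivPoly.eval S S id (h s) (up_map h (up_ring.monom (UP R) a 0)) = h a"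
      unfolding monom[OF a] ES.eval_const[OF hs E.hom_closed[OF a]] by simp
    show "h (UnivPoly.eval R R id s (up_ring.monom (UP R) a 0)) = h a"
      unfolding ER.eval_const[OF s a] by simp
  qed
qed


section \<open>The curves and connectedness\<close>

lemma spec_homI: "cring A \<Longrightarrow> cring B \<Longrightarrow> h \<in> ring_hom A B \<Longrightarrow> spec_hom A B h"
  by (simp add: spec_hom_def spec_hom_axioms_def)

lemma zariski_generization:
  assumes "cring R" "openin (zariski R) V" "q \<in> V" "primeideal q' R" "q' \<subseteq> q"
  shows "q' \<in> V"
proof -
  obtain E where "V = basic_open R E" using assms(2) openin_zariski[OF assms(1)] by blast
  then show ?thesis using assms(3-5) unfolding basic_open_def by blast
qed

lemma cring_UP: "cring R \<Longrightarrow> cring (UP R)"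
  by (rule UP_cring.UP_cring) (simp add: UP_cring_def)

lemma eval_hom: "cring R \<Longrightarrow> s \<in> carrier R \<Longrightarrow> eval R R id s \<in> ring_hom (UP R) R"
  by (rule UP_pre_univ_prop.eval_ring_hom[OF UP_pre_univ_propI[OF _ _ id_ring_hom]])

text \<open>The prime ideal $\mathfrak{p}[t]$, the generic point of the line over $\mathfrak{p}$.\<close>

lemma ex_generic_point:
  assumes R: "cring R" and p: "primeideal p R"
  shows "\<exists>Q. primeideal Q (UP R) \<and> (\<forall>s\<in>carrier R. Q \<subseteq> comap (UP R) (eval R R id s) p)"
proof -
  let ?D = "R Quot p"
  let ?\<pi> = "\<lambda>a. p +>\<^bsub>R\<^esub> a"
  have ip: "ideal p R" using p by (simp add: primeideal_def)
  have D: "domain ?D" by (rule primeideal.quotient_is_domain[OF p])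
  then have cD: "cring ?D" by (simp add: domain_def)
  have \<pi>: "?\<pi> \<in> ring_hom R ?D" by (rule ideal.rcos_ring_hom[OF ip])
  have UR: "cring (UP R)" by (rule cring_UP[OF R])
  have UD: "domain (UP ?D)" by (rule UP_domain.UP_domain) (simp add: UP_domain_def D)
  \<comment> \<open>The kernel of coefficientwise reduction from R[t] to (R/p)[t], which is a
    domain.\<close>
  define Q where "Q = {f \<in> carrier (UP R). up_map ?\<pi> f \<in> {\<zero>\<^bsub>UP ?D\<^esub>}}"
  have "primeideal Q (UP R)"
    unfolding Q_def
    by (rule primeideal_preimage[OF UR up_map_hom[OF R cD \<pi>] domain.zeroprimeideal[OF UD]])
  moreover have "Q \<subseteq> comap (UP R) (eval R R id s) p" if s: "s \<in> carrier R" for s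
  proof
    fix f assume "f \<in> Q"
    then have f: "f \<in> carrier (UP R)" "up_map ?\<pi> f = \<zero>\<^bsub>UP ?D\<^esub>" by (auto simp: Q_def)
    interpret E: UP_pre_univ_prop R R id "UP R" using UP_pre_univ_propI[OF R R] by simp
    interpret ED: UP_pre_univ_prop ?D ?D id "UP ?D" using UP_pre_univ_propI[OF cD cD] by simp
    have \<pi>s: "?\<pi> s \<in> carrier ?D" by (rule ring_hom_closed[OF \<pi> s])
    have ev: "eval R R id s f \<in> carrier R" by (rule ring_hom_closed[OF E.eval_ring_hom[OF s] f(1)])
    \<comment> \<open>Evaluation commutes with reduction, so a polynomial that reduces to zero takes
      all its values in \<open>p\<close>.\<close>
    have "?\<pi> (eval R R id s f) = eval ?D ?D id (?\<pi> s) \<zero>\<^bsub>UP ?D\<^esub>"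
      using eval_up_map[OF R cD \<pi> s f(1)] unfolding f(2) ..
    also have "\<dots> = \<zero>\<^bsub>?D\<^esub>"
      by (rule ring_hom_cring.hom_zero[OF ED.ring_homD[OF ED.eval_ring_hom[OF \<pi>s]]])
    finally have "p +>\<^bsub>R\<^esub> eval R R id s f = p" by (simp add: FactRing_def)
    moreover have "abelian_group R" using R by (simp add: cring_def ring_def)
    note abelian_subgroup.a_rcos_self[OF abelian_subgroupI3[OF ideal.axioms(1)[OF ip] this] ev]
    ultimately have "eval R R id s f \<in> p" by simp
    then show "f \<in> comap (UP R) (eval R R id s) p" using f(1) by (simp add: comap_def)
  qed
  ultimately show ?thesis by blast
qed

text \<open>A separation of Spec R pulls back along \<open>\<psi>\<close> to a separation of Spec k.
  Both parts remain nonempty, because passing from a point to its value at t = 0 keeps it in its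
  part, and this value is the image of a point of Spec k.\<close>

lemma connected_Spec:
  assumes R: "cring R" and k: "cring k" and c: "c \<in> ring_hom k R"
    and \<phi>: "\<phi> \<in> ring_hom R (UP R)" and \<psi>: "\<psi> \<in> ring_hom R k"
    and one: "\<And>x. x \<in> carrier R \<Longrightarrow> eval R R id \<one>\<^bsub>R\<^esub> (\<phi> x) = x"
    and zero: "\<And>x. x \<in> carrier R \<Longrightarrow> eval R R id \<zero>\<^bsub>R\<^esub> (\<phi> x) = c (\<psi> x)"
    and conn: "connected_space (zariski k)"
  shows "connected_space (zariski R)"
  unfolding connected_space_def
proof
  assume "\<exists>E1 E2. openin (zariski R) E1 \<and> openin (zariski R) E2 \<and> topspace (zariski R) \<subseteq> E1 \<union> E2 \<and>
      E1 \<inter> E2 = {} \<and> E1 \<noteq> {} \<and> E2 \<noteq> {}"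
  then obtain E1 E2 p1 p2 where E: "openin (zariski R) E1" "openin (zariski R) E2"
    "topspace (zariski R) \<subseteq> E1 \<union> E2" "E1 \<inter> E2 = {}" and p12: "p1 \<in> E1" "p2 \<in> E2" by blast
  have UR: "cring (UP R)" by (rule cring_UP[OF R])
  interpret cR: cring R by (rule R)
  have ev: "eval R R id s \<in> ring_hom (UP R) R" if "s \<in> carrier R" for s
    by (rule eval_hom[OF R that])
  \<comment> \<open>The projection to Spec k followed by the section of the monomial ideal; by
    \<open>at0\<close> it is the value of the deformation at t = 0.\<close>
  let ?s = "\<lambda>p. comap R \<psi> (comap k c p)"
  have \<phi>c: "\<phi> x \<in> carrier (UP R)" if "x \<in> carrier R" for x by (rule ring_hom_closed[OF \<phi> that])
  have \<psi>c: "\<psi> x \<in> carrier k" if "x \<in> carrier R" for x by (rule ring_hom_closed[OF \<psi> that])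
  have at1: "comap R \<phi> (comap (UP R) (eval R R id \<one>\<^bsub>R\<^esub>) p) = p" if "primeideal p R" for p
  proof -
    have "p \<subseteq> carrier R" using that by (meson ideal.Icarr primeideal_def subsetI)
    then have "(x \<in> carrier R \<and> \<phi> x \<in> carrier (UP R) \<and> eval R R id \<one>\<^bsub>R\<^esub> (\<phi> x) \<in> p) \<longleftrightarrow> x \<in> p" for x
      using one[of x] \<phi>c[of x] by (cases "x \<in> carrier R") (auto simp del: id_def)
    then show ?thesis by (simp add: comap_def)
  qed
  have at0: "comap R \<phi> (comap (UP R) (eval R R id \<zero>\<^bsub>R\<^esub>) p) = ?s p" for p
  proof -
    have "(x \<in> carrier R \<and> \<phi> x \<in> carrier (UP R) \<and> eval R R id \<zero>\<^bsub>R\<^esub> (\<phi> x) \<in> p) \<longleftrightarrow>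
        (x \<in> carrier R \<and> \<psi> x \<in> carrier k \<and> c (\<psi> x) \<in> p)" for x
      using zero[of x] \<phi>c[of x] \<psi>c[of x] by (cases "x \<in> carrier R") simp_all
    then show ?thesis by (simp add: comap_def)
  qed
  interpret \<phi>: spec_hom R "UP R" \<phi> by (rule spec_homI[OF R UR \<phi>])
  interpret \<psi>: spec_hom R k \<psi> by (rule spec_homI[OF R k \<psi>])
  interpret c: spec_hom k R c by (rule spec_homI[OF k R c])
  have same: "?s p \<in> E" if EE': "openin (zariski R) E" "openin (zariski R) E'" "E \<inter> E' = {}"
      "topspace (zariski R) \<subseteq> E \<union> E'" and pE: "p \<in> E" for p E E'
  proof (rule ccontr)
    assume "?s p \<notin> E"
    have p: "primeideal p R" by (rule open_prime[OF R EE'(1) pE])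
    have "primeideal (?s p) R" by (rule \<psi>.comap_prime[OF c.comap_prime[OF p]])
    then have "?s p \<in> E'" using \<open>?s p \<notin> E\<close> EE'(4) unfolding topspace_zariski[OF R] by blast
    obtain Q where Q: "primeideal Q (UP R)" "\<And>s. s \<in> carrier R \<Longrightarrow> Q \<subseteq> comap (UP R) (eval R R id s) p"
      using ex_generic_point[OF R p] by blast
    have prime_ev: "primeideal (comap (UP R) (eval R R id s) p) (UP R)" if "s \<in> carrier R" for s
      using spec_hom.comap_prime[OF spec_homI[OF UR R ev[OF that]] p] .
    \<comment> \<open>The preimages of \<open>E\<close> and \<open>E'\<close> under the deformation
      are disjoint open sets. The point at t = 1 lies in the first, the one at t = 0 in the second,
      and \<open>Q\<close> generizes both.\<close>
    have "comap (UP R) (eval R R id \<one>\<^bsub>R\<^esub>) p \<in> preimage (Spec (UP R)) (Spec_map R (UP R) \<phi>) E"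
      unfolding \<phi>.preimage_eq using prime_ev[OF cR.one_closed] at1[OF p] pE by (intro CollectI conjI) (simp_all only:)
    then have 1: "Q \<in> preimage (Spec (UP R)) (Spec_map R (UP R) \<phi>) E"
      by (rule zariski_generization[OF UR \<phi>.preimage_open[OF EE'(1)] _ Q(1) Q(2)[OF cR.one_closed]])
    have "comap (UP R) (eval R R id \<zero>\<^bsub>R\<^esub>) p \<in> preimage (Spec (UP R)) (Spec_map R (UP R) \<phi>) E'"
      unfolding \<phi>.preimage_eq using prime_ev[OF cR.zero_closed] at0[of p] \<open>?s p \<in> E'\<close>
      by (intro CollectI conjI) (simp_all only:)
    then have 2: "Q \<in> preimage (Spec (UP R)) (Spec_map R (UP R) \<phi>) E'"
      by (rule zariski_generization[OF UR \<phi>.preimage_open[OF EE'(2)] _ Q(1) Q(2)[OF cR.zero_closed]])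
    show False using 1 2 EE'(3) unfolding \<phi>.preimage_eq by blast
  qed
  have s1: "?s p1 \<in> E1" by (rule same[OF E(1,2,4,3) p12(1)])
  have "E2 \<inter> E1 = {}" "topspace (zariski R) \<subseteq> E2 \<union> E1"
    using E(3,4) by (simp_all only: Int_commute Un_commute)
  then have s2: "?s p2 \<in> E2" by (rule same[OF E(2,1) _ _ p12(2)])
  let ?W = "\<lambda>E. preimage (Spec k) (Spec_map R k \<psi>) E"
  have "topspace (zariski k) \<subseteq> ?W E1 \<union> ?W E2"
    using E(3) \<psi>.comap_prime unfolding \<psi>.preimage_eq topspace_zariski[OF R] topspace_zariski[OF k] by blast
  moreover have "?W E1 \<inter> ?W E2 = {}" using E(4) unfolding \<psi>.preimage_eq by blast
  moreover have ne: "comap k c p1 \<in> ?W E1" "comap k c p2 \<in> ?W E2"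
    using s1 s2 c.comap_prime[OF open_prime[OF R E(1) p12(1)]] c.comap_prime[OF open_prime[OF R E(2) p12(2)]]
    unfolding \<psi>.preimage_eq by simp_all
  moreover have "?W E1 \<noteq> {}" "?W E2 \<noteq> {}" using ne by (metis empty_iff)+
  ultimately have "\<exists>E1 E2. openin (zariski k) E1 \<and> openin (zariski k) E2 \<and> topspace (zariski k) \<subseteq> E1 \<union> E2 \<and>
      E1 \<inter> E2 = {} \<and> E1 \<noteq> {} \<and> E2 \<noteq> {}"
    using \<psi>.preimage_open[OF E(1)] \<psi>.preimage_open[OF E(2)]
    by (intro exI[of _ "?W E1"] exI[of _ "?W E2"] conjI)
  then show False using conn unfolding connected_space_def by (rule notE[rotated])
qed

theorem proposition5:
  fixes k R :: "'a ring" and c :: "'a \<Rightarrow> 'a" and n d :: nat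
    and r :: "((nat \<Rightarrow> nat) \<times> (nat \<Rightarrow> nat)) set" and \<Delta> :: "(nat \<Rightarrow> nat) set"
    and U :: "((nat \<Rightarrow> nat) \<Rightarrow> 'a) set"
  assumes "infinite (UNIV :: 'a set)"
    and "cring k"
    and "monomial_order n r"
    and "standard_set n \<Delta>" and "finite \<Delta>" and "card \<Delta> = d" and "d \<ge> 1"
    and "represents_Hilb k n r \<Delta> R c U"
  shows "(\<exists>g. morphism (affine_line R) (Spec R) g \<and>
      morphism_eq (affine_line R) (Spec k)
        (comp_morphism (Spec R) (Spec_map k R c) g)
        (Spec_map k (UP R) (\<lambda>a. const_poly R (c a))) \<and>
      morphism_eq (Spec R) (Spec R)
        (comp_morphism (affine_line R) g (at_param R \<one>\<^bsub>R\<^esub>)) id_morphism \<and>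
      (\<forall>p\<in>topspace (rs_topology (Spec R)).
        curve_connects (residue_field R p) (Spec R)
          (comp_morphism (affine_line R) g
            (base_change_line R (residue_field R p) (residue_map R p)))
          (point_inclusion R p)
          (comp_morphism (Spec k)
            (Spec_map R k (classifying_hom k n R c U k id (monomial_ideal n \<Delta> k)))
            (comp_morphism (Spec R) (Spec_map k R c) (point_inclusion R p)))))
    \<and> (connected_space (rs_topology (Spec k)) \<longrightarrow> connected_space (rs_topology (Spec R)))"
proof -
  interpret hilb_representation k R c n r \<Delta> U
    by (rule hilb_representation.intro[OF assms(1,3,4,5,8)])
  let ?\<psi> = "classifying_hom k n R c U k id (monomial_ideal n \<Delta> k)"
  obtain \<phi> where \<phi>: "\<phi> \<in> ring_hom R (UP R)" and \<psi>: "?\<psi> \<in> ring_hom R k"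
    and \<phi>_c: "\<And>x. x \<in> carrier k \<Longrightarrow> \<phi> (c x) = const_poly R (c x)"
    and one: "\<And>x. x \<in> carrier R \<Longrightarrow> eval R R id \<one>\<^bsub>R\<^esub> (\<phi> x) = x"
    and zero: "\<And>x. x \<in> carrier R \<Longrightarrow> eval R R id \<zero>\<^bsub>R\<^esub> (\<phi> x) = c (?\<psi> x)"
    using deformation by metis
  note k = cring_k and R = cring_R and c = c_hom
  note UP = cring_UP and ev = eval_hom
  define g where "g = Spec_map R (UP R) \<phi>"
  interpret cR: cring R by (rule R)
  have g: "morphism (affine_line R) (Spec R) g"
    unfolding g_def affine_line_def by (rule morphism_Spec_map[OF R UP[OF R] \<phi>])
  have over_k: "morphism_eq (affine_line R) (Spec k) (comp_morphism (Spec R) (Spec_map k R c) g)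
      (Spec_map k (UP R) (\<lambda>a. const_poly R (c a)))"
    unfolding g_def affine_line_def by (rule Spec_map_comp[OF k R UP[OF R] c \<phi>]) (rule \<phi>_c)
  have at_one: "morphism_eq (Spec R) (Spec R) (comp_morphism (affine_line R) g (at_param R \<one>\<^bsub>R\<^esub>)) id_morphism"
    unfolding g_def affine_line_def at_param_def
    by (rule morphism_eq_trans[OF Spec_map_comp[OF R UP[OF R] R \<phi> ev[OF R cR.one_closed]] Spec_map_id[OF R refl]])
      (rule one)
  have curve: "curve_connects (residue_field R p) (Spec R)
      (comp_morphism (affine_line R) g (base_change_line R (residue_field R p) (residue_map R p)))
      (point_inclusion R p)
      (comp_morphism (Spec k) (Spec_map R k ?\<psi>) (comp_morphism (Spec R) (Spec_map k R c) (point_inclusion R p)))"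
    if "primeideal p R" for p
  proof -
    let ?F = "residue_field R p" and ?h = "residue_map R p"
    note F = primeideal.residue_field_cring[OF that] and h = primeideal.residue_map_hom[OF that]
    interpret F: cring ?F by (rule F)
    interpret h: ring_hom_cring R ?F ?h by (rule ring_hom_cringI[OF R F h])
    let ?\<gamma> = "comp_morphism (affine_line R) g (base_change_line R ?F ?h)"
    let ?\<chi> = "\<lambda>a. up_map ?h (\<phi> a)"
    have uh: "up_map ?h \<in> ring_hom (UP R) (UP ?F)" by (rule up_map_hom[OF R F h])
    have \<chi>: "?\<chi> \<in> ring_hom R (UP ?F)" using ring_hom_trans[OF \<phi> uh] by (simp add: comp_def)
    have \<gamma>_eq: "morphism_eq (affine_line ?F) (Spec R) ?\<gamma> (Spec_map R (UP ?F) ?\<chi>)"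
      unfolding g_def affine_line_def base_change_line_def
      by (rule Spec_map_comp[OF R UP[OF R] UP[OF F] \<phi> uh]) (rule refl)
    have bc: "morphism (affine_line ?F) (affine_line R) (base_change_line R ?F ?h)"
      unfolding affine_line_def base_change_line_def by (rule morphism_Spec_map[OF UP[OF R] UP[OF F] uh])
    have "morphism (affine_line ?F) (Spec R) (Spec_map R (UP ?F) ?\<chi>)"
      unfolding affine_line_def by (rule morphism_Spec_map[OF R UP[OF F] \<chi>])
    then have \<gamma>: "morphism (affine_line ?F) (Spec R) ?\<gamma>"
      by (rule morphism_comp[OF bc g _ morphism_eq_sym[OF \<gamma>_eq]])
    \<comment> \<open>Evaluation commutes with the residue map, so the restriction of the curve to a
      parameter coming from \<open>R\<close> is induced by evaluating \<open>\<phi>\<close> over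
      \<open>R\<close> first. The parameters 1 and 0 are of this kind.\<close>
    have at: "morphism_eq (Spec ?F) (Spec R) (comp_morphism (affine_line ?F) ?\<gamma> (at_param ?F (?h s)))
        (Spec_map R ?F (\<lambda>a. ?h (eval R R id s (\<phi> a))))" if s: "s \<in> carrier R" for s
    proof -
      have hs: "?h s \<in> carrier ?F" using s by simp
      have ap: "morphism (Spec ?F) (affine_line ?F) (at_param ?F (?h s))"
        unfolding affine_line_def at_param_def by (rule morphism_Spec_map[OF UP[OF F] F ev[OF F hs]])
      have "morphism_eq (Spec ?F) (Spec R)
          (comp_morphism (affine_line ?F) (Spec_map R (UP ?F) ?\<chi>) (at_param ?F (?h s)))
          (Spec_map R ?F (\<lambda>a. ?h (eval R R id s (\<phi> a))))"
        unfolding affine_line_def at_param_def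
        by (rule Spec_map_comp[OF R UP[OF F] F \<chi> ev[OF F hs]])
          (rule eval_up_map[OF R F h s ring_hom_closed[OF \<phi>]])
      with comp_morphism_cong_left[OF ap \<gamma>_eq] show ?thesis by (rule morphism_eq_trans)
    qed
    \<comment> \<open>Ring maps with equal values on the carrier may differ as functions. Their
      induced morphisms are identified because both equal one composite with the morphism of the
      identity.\<close>
    have Spec_map_cong: "morphism_eq (Spec ?F) (Spec R) (Spec_map R ?F f) (Spec_map R ?F f')"
      if "f \<in> ring_hom R ?F" "\<And>a. a \<in> carrier R \<Longrightarrow> f a = f' a" for f f'
    proof (rule morphism_eq_trans[OF morphism_eq_sym])
      show "morphism_eq (Spec ?F) (Spec R) (comp_morphism (Spec R) (Spec_map R R id) (Spec_map R ?F f)) (Spec_map R ?F f)"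
        by (rule Spec_map_comp[OF R R F id_ring_hom that(1)]) simp
      show "morphism_eq (Spec ?F) (Spec R) (comp_morphism (Spec R) (Spec_map R R id) (Spec_map R ?F f)) (Spec_map R ?F f')"
        by (rule Spec_map_comp[OF R R F id_ring_hom that(1)]) (simp add: that(2))
    qed
    have ev_hom: "(\<lambda>a. ?h (eval R R id s (\<phi> a))) \<in> ring_hom R ?F" if "s \<in> carrier R" for s
      using ring_hom_trans[OF ring_hom_trans[OF \<phi> ev[OF R that]] h] by (simp add: comp_def)
    have "morphism_eq (Spec ?F) (Spec R) (Spec_map R ?F (\<lambda>a. ?h (eval R R id \<one>\<^bsub>R\<^esub> (\<phi> a)))) (point_inclusion R p)"
      unfolding point_inclusion_def by (rule Spec_map_cong[OF ev_hom[OF cR.one_closed]]) (simp add: one)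
    with at[OF cR.one_closed] have 1: "morphism_eq (Spec ?F) (Spec R)
        (comp_morphism (affine_line ?F) ?\<gamma> (at_param ?F \<one>\<^bsub>?F\<^esub>)) (point_inclusion R p)"
      unfolding h.hom_one by (rule morphism_eq_trans)
    \<comment> \<open>This point goes down to Spec k and back along the section, so it is induced by
      residue map after \<open>c\<close> after \<open>\<psi>\<close>; by \<open>zero\<close>, that
      is evaluation at t = 0 followed by the residue map.\<close>
    let ?v = "comp_morphism (Spec k) (Spec_map R k ?\<psi>) (comp_morphism (Spec R) (Spec_map k R c) (point_inclusion R p))"
    have hc: "(\<lambda>a. ?h (c a)) \<in> ring_hom k ?F" using ring_hom_trans[OF c h] by (simp add: comp_def)
    have "morphism_eq (Spec ?F) (Spec k) (comp_morphism (Spec R) (Spec_map k R c) (point_inclusion R p))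
        (Spec_map k ?F (\<lambda>a. ?h (c a)))"
      unfolding point_inclusion_def by (rule Spec_map_comp[OF k R F c h]) (rule refl)
    then have "morphism_eq (Spec ?F) (Spec R) ?v (comp_morphism (Spec k) (Spec_map R k ?\<psi>) (Spec_map k ?F (\<lambda>a. ?h (c a))))"
      by (rule comp_morphism_cong_right[OF morphism_Spec_map[OF R k \<psi>]])
    moreover have "morphism_eq (Spec ?F) (Spec R) (comp_morphism (Spec k) (Spec_map R k ?\<psi>) (Spec_map k ?F (\<lambda>a. ?h (c a))))
        (Spec_map R ?F (\<lambda>a. ?h (eval R R id \<zero>\<^bsub>R\<^esub> (\<phi> a))))"
      by (rule Spec_map_comp[OF R k F \<psi> hc]) (simp add: zero)
    ultimately have "morphism_eq (Spec ?F) (Spec R) ?v (Spec_map R ?F (\<lambda>a. ?h (eval R R id \<zero>\<^bsub>R\<^esub> (\<phi> a))))"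
      by (rule morphism_eq_trans)
    from at[OF cR.zero_closed] morphism_eq_sym[OF this] have 0: "morphism_eq (Spec ?F) (Spec R)
        (comp_morphism (affine_line ?F) ?\<gamma> (at_param ?F \<zero>\<^bsub>?F\<^esub>)) ?v"
      unfolding h.hom_zero by (rule morphism_eq_trans)
    show ?thesis unfolding curve_connects_def using \<gamma> 1 0 by (intro conjI)
  qed
  have "connected_space (rs_topology (Spec k)) \<longrightarrow> connected_space (rs_topology (Spec R))"
    unfolding Spec_topology using connected_Spec[OF R k c \<phi> \<psi> one zero] by (rule impI)
  moreover have "\<forall>p\<in>topspace (rs_topology (Spec R)). curve_connects (residue_field R p) (Spec R)
      (comp_morphism (affine_line R) g (base_change_line R (residue_field R p) (residue_map R p)))
      (point_inclusion R p)
      (comp_morphism (Spec k) (Spec_map R k ?\<psi>) (comp_morphism (Spec R) (Spec_map k R c) (point_inclusion R p)))"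
    unfolding Spec_topology topspace_zariski[OF R] using curve by (intro ballI) (rule curve, simp)
  ultimately show ?thesis using g over_k at_one by (intro conjI exI[of _ g])
qed

end
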